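(* Let $I\subset\mathbb{C}[z_1,\ldots,z_d]$ be a homogeneous ideal such that $Z(I)\cap\partial\mathbb{D}^d\subset\mathbb{T}^d$. Then the quotient module $\mathcal{M}=[I]^\perp$ of $H^2(\mathbb{D}^d)$ is $(1,\infty)$-essentially normal, i.e. $[S_{z_i}^*,S_{z_j}]\in\mathcal{L}^{(1,\infty)}$ for all $i,j=1,\ldots,d$, where $S_{z_i}=P_{\mathcal{M}}M_{z_i}|_{\mathcal{M}}$.
   Context: $d\ge 3$ is an integer, $\mathbb{D}$ is the open unit disc in $\mathbb{C}$, $\mathbb{T}$ the unit circle, $\mathbb{D}^d$ the unit polydisc, $\partial\mathbb{D}^d$ its topological boundary in $\mathbb{C}^d$. $H^2(\mathbb{D}^d)$ is the Hardy space over $\mathbb{D}^d$, in which the monomials $z^\gamma$, $\gamma\in\mathbb{Z}_+^d$, form an orthonormal basis. $M_{z_i}$ is multiplication by $z_i$ on $H^2(\mathbb{D}^d)$. A homogeneous ideal is an ideal generated by homogeneous polynomials. $Z(I)\subset\mathbb{C}^d$ is the common zero set of $I$. $[I]$ is the closure of $I$ in $H^2(\mathbb{D}^d)$, and $[I]^\perp$ its orthogonal complement; $P_{\mathcal{M}}$ is the orthogonal projection onto $\mathcal{M}$. $[A,B]=AB-BA$. For $p\ge1$, $\mathcal{L}^{(p,\infty)}$ denotes the ideal of compact operators whose decreasingly ordered singular values $s_1\ge s_2\ge\cdots$ satisfy $s_n=O(n^{-1/p})$. *)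

theory Defs
  imports
    "HOL-Analysis.Analysis"
    "HOL-Library.Poly_Mapping"
    "HOL-Library.Landau_Symbols"
begin

section \<open>Polynomials in several variables\<close>

text \<open>
  The finite type \<open>'d\<close> indexes the variables, and \<open>'d \<Rightarrow>\<^sub>0 nat\<close> is the type of
  multi-indices. The convolution product of \<open>Poly_Mapping\<close> makes the type of finitely supported
  coefficient families below the polynomial ring over the complex numbers.
\<close>

type_synonym 'd mpoly = "('d \<Rightarrow>\<^sub>0 nat) \<Rightarrow>\<^sub>0 complex"

definition monom_eval :: "('d::finite \<Rightarrow>\<^sub>0 nat) \<Rightarrow> complex ^ 'd \<Rightarrow> complex"
  where "monom_eval \<gamma> z = (\<Prod>i\<in>UNIV. z $ i ^ Poly_Mapping.lookup \<gamma> i)"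

definition poly_eval :: "'d::finite mpoly \<Rightarrow> complex ^ 'd \<Rightarrow> complex"
  where "poly_eval p z = (\<Sum>\<gamma>\<in>Poly_Mapping.keys p. Poly_Mapping.lookup p \<gamma> * monom_eval \<gamma> z)"

definition homogeneous_poly :: "'d::finite mpoly \<Rightarrow> bool"
  where "homogeneous_poly p \<longleftrightarrow> (\<exists>n. \<forall>\<gamma>\<in>Poly_Mapping.keys p. (\<Sum>i\<in>UNIV. Poly_Mapping.lookup \<gamma> i) = n)"

text \<open>The ideal generated by a set is its span in the ring viewed as a module over itself.\<close>

definition homogeneous_ideal :: "'d::finite mpoly set \<Rightarrow> bool"
  where "homogeneous_ideal I \<longleftrightarrow> (\<exists>B. (\<forall>p\<in>B. homogeneous_poly p) \<and> I = module.span (*) B)"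

definition zero_set :: "'d::finite mpoly set \<Rightarrow> (complex ^ 'd) set"
  where "zero_set I = {z. \<forall>p\<in>I. poly_eval p z = 0}"

definition polydisc :: "(complex ^ 'd::finite) set"
  where "polydisc = {z. \<forall>i. cmod (z $ i) < 1}"

definition torus :: "(complex ^ 'd::finite) set"
  where "torus = {z. \<forall>i. cmod (z $ i) = 1}"


section \<open>Power series with square-summable coefficients\<close>

definition square_summable :: "(('d::finite \<Rightarrow>\<^sub>0 nat) \<Rightarrow> complex) \<Rightarrow> bool"
  where "square_summable a \<longleftrightarrow> (\<lambda>\<gamma>. (cmod (a \<gamma>))\<^sup>2) summable_on UNIV"

text \<open>Functions on the polydisc are extended by zero, so that equality is equality on the polydisc.\<close>

definition power_series :: "(('d::finite \<Rightarrow>\<^sub>0 nat) \<Rightarrow> complex) \<Rightarrow> complex ^ 'd \<Rightarrow> complex"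
  where "power_series a z = (if z \<in> polydisc then \<Sum>\<^sub>\<infinity>\<gamma>. a \<gamma> * monom_eval \<gamma> z else 0)"

lemma norm_monom_eval: "cmod (monom_eval \<gamma> z) = (\<Prod>i\<in>UNIV. cmod (z $ i) ^ Poly_Mapping.lookup \<gamma> i)"
  by (simp add: monom_eval_def prod_norm[symmetric] norm_power)

lemma norm_monom_eval_le_1:
  assumes "z \<in> polydisc"
  shows "cmod (monom_eval \<gamma> z) \<le> 1"
  unfolding norm_monom_eval using assms
  by (intro prod_le_1) (auto simp: polydisc_def intro!: power_le_one intro: less_imp_le)

lemma monom_eval_add: "monom_eval (\<gamma> + \<delta>) z = monom_eval \<gamma> z * monom_eval \<delta> z"
  by (simp add: monom_eval_def lookup_add power_add prod.distrib)

lemma monom_eval_single [simp]: "monom_eval (Poly_Mapping.single i 1) z = z $ i"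
proof -
  have "monom_eval (Poly_Mapping.single i 1) z = (\<Prod>j\<in>UNIV. if j = i then z $ i else 1)"
    unfolding monom_eval_def by (rule prod.cong) (auto simp: lookup_single when_def)
  thus ?thesis by simp
qed

lemma monom_eval_summable:
  fixes z :: "complex ^ 'd::finite"
  assumes z: "z \<in> polydisc"
  shows "(\<lambda>\<gamma>. cmod (monom_eval \<gamma> z)) summable_on UNIV"
proof (rule nonneg_bounded_partial_sums_imp_summable_on)
  let ?r = "\<lambda>i. cmod (z $ i)"
  have r: "?r i < 1" for i using z by (auto simp: polydisc_def)
  show "\<forall>\<^sub>F X in finite_subsets_at_top UNIV.
      (\<Sum>\<gamma>\<in>X. cmod (monom_eval \<gamma> z)) \<le> (\<Prod>i\<in>UNIV. 1 / (1 - ?r i))"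
    unfolding eventually_finite_subsets_at_top
  proof (intro exI[of _ "{}"] conjI allI impI; clarsimp?)
    fix F :: "('d \<Rightarrow>\<^sub>0 nat) set" assume F: "finite F"
    define N where "N = Max (insert 0 ((\<lambda>(\<gamma>, i). Poly_Mapping.lookup \<gamma> i) ` (F \<times> UNIV)))"
    have N: "Poly_Mapping.lookup \<gamma> i \<le> N" if "\<gamma> \<in> F" for \<gamma> i
      unfolding N_def using F that by (intro Max_ge) (auto intro!: image_eqI[of _ _ "(\<gamma>, i)"])
    have "(\<Sum>\<gamma>\<in>F. cmod (monom_eval \<gamma> z)) = (\<Sum>g\<in>Poly_Mapping.lookup ` F. \<Prod>i\<in>UNIV. ?r i ^ g i)"
      by (subst sum.reindex) (auto simp: norm_monom_eval inj_on_def lookup_inject)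
    also have "\<dots> \<le> (\<Sum>g\<in>PiE UNIV (\<lambda>_. {..N}). \<Prod>i\<in>UNIV. ?r i ^ g i)"
      by (rule sum_mono2) (auto intro!: finite_PiE prod_nonneg N)
    also have "\<dots> = (\<Prod>i\<in>UNIV. \<Sum>n\<le>N. ?r i ^ n)"
      by (rule prod_sum_PiE[symmetric]) auto
    also have "\<dots> \<le> (\<Prod>i\<in>UNIV. 1 / (1 - ?r i))"
    proof (rule prod_mono, safe)
      fix i
      show "0 \<le> (\<Sum>n\<le>N. ?r i ^ n)" by (intro sum_nonneg) auto
      have "(\<Sum>n\<le>N. ?r i ^ n) \<le> suminf (\<lambda>n. ?r i ^ n)"
        using r[of i] by (intro sum_le_suminf summable_geometric) auto
      thus "(\<Sum>n\<le>N. ?r i ^ n) \<le> 1 / (1 - ?r i)"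
        using r[of i] by (simp add: suminf_geometric)
    qed
    finally show "(\<Sum>\<gamma>\<in>F. cmod (monom_eval \<gamma> z)) \<le> (\<Prod>i\<in>UNIV. 1 / (1 - ?r i))" .
  qed
qed auto

lemma power_series_abs_summable:
  assumes a: "square_summable a" and z: "z \<in> polydisc"
  shows "(\<lambda>\<gamma>. cmod (a \<gamma> * monom_eval \<gamma> z)) summable_on UNIV"
proof (rule summable_on_comparison_test)
  show "(\<lambda>\<gamma>. (cmod (a \<gamma>))\<^sup>2 + cmod (monom_eval \<gamma> z)) summable_on UNIV"
    using a monom_eval_summable[OF z] unfolding square_summable_def by (rule summable_on_add)
  fix \<gamma>
  let ?x = "cmod (a \<gamma>)" and ?y = "cmod (monom_eval \<gamma> z)"
  have y: "0 \<le> ?y" "?y \<le> 1" using norm_monom_eval_le_1[OF z] by auto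
  have "?y\<^sup>2 \<le> ?y" using y by (simp add: power2_eq_square mult_left_le)
  moreover have "2 * (?x * ?y) \<le> ?x\<^sup>2 + ?y\<^sup>2"
    using sum_squares_bound[of ?x ?y] by simp
  moreover have "0 \<le> ?x * ?y" by simp
  ultimately show "cmod (a \<gamma> * monom_eval \<gamma> z) \<le> ?x\<^sup>2 + ?y"
    unfolding norm_mult by linarith
qed auto

lemma power_series_summable:
  assumes "square_summable a" and "z \<in> polydisc"
  shows "(\<lambda>\<gamma>. a \<gamma> * monom_eval \<gamma> z) summable_on UNIV"
  using power_series_abs_summable[OF assms] by (rule abs_summable_summable)

lemma square_summable_add:
  assumes "square_summable a" "square_summable b"
  shows "square_summable (\<lambda>\<gamma>. a \<gamma> + b \<gamma>)"
  unfolding square_summable_def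
proof (rule summable_on_comparison_test)
  show "(\<lambda>\<gamma>. 2 * (cmod (a \<gamma>))\<^sup>2 + 2 * (cmod (b \<gamma>))\<^sup>2) summable_on UNIV"
    using assms unfolding square_summable_def
    by (intro summable_on_add summable_on_cmult_right)
  fix \<gamma>
  have "(cmod (a \<gamma> + b \<gamma>))\<^sup>2 \<le> (cmod (a \<gamma>) + cmod (b \<gamma>))\<^sup>2"
    by (intro power_mono norm_triangle_ineq) auto
  also have "\<dots> \<le> 2 * (cmod (a \<gamma>))\<^sup>2 + 2 * (cmod (b \<gamma>))\<^sup>2"
    using sum_squares_bound[of "cmod (a \<gamma>)" "cmod (b \<gamma>)"] by (simp add: power2_sum)
  finally show "(cmod (a \<gamma> + b \<gamma>))\<^sup>2 \<le> 2 * (cmod (a \<gamma>))\<^sup>2 + 2 * (cmod (b \<gamma>))\<^sup>2" .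
qed auto

lemma square_summable_cmult:
  assumes "square_summable a"
  shows "square_summable (\<lambda>\<gamma>. c * a \<gamma>)"
  using assms unfolding square_summable_def norm_mult power_mult_distrib
  by (rule summable_on_cmult_right)

lemma square_summable_finite:
  assumes "finite {\<gamma>. a \<gamma> \<noteq> 0}"
  shows "square_summable a"
  unfolding square_summable_def
  by (rule finite_nonzero_values_imp_summable_on) (use assms in simp)

lemma power_series_add:
  assumes "square_summable a" "square_summable b"
  shows "power_series (\<lambda>\<gamma>. a \<gamma> + b \<gamma>) = (\<lambda>z. power_series a z + power_series b z)"
  using assms
  by (auto simp: power_series_def fun_eq_iff distrib_right infsum_add power_series_summable)

lemma power_series_cmult:
  "power_series (\<lambda>\<gamma>. c * a \<gamma>) = (\<lambda>z. c * power_series a z)"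
  by (auto simp: power_series_def fun_eq_iff infsum_cmult_right' mult.assoc)

lemma power_series_zero: "power_series (\<lambda>_. 0) = (\<lambda>_. 0)"
  by (auto simp: power_series_def)

text \<open>
  Uniqueness of the coefficients. Among the coefficients of least total degree pick the one whose
  multi-index is longest; it is then the only one of least weight for suitable integral weights
  of the variables, and is found by letting the argument tend to zero along the weighted curve.
\<close>

lemma power_series_eq_0:
  fixes a :: "('d::finite \<Rightarrow>\<^sub>0 nat) \<Rightarrow> complex"
  assumes a: "square_summable a" and 0: "power_series a = (\<lambda>_. 0)"
  shows "a = (\<lambda>_. 0)"
proof (rule ccontr)
  assume "a \<noteq> (\<lambda>_. 0)"
  then obtain \<delta> where \<delta>: "a \<delta> \<noteq> 0" by auto
  define deg where "deg = (\<lambda>\<gamma> :: 'd \<Rightarrow>\<^sub>0 nat. \<Sum>i\<in>UNIV. Poly_Mapping.lookup \<gamma> i)"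
  define sq where "sq = (\<lambda>\<gamma> :: 'd \<Rightarrow>\<^sub>0 nat. \<Sum>i\<in>UNIV. (Poly_Mapping.lookup \<gamma> i)\<^sup>2)"
  define n where "n = (LEAST n. \<exists>\<gamma>. a \<gamma> \<noteq> 0 \<and> deg \<gamma> = n)"
  have ex: "\<exists>\<gamma>. a \<gamma> \<noteq> 0 \<and> deg \<gamma> = n"
    unfolding n_def by (rule LeastI[of _ "deg \<delta>"]) (use \<delta> in auto)
  have n_le: "n \<le> deg \<gamma>" if "a \<gamma> \<noteq> 0" for \<gamma>
    unfolding n_def by (rule Least_le) (use that in auto)
  have le_deg: "Poly_Mapping.lookup \<gamma> i \<le> deg \<gamma>" for \<gamma> i
    unfolding deg_def by (rule member_le_sum) auto
  have sq_le: "sq \<gamma> \<le> card (UNIV :: 'd set) * n\<^sup>2" if "deg \<gamma> = n" for \<gamma>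
    unfolding sq_def using le_deg[of \<gamma>] that
    by (intro sum_bounded_above[of UNIV _ "n\<^sup>2", simplified]) auto
  have "\<exists>\<gamma>0. (a \<gamma>0 \<noteq> 0 \<and> deg \<gamma>0 = n) \<and> (\<forall>\<gamma>. (a \<gamma> \<noteq> 0 \<and> deg \<gamma> = n) \<longrightarrow> sq \<gamma> \<le> sq \<gamma>0)"
    by (rule ex_has_greatest_nat[of _ "SOME \<gamma>. a \<gamma> \<noteq> 0 \<and> deg \<gamma> = n" _ "Suc (card (UNIV :: 'd set) * n\<^sup>2)"])
       (use someI_ex[OF ex] sq_le in \<open>auto simp: less_Suc_eq_le\<close>)
  then obtain \<gamma>0 where g0: "a \<gamma>0 \<noteq> 0 \<and> deg \<gamma>0 = n"
    and g0_max: "\<And>\<gamma>. a \<gamma> \<noteq> 0 \<and> deg \<gamma> = n \<Longrightarrow> sq \<gamma> \<le> sq \<gamma>0"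
    by auto
  define K where "K = n * (n + 1) + 1"
  define w where "w = (\<lambda>i. K - Poly_Mapping.lookup \<gamma>0 i)"
  have lk: "Poly_Mapping.lookup \<gamma>0 i \<le> n" for i using le_deg[of \<gamma>0 i] g0 by simp
  have nK: "n < K" unfolding K_def by simp
  have w_pos: "0 < w i" for i unfolding w_def using lk[of i] nK by simp
  define W where "W = (\<lambda>\<gamma> :: 'd \<Rightarrow>\<^sub>0 nat. \<Sum>i\<in>UNIV. w i * Poly_Mapping.lookup \<gamma> i)"
  have W_int: "int (W \<gamma>) = int K * int (deg \<gamma>) - (\<Sum>i\<in>UNIV. int (Poly_Mapping.lookup \<gamma>0 i) * int (Poly_Mapping.lookup \<gamma> i))"
    for \<gamma>
  proof -
    have "int (w i) = int K - int (Poly_Mapping.lookup \<gamma>0 i)" for i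
      unfolding w_def using lk[of i] nK by simp
    hence "int (W \<gamma>) = (\<Sum>i\<in>UNIV. int K * int (Poly_Mapping.lookup \<gamma> i)
        - int (Poly_Mapping.lookup \<gamma>0 i) * int (Poly_Mapping.lookup \<gamma> i))"
      unfolding W_def of_nat_sum of_nat_mult by (simp only: left_diff_distrib)
    thus ?thesis unfolding deg_def of_nat_sum sum_distrib_left sum_subtractf .
  qed
  have W_less: "W \<gamma>0 < W \<gamma>" if g: "a \<gamma> \<noteq> 0" "\<gamma> \<noteq> \<gamma>0" for \<gamma>
  proof (cases "deg \<gamma> = n")
    case True
    obtain j where j: "Poly_Mapping.lookup \<gamma> j \<noteq> Poly_Mapping.lookup \<gamma>0 j"
      using g(2) by (metis poly_mapping_eqI)
    have "0 < (int (Poly_Mapping.lookup \<gamma>0 j) - int (Poly_Mapping.lookup \<gamma> j))\<^sup>2" using j by simp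
    also have "\<dots> \<le> (\<Sum>i\<in>UNIV. (int (Poly_Mapping.lookup \<gamma>0 i) - int (Poly_Mapping.lookup \<gamma> i))\<^sup>2)"
      by (rule member_le_sum) auto
    also have "\<dots> = (\<Sum>i\<in>UNIV. int (Poly_Mapping.lookup \<gamma>0 i)^2 + int (Poly_Mapping.lookup \<gamma> i)^2
                       - 2 * (int (Poly_Mapping.lookup \<gamma>0 i) * int (Poly_Mapping.lookup \<gamma> i)))"
      by (rule sum.cong) (auto simp: power2_diff)
    also have "\<dots> = int (sq \<gamma>0) + int (sq \<gamma>)
        - 2 * (\<Sum>i\<in>UNIV. int (Poly_Mapping.lookup \<gamma>0 i) * int (Poly_Mapping.lookup \<gamma> i))"
      by (simp add: sq_def sum_subtractf sum.distrib sum_distrib_left)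
    finally have "2 * (\<Sum>i\<in>UNIV. int (Poly_Mapping.lookup \<gamma>0 i) * int (Poly_Mapping.lookup \<gamma> i)) < int (sq \<gamma>0) + int (sq \<gamma>)"
      by simp
    moreover have "int (sq \<gamma>) \<le> int (sq \<gamma>0)" using g0_max[of \<gamma>] g True by simp
    ultimately have "(\<Sum>i\<in>UNIV. int (Poly_Mapping.lookup \<gamma>0 i) * int (Poly_Mapping.lookup \<gamma> i)) < int (sq \<gamma>0)"
      by linarith
    moreover have "(\<Sum>i\<in>UNIV. int (Poly_Mapping.lookup \<gamma>0 i) * int (Poly_Mapping.lookup \<gamma>0 i)) = int (sq \<gamma>0)"
      by (simp add: sq_def power2_eq_square)
    ultimately have "int (W \<gamma>0) < int (W \<gamma>)"
      unfolding W_int using True g0 by simp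
    thus ?thesis by simp
  next
    case False
    hence d: "n + 1 \<le> deg \<gamma>" using n_le[OF g(1)] by simp
    have "(\<Sum>i\<in>UNIV. int (Poly_Mapping.lookup \<gamma>0 i) * int (Poly_Mapping.lookup \<gamma> i)) \<le> (\<Sum>i\<in>UNIV. int n * int (Poly_Mapping.lookup \<gamma> i))"
      by (intro sum_mono mult_right_mono) (use lk in auto)
    also have "\<dots> = int n * int (deg \<gamma>)" by (simp add: deg_def sum_distrib_left)
    finally have "int (W \<gamma>) \<ge> (int K - int n) * int (deg \<gamma>)"
      unfolding W_int by (simp add: left_diff_distrib)
    moreover have "(int K - int n) * int (deg \<gamma>) \<ge> (int K - int n) * (int n + 1)"
      using d nK by (intro mult_left_mono) auto
    moreover have "(int K - int n) * (int n + 1) > int K * int n"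
      by (simp add: K_def algebra_simps)
    moreover have "int (W \<gamma>0) \<le> int K * int n"
      unfolding W_int using g0 by (simp add: sum_nonneg)
    ultimately show ?thesis by linarith
  qed
  define c where "c = (\<lambda>t::real. (\<chi> i. complex_of_real (t ^ w i)) :: complex ^ 'd)"
  have c_disc: "c t \<in> polydisc" if "0 < t" "t < 1" for t
    using that w_pos by (auto simp: c_def polydisc_def norm_power power_less_one_iff)
  have c_monom: "monom_eval \<gamma> (c t) = complex_of_real (t ^ W \<gamma>)" for \<gamma> t
    by (simp add: monom_eval_def c_def W_def power_mult[symmetric] power_sum)
  define h :: real where "h = 1 / 2"
  have h: "0 < h" by (simp add: h_def)
  define S where "S = (\<Sum>\<^sub>\<infinity>\<gamma>\<in>UNIV - {\<gamma>0}. cmod (a \<gamma> * monom_eval \<gamma> (c h)))"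
  have hd: "c h \<in> polydisc" by (rule c_disc) (auto simp: h_def)
  have Ssum: "(\<lambda>\<gamma>. cmod (a \<gamma> * monom_eval \<gamma> (c h))) summable_on (UNIV - {\<gamma>0})"
    using power_series_abs_summable[OF a hd] by (rule summable_on_subset_banach) auto
  have bound: "cmod (a \<gamma>0) * h ^ W \<gamma>0 \<le> u * S" if u: "0 < u" "u < 1" for u
  proof -
    have ud: "c (u * h) \<in> polydisc"
      by (rule c_disc) (use u in \<open>auto simp: h_def\<close>)
    let ?f = "\<lambda>\<gamma>. a \<gamma> * monom_eval \<gamma> (c (u * h))"
    have fs: "?f summable_on UNIV" by (rule power_series_summable[OF a ud])
    have fs': "(\<lambda>\<gamma>. cmod (?f \<gamma>)) summable_on (UNIV - {\<gamma>0})"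
      using power_series_abs_summable[OF a ud] by (rule summable_on_subset_banach) auto
    have fs'': "?f summable_on (UNIV - {\<gamma>0})"
      using fs by (rule summable_on_subset_banach) auto
    have "infsum ?f UNIV = 0"
      using fun_cong[OF 0, of "c (u * h)"] ud by (simp add: power_series_def)
    moreover have "infsum ?f (insert \<gamma>0 (UNIV - {\<gamma>0})) = ?f \<gamma>0 + infsum ?f (UNIV - {\<gamma>0})"
      by (rule infsum_insert[OF fs'']) auto
    ultimately have "?f \<gamma>0 = - infsum ?f (UNIV - {\<gamma>0})"
      by (simp add: insert_Diff_if insert_absorb eq_neg_iff_add_eq_0 insert_UNIV)
    hence "cmod (?f \<gamma>0) = cmod (infsum ?f (UNIV - {\<gamma>0}))" by simp
    also have "\<dots> \<le> (\<Sum>\<^sub>\<infinity>\<gamma>\<in>UNIV - {\<gamma>0}. cmod (?f \<gamma>))"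
      by (rule norm_infsum_bound[OF fs'])
    also have "\<dots> \<le> (\<Sum>\<^sub>\<infinity>\<gamma>\<in>UNIV - {\<gamma>0}. u ^ Suc (W \<gamma>0) * cmod (a \<gamma> * monom_eval \<gamma> (c h)))"
    proof (rule infsum_mono[OF fs'])
      show "(\<lambda>\<gamma>. u ^ Suc (W \<gamma>0) * cmod (a \<gamma> * monom_eval \<gamma> (c h))) summable_on (UNIV - {\<gamma>0})"
        by (rule summable_on_cmult_right[OF Ssum])
      fix \<gamma> assume \<gamma>: "\<gamma> \<in> UNIV - {\<gamma>0}"
      show "cmod (?f \<gamma>) \<le> u ^ Suc (W \<gamma>0) * cmod (a \<gamma> * monom_eval \<gamma> (c h))"
      proof (cases "a \<gamma> = 0")
        case False
        have "u ^ W \<gamma> \<le> u ^ Suc (W \<gamma>0)"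
          using W_less[OF False] \<gamma> u by (intro power_decreasing) auto
        hence "cmod (a \<gamma>) * h ^ W \<gamma> * u ^ W \<gamma> \<le> cmod (a \<gamma>) * h ^ W \<gamma> * u ^ Suc (W \<gamma>0)"
          using h by (intro mult_left_mono) auto
        thus ?thesis using u h
          by (simp add: c_monom norm_mult norm_power power_mult_distrib mult_ac)
      qed simp
    qed
    also have "\<dots> = u ^ Suc (W \<gamma>0) * S" unfolding S_def by (rule infsum_cmult_right')
    finally have "u ^ W \<gamma>0 * (cmod (a \<gamma>0) * h ^ W \<gamma>0) \<le> u ^ W \<gamma>0 * (u * S)"
      using u h by (simp add: c_monom norm_mult norm_power power_mult_distrib mult_ac)
    thus ?thesis using u by simp
  qed
  have "((\<lambda>u. u * S) \<longlongrightarrow> 0 * S) (at_right 0)"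
    by (intro tendsto_intros)
  moreover have "\<forall>\<^sub>F u in at_right 0. cmod (a \<gamma>0) * h ^ W \<gamma>0 \<le> u * S"
    unfolding eventually_at_right_field using bound by (intro exI[of _ 1]) auto
  ultimately have "cmod (a \<gamma>0) * h ^ W \<gamma>0 \<le> 0 * S"
    by (intro tendsto_le[OF _ _ tendsto_const]) auto
  moreover have "0 < cmod (a \<gamma>0) * h ^ W \<gamma>0" using g0 by (auto simp: h_def)
  ultimately show False by simp
qed

lemma power_series_inject:
  assumes "square_summable a" "square_summable b"
  shows "power_series a = power_series b \<longleftrightarrow> a = b"
proof
  assume eq: "power_series a = power_series b"
  have b': "square_summable (\<lambda>\<gamma>. - 1 * b \<gamma>)" by (rule square_summable_cmult[OF assms(2)])
  have "power_series (\<lambda>\<gamma>. a \<gamma> + - 1 * b \<gamma>) = (\<lambda>_. 0)"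
    unfolding power_series_add[OF assms(1) b'] power_series_cmult eq by simp
  from power_series_eq_0[OF square_summable_add[OF assms(1) b'] this]
  show "a = b" by (auto simp: fun_eq_iff)
qed simp


section \<open>The Hardy space over the polydisc\<close>

typedef (overloaded) 'd hardy =
  "{power_series a | a. square_summable (a :: ('d::finite \<Rightarrow>\<^sub>0 nat) \<Rightarrow> complex)}"
  morphisms hardy_fun Abs_hardy
  using square_summable_finite[of "\<lambda>_. 0"] by auto

setup_lifting type_definition_hardy

definition hardy_coeff :: "'d::finite hardy \<Rightarrow> ('d \<Rightarrow>\<^sub>0 nat) \<Rightarrow> complex"
  where "hardy_coeff f = (THE a. square_summable a \<and> hardy_fun f = power_series a)"

lemma hardy_coeff_eqI:
  assumes "square_summable a" "hardy_fun f = power_series a"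
  shows "hardy_coeff f = a"
  unfolding hardy_coeff_def using assms power_series_inject by (intro the_equality) auto

lemma
  shows square_summable_hardy_coeff: "square_summable (hardy_coeff f)"
    and hardy_fun_eq: "hardy_fun f = power_series (hardy_coeff f)"
proof -
  obtain a where a: "square_summable a" "hardy_fun f = power_series a"
    using hardy_fun[of f] by auto
  with hardy_coeff_eqI[OF a] show "square_summable (hardy_coeff f)"
    "hardy_fun f = power_series (hardy_coeff f)" by auto
qed

lemma hardy_eq_iff: "f = g \<longleftrightarrow> hardy_coeff f = hardy_coeff g"
  by (metis hardy_fun_eq hardy_fun_inject)

instantiation hardy :: (finite) ab_group_add
begin

lift_definition zero_hardy :: "'a hardy" is "\<lambda>_. 0"
proof (intro CollectI exI conjI)
  show "(\<lambda>_. 0) = power_series (\<lambda>_. 0)" by (rule power_series_zero[symmetric])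
  show "square_summable (\<lambda>_. 0)" by (rule square_summable_finite) simp
qed

lift_definition plus_hardy :: "'a hardy \<Rightarrow> 'a hardy \<Rightarrow> 'a hardy" is "\<lambda>f g z. f z + g z"
proof safe
  fix a b :: "('a \<Rightarrow>\<^sub>0 nat) \<Rightarrow> complex"
  assume "square_summable a" "square_summable b"
  thus "\<exists>c. (\<lambda>z. power_series a z + power_series b z) = power_series c \<and> square_summable c"
    by (intro exI[of _ "\<lambda>\<gamma>. a \<gamma> + b \<gamma>"] conjI power_series_add[symmetric] square_summable_add)
qed

lift_definition uminus_hardy :: "'a hardy \<Rightarrow> 'a hardy" is "\<lambda>f z. - f z"
proof safe
  fix a :: "('a \<Rightarrow>\<^sub>0 nat) \<Rightarrow> complex"
  assume "square_summable a"
  thus "\<exists>b. (\<lambda>z. - power_series a z) = power_series b \<and> square_summable b"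
    using power_series_cmult[of "- 1" a, symmetric]
    by (intro exI[of _ "\<lambda>\<gamma>. - 1 * a \<gamma>"] conjI square_summable_cmult) simp_all
qed

definition minus_hardy :: "'a hardy \<Rightarrow> 'a hardy \<Rightarrow> 'a hardy"
  where "minus_hardy f g = f + - g"

instance
proof
  fix f g h :: "'a hardy"
  note eq = hardy_fun_inject[symmetric] plus_hardy.rep_eq zero_hardy.rep_eq uminus_hardy.rep_eq
  show "f + g + h = f + (g + h)" by (simp only: eq add.assoc)
  show "f + g = g + f" by (simp only: eq add.commute)
  show "0 + f = f" by (simp only: eq add_0)
  show "- f + f = 0" by (simp only: eq ab_left_minus)
qed (rule minus_hardy_def)

end

lift_definition scaleC :: "complex \<Rightarrow> 'd::finite hardy \<Rightarrow> 'd hardy" is "\<lambda>c f z. c * f z"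
proof safe
  fix c :: complex and a :: "('d \<Rightarrow>\<^sub>0 nat) \<Rightarrow> complex"
  assume "square_summable a"
  thus "\<exists>b. (\<lambda>z. c * power_series a z) = power_series b \<and> square_summable b"
    by (intro exI[of _ "\<lambda>\<gamma>. c * a \<gamma>"] conjI power_series_cmult[symmetric] square_summable_cmult)
qed

global_interpretation hardy: vector_space "scaleC :: complex \<Rightarrow> 'd::finite hardy \<Rightarrow> 'd hardy"
proof
  fix f g :: "'d hardy" and a b :: complex
  note eq = hardy_fun_inject[symmetric] plus_hardy.rep_eq scaleC.rep_eq
  show "scaleC a (f + g) = scaleC a f + scaleC a g" by (simp only: eq distrib_left)
  show "scaleC (a + b) f = scaleC a f + scaleC b f" by (simp only: eq distrib_right)
  show "scaleC a (scaleC b f) = scaleC (a * b) f" by (simp only: eq mult.assoc)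
  show "scaleC 1 f = f" by (simp only: eq mult_1)
qed

lemma hardy_coeff_0 [simp]: "hardy_coeff 0 = (\<lambda>_. 0)"
proof (rule hardy_coeff_eqI)
  show "square_summable (\<lambda>_. 0)" by (rule square_summable_finite) simp
qed (simp add: zero_hardy.rep_eq power_series_zero)

lemma hardy_coeff_add [simp]: "hardy_coeff (f + g) = (\<lambda>\<gamma>. hardy_coeff f \<gamma> + hardy_coeff g \<gamma>)"
  using square_summable_hardy_coeff[of f] square_summable_hardy_coeff[of g]
  by (intro hardy_coeff_eqI square_summable_add)
     (simp_all only: plus_hardy.rep_eq power_series_add hardy_fun_eq[of f] hardy_fun_eq[of g])

lemma hardy_coeff_scaleC [simp]: "hardy_coeff (scaleC c f) = (\<lambda>\<gamma>. c * hardy_coeff f \<gamma>)"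
  using square_summable_hardy_coeff[of f]
  by (intro hardy_coeff_eqI square_summable_cmult)
     (simp_all only: scaleC.rep_eq power_series_cmult hardy_fun_eq[of f])

text \<open>The inner product for which the monomials form an orthonormal basis, linear in the first argument.\<close>

definition cinner :: "'d::finite hardy \<Rightarrow> 'd hardy \<Rightarrow> complex"
  where "cinner f g = (\<Sum>\<^sub>\<infinity>\<gamma>. hardy_coeff f \<gamma> * cnj (hardy_coeff g \<gamma>))"

lemma cinner_summable:
  "(\<lambda>\<gamma>. hardy_coeff f \<gamma> * cnj (hardy_coeff g \<gamma>)) summable_on UNIV"
proof (rule abs_summable_summable, rule summable_on_comparison_test)
  show "(\<lambda>\<gamma>. (cmod (hardy_coeff f \<gamma>))\<^sup>2 + (cmod (hardy_coeff g \<gamma>))\<^sup>2) summable_on UNIV"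
    using square_summable_hardy_coeff unfolding square_summable_def by (intro summable_on_add)
  fix \<gamma>
  let ?x = "cmod (hardy_coeff f \<gamma>)" and ?y = "cmod (hardy_coeff g \<gamma>)"
  have "2 * (?x * ?y) \<le> ?x\<^sup>2 + ?y\<^sup>2" using sum_squares_bound[of ?x ?y] by simp
  moreover have "0 \<le> ?x * ?y" by simp
  ultimately show "cmod (hardy_coeff f \<gamma> * cnj (hardy_coeff g \<gamma>)) \<le> ?x\<^sup>2 + ?y\<^sup>2"
    unfolding norm_mult complex_mod_cnj by linarith
qed auto

lemma cinner_add_left: "cinner (f + g) h = cinner f h + cinner g h"
  by (simp add: cinner_def distrib_right infsum_add cinner_summable)

lemma cinner_scaleC_left: "cinner (scaleC c f) g = c * cinner f g"
  by (simp add: cinner_def mult.assoc infsum_cmult_right')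

lemma cinner_commute: "cinner f g = cnj (cinner g f)"
  by (simp add: cinner_def infsum_cnj[symmetric] mult.commute)

lemma cinner_self: "cinner f f = complex_of_real (\<Sum>\<^sub>\<infinity>\<gamma>. (cmod (hardy_coeff f \<gamma>))\<^sup>2)"
proof -
  have "((\<lambda>\<gamma>. complex_of_real ((cmod (hardy_coeff f \<gamma>))\<^sup>2)) has_sum
      complex_of_real (\<Sum>\<^sub>\<infinity>\<gamma>. (cmod (hardy_coeff f \<gamma>))\<^sup>2)) UNIV"
    using square_summable_hardy_coeff[of f] unfolding square_summable_def
    by (intro has_sum_of_real has_sum_infsum)
  hence "((\<lambda>\<gamma>. hardy_coeff f \<gamma> * cnj (hardy_coeff f \<gamma>)) has_sum
      complex_of_real (\<Sum>\<^sub>\<infinity>\<gamma>. (cmod (hardy_coeff f \<gamma>))\<^sup>2)) UNIV"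
    by (simp only: complex_norm_square)
  thus ?thesis unfolding cinner_def by (rule infsumI)
qed

lemma cinner_self_eq_0: "Re (cinner f f) = 0 \<longleftrightarrow> f = 0"
proof
  assume "Re (cinner f f) = 0"
  hence "(\<Sum>\<^sub>\<infinity>\<gamma>. (cmod (hardy_coeff f \<gamma>))\<^sup>2) = 0" by (simp add: cinner_self)
  hence "(cmod (hardy_coeff f \<gamma>))\<^sup>2 = 0" for \<gamma>
    using square_summable_hardy_coeff[of f] unfolding square_summable_def
    by (intro nonneg_infsum_le_0D[where A = UNIV]) auto
  thus "f = 0" by (auto simp: hardy_eq_iff)
qed (simp add: cinner_def)

text \<open>
  The real Hilbert space structure underlying the complex one provides the norm
  \<open>sqrt (Re (cinner f f))\<close> and the topology.
\<close>

instantiation hardy :: (finite) real_vector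
begin

definition scaleR_hardy :: "real \<Rightarrow> 'a hardy \<Rightarrow> 'a hardy"
  where "scaleR_hardy r f = scaleC (complex_of_real r) f"

instance
  by standard
    (simp_all add: scaleR_hardy_def hardy.scale_right_distrib hardy.scale_left_distrib)

end

instantiation hardy :: (finite) real_inner
begin

definition inner_hardy :: "'a hardy \<Rightarrow> 'a hardy \<Rightarrow> real"
  where "inner_hardy f g = Re (cinner f g)"

definition norm_hardy :: "'a hardy \<Rightarrow> real"
  where "norm_hardy f = sqrt (inner f f)"

definition sgn_hardy :: "'a hardy \<Rightarrow> 'a hardy"
  where "sgn_hardy f = f /\<^sub>R norm f"

definition dist_hardy :: "'a hardy \<Rightarrow> 'a hardy \<Rightarrow> real"
  where "dist_hardy f g = norm (f - g)"

definition uniformity_hardy :: "('a hardy \<times> 'a hardy) filter"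
  where "uniformity_hardy = (INF e\<in>{0<..}. principal {(f, g). dist f g < e})"

definition open_hardy :: "'a hardy set \<Rightarrow> bool"
  where "open_hardy U \<longleftrightarrow> (\<forall>x\<in>U. \<forall>\<^sub>F (x', y) in uniformity. x' = x \<longrightarrow> y \<in> U)"

instance
proof
  fix f g h :: "'a hardy" and r :: real
  show "inner f g = inner g f"
    unfolding inner_hardy_def by (subst cinner_commute) simp
  show "inner (f + g) h = inner f h + inner g h"
    by (simp add: inner_hardy_def cinner_add_left)
  show "inner (r *\<^sub>R f) g = r * inner f g"
    by (simp add: inner_hardy_def scaleR_hardy_def cinner_scaleC_left)
  show "0 \<le> inner f f"
    by (simp add: inner_hardy_def cinner_self infsum_nonneg)
  show "inner f f = 0 \<longleftrightarrow> f = 0"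
    by (simp add: inner_hardy_def cinner_self_eq_0)
qed (rule sgn_hardy_def norm_hardy_def dist_hardy_def uniformity_hardy_def open_hardy_def)+

end


section \<open>Multiplication by the coordinates, and polynomials in the Hardy space\<close>

lift_definition mult_var :: "'d::finite \<Rightarrow> 'd hardy \<Rightarrow> 'd hardy" is "\<lambda>i f z. z $ i * f z"
proof safe
  fix i :: 'd and a :: "('d \<Rightarrow>\<^sub>0 nat) \<Rightarrow> complex"
  assume a: "square_summable a"
  let ?e = "\<lambda>\<gamma>. \<gamma> + Poly_Mapping.single i (1 :: nat)"
  define b where "b = (\<lambda>\<gamma>. if \<gamma> \<in> range ?e then a (\<gamma> - Poly_Mapping.single i 1) else 0)"
  have inj: "inj ?e" by (auto simp: inj_def)
  have be: "b (?e \<gamma>) = a \<gamma>" for \<gamma> by (simp add: b_def)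
  have b0: "b \<gamma> = 0" if "\<gamma> \<notin> range ?e" for \<gamma> using that by (simp add: b_def)
  have "(\<lambda>\<gamma>. (cmod (b \<gamma>))\<^sup>2) summable_on range ?e"
    using a unfolding summable_on_reindex[OF inj] o_def be square_summable_def .
  hence bs: "square_summable b"
    unfolding square_summable_def
    by (subst summable_on_cong_neutral[where T = "range ?e"]) (auto simp: b0)
  have "power_series b z = z $ i * power_series a z" for z
  proof (cases "z \<in> polydisc")
    case True
    have "(\<Sum>\<^sub>\<infinity>\<gamma>. b \<gamma> * monom_eval \<gamma> z) = (\<Sum>\<^sub>\<infinity>\<gamma>\<in>range ?e. b \<gamma> * monom_eval \<gamma> z)"
      by (rule infsum_cong_neutral) (auto simp: b0)
    also have "\<dots> = (\<Sum>\<^sub>\<infinity>\<gamma>. z $ i * (a \<gamma> * monom_eval \<gamma> z))"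
      unfolding infsum_reindex[OF inj] o_def be monom_eval_add monom_eval_single
      by (simp add: mult_ac)
    also have "\<dots> = z $ i * (\<Sum>\<^sub>\<infinity>\<gamma>. a \<gamma> * monom_eval \<gamma> z)"
      by (rule infsum_cmult_right')
    finally show ?thesis using True by (simp add: power_series_def)
  qed (simp add: power_series_def)
  thus "\<exists>b. (\<lambda>z. z $ i * power_series a z) = power_series b \<and> square_summable b"
    using bs by (intro exI[of _ b]) auto
qed

lift_definition hardy_of_poly :: "'d::finite mpoly \<Rightarrow> 'd hardy"
  is "\<lambda>p z. if z \<in> polydisc then poly_eval p z else 0"
proof -
  fix p :: "'d mpoly"
  have "poly_eval p z = (\<Sum>\<^sub>\<infinity>\<gamma>. Poly_Mapping.lookup p \<gamma> * monom_eval \<gamma> z)" for z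
  proof -
    have "(\<Sum>\<^sub>\<infinity>\<gamma>. Poly_Mapping.lookup p \<gamma> * monom_eval \<gamma> z) =
        (\<Sum>\<^sub>\<infinity>\<gamma>\<in>Poly_Mapping.keys p. Poly_Mapping.lookup p \<gamma> * monom_eval \<gamma> z)"
      by (rule infsum_cong_neutral) (auto simp: in_keys_iff)
    thus ?thesis by (simp add: poly_eval_def)
  qed
  thus "\<exists>a. (\<lambda>z. if z \<in> polydisc then poly_eval p z else 0) = power_series a \<and> square_summable a"
    by (intro exI[of _ "Poly_Mapping.lookup p"])
       (auto simp: power_series_def intro: square_summable_finite)
qed


section \<open>Operators on closed subspaces\<close>

text \<open>
  An operator on a closed complex subspace \<open>M\<close> is represented by a function on the whole Hardy
  space, of which only the values on \<open>M\<close> matter.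
\<close>

definition projection :: "'d::finite hardy set \<Rightarrow> 'd hardy \<Rightarrow> 'd hardy"
  where "projection M f = (THE g. g \<in> M \<and> (\<forall>h\<in>M. cinner (f - g) h = 0))"

definition adjoint_on :: "'d::finite hardy set \<Rightarrow> ('d hardy \<Rightarrow> 'd hardy) \<Rightarrow> 'd hardy \<Rightarrow> 'd hardy"
  where "adjoint_on M T f = (THE g. g \<in> M \<and> (\<forall>h\<in>M. cinner h g = cinner (T h) f))"

definition commutator :: "('a \<Rightarrow> 'a) \<Rightarrow> ('a \<Rightarrow> 'a) \<Rightarrow> 'a \<Rightarrow> 'a::minus"
  where "commutator A B f = A (B f) - B (A f)"

definition compact_operator_on :: "'d::finite hardy set \<Rightarrow> ('d hardy \<Rightarrow> 'd hardy) \<Rightarrow> bool"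
  where "compact_operator_on M T \<longleftrightarrow>
    T ` M \<subseteq> M \<and>
    (\<forall>f\<in>M. \<forall>g\<in>M. T (f + g) = T f + T g) \<and>
    (\<forall>c. \<forall>f\<in>M. T (scaleC c f) = scaleC c (T f)) \<and>
    compact (closure (T ` (M \<inter> cball 0 1)))"

text \<open>
  The singular values are the square roots of the eigenvalues of \<open>T\<^sup>* T\<close> in decreasing order,
  repeated according to multiplicity (the complex dimension of the eigenspace) and padded with
  zeros if there are only finitely many positive ones. Enumeration starts at 0, so \<open>s n\<close> is the
  singular value usually numbered \<open>n + 1\<close>.
\<close>

definition singular_values ::
    "'d::finite hardy set \<Rightarrow> ('d hardy \<Rightarrow> 'd hardy) \<Rightarrow> (nat \<Rightarrow> real) \<Rightarrow> bool"
  where "singular_values M T s \<longleftrightarrow>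
    decseq s \<and> (\<forall>n. 0 \<le> s n) \<and>
    (\<forall>\<sigma>>0. finite {n. s n = \<sigma>} \<and>
      card {n. s n = \<sigma>} =
        hardy.dim {f \<in> M. adjoint_on M T (T f) = scaleC (complex_of_real (\<sigma>\<^sup>2)) f})"

definition weak_schatten :: "real \<Rightarrow> 'd::finite hardy set \<Rightarrow> ('d hardy \<Rightarrow> 'd hardy) set"
  where "weak_schatten p M =
    {T. compact_operator_on M T \<and>
        (\<exists>s. singular_values M T s \<and> s \<in> O(\<lambda>n. real (Suc n) powr (- 1 / p)))}"


section \<open>Quotient modules\<close>

definition quotient_module :: "'d::finite mpoly set \<Rightarrow> 'd hardy set"
  where "quotient_module I = {f. \<forall>g\<in>closure (hardy_of_poly ` I). cinner f g = 0}"

definition compression :: "'d::finite hardy set \<Rightarrow> 'd \<Rightarrow> 'd hardy \<Rightarrow> 'd hardy"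
  where "compression M i f = projection M (mult_var i f)"

definition essentially_normal :: "real \<Rightarrow> 'd::finite hardy set \<Rightarrow> bool"
  where "essentially_normal p M \<longleftrightarrow>
    (\<forall>i j. commutator (adjoint_on M (compression M i)) (compression M j) \<in> weak_schatten p M)"

end

theory Submission
  imports Defs "HOL-Computational_Algebra.Fundamental_Theorem_Algebra"
begin

text \<open>
  Write \<open>M = [I]\<^sup>\<bottom>\<close>, let \<open>M\<^sub>n\<close> be the space of its homogeneous elements of degree \<open>n\<close>, and let
  \<open>T\<^sub>i\<close> be the backward shift in the variable \<open>z\<^sub>i\<close>, the adjoint of multiplication by \<open>z\<^sub>i\<close>. As \<open>I\<close>
  is an ideal, \<open>T\<^sub>i\<close> maps \<open>M\<close> into itself and is the adjoint of the compression \<open>S\<^sub>i\<close>; as \<open>I\<close> is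
  homogeneous, \<open>M\<close> is the orthogonal sum of the \<open>M\<^sub>n\<close>, and \<open>T\<^sub>i\<close> maps \<open>M\<^sub>n\<^sub>+\<^sub>1\<close> into \<open>M\<^sub>n\<close>. Every
  commutator \<open>[S\<^sub>i\<^sup>*, S\<^sub>j]\<close> maps each \<open>M\<^sub>n\<close> into itself. If the dimension of \<open>M\<^sub>n\<close> is bounded and the
  norm of the commutator on \<open>M\<^sub>n\<close> is \<open>O(1/n)\<close>, then only \<open>O(1/\<epsilon>)\<close> singular values exceed \<open>\<epsilon>\<close>, which
  is the assertion (\<open>weak_schatten_1I\<close>).

  The norm of the commutator is controlled by two defects. For \<open>f\<close>, \<open>h\<close> in \<open>M\<close>, the inner product of
  \<open>[S\<^sub>i\<^sup>*, S\<^sub>j] f\<close> with \<open>h\<close> is the inner product of \<open>Q\<^sub>i f\<close> with \<open>Q\<^sub>i h\<close> if \<open>i = j\<close>, and zero otherwise,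
  minus the inner product of the components of \<open>z\<^sub>j f\<close> and \<open>z\<^sub>i h\<close> orthogonal to \<open>M\<close>. Here \<open>Q\<^sub>i f\<close> keeps
  the monomials of \<open>f\<close> that are free of \<open>z\<^sub>i\<close>. So it is enough that on \<open>M\<^sub>n\<close> the square of the norm of
  \<open>Q\<^sub>i f\<close> and the square of the distance of \<open>z\<^sub>i f\<close> to \<open>M\<close> are at most \<open>C/n\<close> times the square of the
  norm of \<open>f\<close> (\<open>face_part_bound\<close>, \<open>lift_bound\<close>). The second bound follows from the first, because
  \<open>f = T\<^sub>i g\<close> with \<open>g\<close> in \<open>M\<^sub>n\<^sub>+\<^sub>1\<close> for large \<open>n\<close>, and then \<open>g - z\<^sub>i f = Q\<^sub>i g\<close>.

  The hypothesis on the zero set enters through the pencils \<open>T\<^sub>i - c T\<^sub>j\<close>. On \<open>Z(I) - {0}\<close> all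
  coordinates have the same nonzero modulus, so for \<open>|c| \<noteq> 1\<close> the ideal generated by \<open>I\<close> and
  \<open>z\<^sub>i - cnj c z\<^sub>j\<close> has no zero other than the origin, and by the Nullstellensatz it contains all
  monomials of high degree. By duality \<open>T\<^sub>i - c T\<^sub>j\<close> is injective on \<open>M\<^sub>n\<close> for large \<open>n\<close>. The case
  \<open>c = 0\<close> shows that \<open>dim M\<^sub>n\<close> is eventually nonincreasing, hence eventually constant, and that the
  \<open>T\<^sub>i\<close> are then bijective between consecutive parts. The other \<open>c\<close> show that the operator
  \<open>T\<^sub>i T\<^sub>j\<^sup>-\<^sup>1\<close> on such a part has only unimodular eigenvalues. Therefore a product of factors
  \<open>T\<^sub>i - a T\<^sub>j\<close> with \<open>|a| = 1\<close> vanishes on \<open>M\<^sub>n\<close> (\<open>pencil_product_eventually_0\<close>). In terms of the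
  coefficients of \<open>f\<close> this says that along every line \<open>\<gamma> + k (e\<^sub>i - e\<^sub>j)\<close> they satisfy a linear
  recurrence with unimodular roots. Such a sequence cannot be concentrated at its beginning: its first
  term is dominated by its quadratic mean (\<open>first_term_square_bound\<close>). A monomial of degree \<open>n\<close> that is
  free of \<open>z\<^sub>i\<close> begins such a line of length at least \<open>n/d\<close>, for a variable \<open>z\<^sub>j\<close> whose exponent is
  largest, and summation over these lines bounds \<open>Q\<^sub>i f\<close>.
\<close>

section \<open>Ideals and evaluation of polynomials\<close>

text \<open>
  The ring is a module over itself. Its ideals are the submodules; the facts are instantiated by
  hand because an interpretation would make the simplifier rewrite products in both directions.
\<close>

lemma module_mult: "module ((*) :: 'a::comm_ring_1 \<Rightarrow> 'a \<Rightarrow> 'a)"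
  by standard (simp_all add: algebra_simps)

abbreviation is_ideal :: "'a::comm_ring_1 set \<Rightarrow> bool"
  where "is_ideal \<equiv> module.subspace (*)"

lemmas is_idealI = module.subspaceI[OF module_mult]
  and ideal_0 = module.subspace_0[OF module_mult]
  and ideal_add = module.subspace_add[OF module_mult]
  and ideal_diff = module.subspace_diff[OF module_mult]
  and ideal_mult = module.subspace_scale[OF module_mult]
  and ideal_sum = module.subspace_sum[OF module_mult]
  and is_ideal_span = module.subspace_span[OF module_mult]

abbreviation const_poly :: "complex \<Rightarrow> 'd::finite mpoly"
  where "const_poly c \<equiv> Poly_Mapping.single 0 c"

abbreviation var_poly :: "'d \<Rightarrow> 'd::finite mpoly"
  where "var_poly k \<equiv> Poly_Mapping.single (Poly_Mapping.single k 1) 1"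

lemma poly_eval_superset:
  assumes "finite K" "Poly_Mapping.keys p \<subseteq> K"
  shows "poly_eval p z = (\<Sum>\<gamma>\<in>K. Poly_Mapping.lookup p \<gamma> * monom_eval \<gamma> z)"
  unfolding poly_eval_def using assms
  by (intro sum.mono_neutral_left) (auto simp: in_keys_iff)

lemma poly_eval_0 [simp]: "poly_eval 0 z = 0"
  by (simp add: poly_eval_def)

lemma poly_eval_add [simp]: "poly_eval (p + q) z = poly_eval p z + poly_eval q z"
proof -
  let ?K = "Poly_Mapping.keys p \<union> Poly_Mapping.keys q"
  have "poly_eval (p + q) z = (\<Sum>\<gamma>\<in>?K. Poly_Mapping.lookup (p + q) \<gamma> * monom_eval \<gamma> z)"
    using keys_add[of p q] by (intro poly_eval_superset) auto
  also have "\<dots> = (\<Sum>\<gamma>\<in>?K. Poly_Mapping.lookup p \<gamma> * monom_eval \<gamma> z)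
      + (\<Sum>\<gamma>\<in>?K. Poly_Mapping.lookup q \<gamma> * monom_eval \<gamma> z)"
    by (simp add: lookup_add distrib_right sum.distrib)
  finally show ?thesis
    by (simp add: poly_eval_superset[of ?K p] poly_eval_superset[of ?K q])
qed

lemma poly_eval_sum [simp]: "poly_eval (\<Sum>x\<in>A. f x) z = (\<Sum>x\<in>A. poly_eval (f x) z)"
  by (induction A rule: infinite_finite_induct) auto

lemma poly_eval_single [simp]: "poly_eval (Poly_Mapping.single \<gamma> c) z = c * monom_eval \<gamma> z"
  by (simp add: poly_eval_def)

lemma sum_single_keys: "(\<Sum>\<gamma>\<in>Poly_Mapping.keys p. Poly_Mapping.single \<gamma> (Poly_Mapping.lookup p \<gamma>)) = p"
  by (rule poly_mapping_eqI)
     (auto simp: lookup_sum lookup_single when_def in_keys_iff)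

lemma poly_eval_mult [simp]: "poly_eval (p * q) z = poly_eval p z * poly_eval q z"
proof -
  have "p * q = (\<Sum>\<gamma>\<in>Poly_Mapping.keys p. Poly_Mapping.single \<gamma> (Poly_Mapping.lookup p \<gamma>))
      * (\<Sum>\<delta>\<in>Poly_Mapping.keys q. Poly_Mapping.single \<delta> (Poly_Mapping.lookup q \<delta>))"
    by (simp only: sum_single_keys)
  hence "p * q = (\<Sum>\<gamma>\<in>Poly_Mapping.keys p. \<Sum>\<delta>\<in>Poly_Mapping.keys q.
      Poly_Mapping.single (\<gamma> + \<delta>) (Poly_Mapping.lookup p \<gamma> * Poly_Mapping.lookup q \<delta>))"
    by (simp add: sum_product mult_single)
  hence "poly_eval (p * q) z = (\<Sum>\<gamma>\<in>Poly_Mapping.keys p. \<Sum>\<delta>\<in>Poly_Mapping.keys q.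
      Poly_Mapping.lookup p \<gamma> * Poly_Mapping.lookup q \<delta> * monom_eval (\<gamma> + \<delta>) z)"
    by (simp only: poly_eval_sum poly_eval_single)
  also have "\<dots> = poly_eval p z * poly_eval q z"
    unfolding poly_eval_def sum_product monom_eval_add by (simp only: mult_ac)
  finally show ?thesis .
qed

lemma monom_eval_0 [simp]: "monom_eval 0 z = 1"
  by (simp add: monom_eval_def)

lemma poly_eval_1 [simp]: "poly_eval 1 z = 1"
  using poly_eval_single[of 0 1 z] by simp

lemma poly_eval_uminus [simp]: "poly_eval (- p) z = - poly_eval p z"
  using poly_eval_add[of p "- p" z] by (simp add: eq_neg_iff_add_eq_0 add.commute)

lemma poly_eval_diff [simp]: "poly_eval (p - q) z = poly_eval p z - poly_eval q z"
  using poly_eval_add[of p "- q" z] by simp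

lemma monom_poly_prod:
  fixes \<gamma> :: "'d::finite \<Rightarrow>\<^sub>0 nat"
  shows "Poly_Mapping.single \<gamma> (1::complex) = (\<Prod>k\<in>UNIV. var_poly k ^ Poly_Mapping.lookup \<gamma> k)"
proof -
  have p: "var_poly k ^ n = Poly_Mapping.single (Poly_Mapping.single k n) (1::complex)" for k :: 'd and n
    by (induction n) (simp_all add: mult_single single_add[symmetric])
  have s: "(\<Prod>k\<in>A. Poly_Mapping.single (f k) (1::complex)) = Poly_Mapping.single (\<Sum>k\<in>A. f k) 1"
    if "finite A" for A :: "'d set" and f :: "'d \<Rightarrow> ('d \<Rightarrow>\<^sub>0 nat)"
    using that by (induction A) (simp_all add: mult_single)
  have "(\<Sum>k\<in>UNIV. Poly_Mapping.single k (Poly_Mapping.lookup \<gamma> k)) = \<gamma>"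
    by (rule poly_mapping_eqI) (simp add: lookup_sum lookup_single when_def)
  thus ?thesis by (simp only: p s[OF finite])
qed

section \<open>A Nullstellensatz over the complex numbers\<close>

lemma underdetermined_system:
  fixes M :: "'a \<Rightarrow> 'b \<Rightarrow> 'c::field"
  assumes "finite G" "finite F" "card G < card F"
  shows "\<exists>c. (\<exists>x\<in>F. c x \<noteq> 0) \<and> (\<forall>g\<in>G. (\<Sum>x\<in>F. c x * M x g) = 0)"
  using assms
proof (induction G arbitrary: F M rule: finite_induct)
  case empty
  then obtain x where "x \<in> F" by fastforce
  thus ?case by (intro exI[of _ "\<lambda>_. 1"]) auto
next
  case (insert g G)
  show ?case
  proof (cases "\<forall>x\<in>F. M x g = 0")
    case True
    with insert.IH[of F M] insert.prems insert.hyps show ?thesis by auto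
  next
    case False
    then obtain y where y: "y \<in> F" "M y g \<noteq> 0" by auto
    have "card G < card (F - {y})"
      using insert.prems insert.hyps y by simp
    from insert.IH[OF _ this, of "\<lambda>x h. M x h - M x g / M y g * M y h"] insert.prems(1)
    obtain c x0 where c: "x0 \<in> F - {y}" "c x0 \<noteq> 0"
      "\<And>h. h \<in> G \<Longrightarrow> (\<Sum>x\<in>F - {y}. c x * (M x h - M x g / M y g * M y h)) = 0"
      by auto
    define c' where "c' = c(y := - (\<Sum>x\<in>F - {y}. c x * M x g / M y g))"
    have split: "(\<Sum>x\<in>F. c' x * M x h) = c' y * M y h + (\<Sum>x\<in>F - {y}. c x * M x h)" for h
      unfolding sum.remove[OF insert.prems(1) y(1)]
      by (intro arg_cong2[where f = "(+)"] refl sum.cong) (auto simp: c'_def)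
    have expand: "(\<Sum>x\<in>F. c' x * M x h) = (\<Sum>x\<in>F - {y}. c x * (M x h - M x g / M y g * M y h))" for h
    proof -
      have "c x * (M x h - M x g / M y g * M y h) = c x * M x h - c x * M x g / M y g * M y h" for x
        by (simp add: right_diff_distrib)
      thus ?thesis unfolding split by (simp add: c'_def sum_distrib_right sum_subtractf)
    qed
    have "(\<Sum>x\<in>F. c' x * M x h) = 0" if "h \<in> insert g G" for h
    proof (cases "h = g")
      case True
      thus ?thesis unfolding expand using y by simp
    next
      case False
      thus ?thesis unfolding expand using that c(3) by simp
    qed
    moreover have "c' x0 \<noteq> 0" using c by (auto simp: c'_def)
    ultimately show ?thesis using c(1) by (intro exI[of _ c']) auto
  qed
qed

text \<open>
  The image of a polynomial in one variable under the substitution of the variable with index \<open>k\<close>,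
  evaluated by Horner's scheme.
\<close>

definition subst_var :: "'d \<Rightarrow> complex poly \<Rightarrow> 'd::finite mpoly"
  where "subst_var k u = fold_coeffs (\<lambda>a p. const_poly a + var_poly k * p) u 0"

lemma subst_var_0 [simp]: "subst_var k 0 = 0"
  by (simp add: subst_var_def)

lemma subst_var_pCons [simp]: "subst_var k (pCons a u) = const_poly a + var_poly k * subst_var k u"
  by (cases "pCons a u = 0") (auto simp: subst_var_def)

lemma subst_var_add: "subst_var k (u + v) = subst_var k u + subst_var k v"
  by (induction u v rule: poly_induct2) (simp_all add: single_add distrib_left)

lemma subst_var_smult: "subst_var k (smult a u) = const_poly a * subst_var k u"
proof (induction u)
  case (pCons b u)
  show ?case
    by (simp only: smult_pCons subst_var_pCons pCons.IH distrib_left mult_single add_0_left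
        mult.left_commute[of "const_poly a"])
qed simp

lemma subst_var_mult: "subst_var k (u * v) = subst_var k u * subst_var k v"
proof (induction u)
  case (pCons a u)
  have "subst_var k (pCons a u * v) = const_poly a * subst_var k v + var_poly k * subst_var k (u * v)"
    by (simp add: subst_var_add subst_var_smult)
  thus ?case by (simp only: pCons.IH subst_var_pCons distrib_right mult.assoc)
qed simp

lemma subst_var_1 [simp]: "subst_var k 1 = 1"
  by (simp add: one_pCons)

lemma subst_var_linear: "subst_var k [:- a, 1:] = var_poly k - const_poly a"
  by (simp add: single_uminus)

lemma subst_var_sum: "subst_var k (\<Sum>x\<in>A. f x) = (\<Sum>x\<in>A. subst_var k (f x))"
  by (induction A rule: infinite_finite_induct) (simp_all add: subst_var_add)

lemma subst_var_prod: "subst_var k (\<Prod>x\<in>A. f x) = (\<Prod>x\<in>A. subst_var k (f x))"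
  by (induction A rule: infinite_finite_induct) (simp_all add: subst_var_mult)

text \<open>
  Ideals that avoid all powers of \<open>q\<close> replace the ideals of the localisation at \<open>q\<close>. A maximal one is
  prime, and every element outside it divides a power of \<open>q\<close> modulo the ideal.
\<close>

definition avoids_powers :: "'a::comm_ring_1 \<Rightarrow> 'a set \<Rightarrow> bool"
  where "avoids_powers q P \<longleftrightarrow> is_ideal P \<and> (\<forall>n. q ^ n \<notin> P)"

definition maximal_avoiding :: "'a::comm_ring_1 \<Rightarrow> 'a set \<Rightarrow> bool"
  where "maximal_avoiding q P \<longleftrightarrow> avoids_powers q P \<and> (\<forall>R. P \<subseteq> R \<longrightarrow> avoids_powers q R \<longrightarrow> R = P)"

lemma exists_maximal_avoiding:
  assumes "avoids_powers q J"
  shows "\<exists>P. J \<subseteq> P \<and> maximal_avoiding q P"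
proof -
  let ?A = "{P. J \<subseteq> P \<and> avoids_powers q P}"
  have "\<exists>P\<in>?A. \<forall>X\<in>?A. P \<subseteq> X \<longrightarrow> X = P"
  proof (rule subset_Zorn_nonempty)
    show "?A \<noteq> {}" using assms by auto
    fix \<C> assume ne: "\<C> \<noteq> {}" and ch: "subset.chain ?A \<C>"
    have in_A: "J \<subseteq> X" "is_ideal X" "\<And>n. q ^ n \<notin> X" if "X \<in> \<C>" for X
      using that ch by (auto simp: subset.chain_def avoids_powers_def)
    have "is_ideal (\<Union>\<C>)"
    proof (rule is_idealI)
      show "0 \<in> \<Union>\<C>" using ne in_A(2) ideal_0 by blast
      show "x + y \<in> \<Union>\<C>" if xy: "x \<in> \<Union>\<C>" "y \<in> \<Union>\<C>" for x y
      proof -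
        obtain X Y where "X \<in> \<C>" "Y \<in> \<C>" "x \<in> X" "y \<in> Y" using xy by auto
        moreover from this ch have "X \<subseteq> Y \<or> Y \<subseteq> X"
          unfolding subset.chain_def by blast
        ultimately show ?thesis using in_A(2) ideal_add by blast
      qed
      show "c * x \<in> \<Union>\<C>" if "x \<in> \<Union>\<C>" for c x
        using that in_A(2) ideal_mult by blast
    qed
    moreover have "J \<subseteq> \<Union>\<C>" using ne in_A(1) by blast
    ultimately show "\<Union>\<C> \<in> ?A" using in_A(3) by (auto simp: avoids_powers_def)
  qed
  then obtain P where "J \<subseteq> P" "avoids_powers q P" and "\<forall>X\<in>?A. P \<subseteq> X \<longrightarrow> X = P"
    by auto
  thus ?thesis unfolding maximal_avoiding_def
    by (intro exI[of _ P]) (simp add: subset_trans[of J P])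
qed

lemma maximal_avoiding_inverse:
  assumes P: "maximal_avoiding q P" and r: "r \<notin> P"
  shows "\<exists>s n. s * r - q ^ n \<in> P"
proof -
  have sP: "is_ideal P" using P by (auto simp: maximal_avoiding_def avoids_powers_def)
  note addP = ideal_add[OF sP] and scaleP = ideal_mult[OF sP]
  let ?R = "{p + s * r | p s. p \<in> P}"
  have "is_ideal ?R"
  proof (rule is_idealI)
    show "0 \<in> ?R" using ideal_0[OF sP] by (intro CollectI exI[of _ 0]) auto
    show "x + y \<in> ?R" if xy: "x \<in> ?R" "y \<in> ?R" for x y
    proof -
      obtain p s p' s' where p: "x = p + s * r" "y = p' + s' * r" "p \<in> P" "p' \<in> P" using xy by auto
      have "x + y = (p + p') + (s + s') * r" unfolding p by (simp add: algebra_simps)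
      thus ?thesis using addP[OF p(3,4)] by blast
    qed
    show "c * x \<in> ?R" if x: "x \<in> ?R" for c x
    proof -
      obtain p s where p: "x = p + s * r" "p \<in> P" using x by auto
      have "c * x = c * p + (c * s) * r" unfolding p by (simp add: algebra_simps)
      thus ?thesis using scaleP[OF p(2)] by blast
    qed
  qed
  moreover have "P \<subseteq> ?R"
  proof
    fix p assume "p \<in> P"
    thus "p \<in> ?R" by (intro CollectI exI[of _ p] exI[of _ 0]) auto
  qed
  moreover have "r \<in> ?R" using ideal_0[OF sP] by (intro CollectI exI[of _ 0] exI[of _ 1]) auto
  ultimately have "\<not> avoids_powers q ?R" using P r unfolding maximal_avoiding_def by blast
  with \<open>is_ideal ?R\<close> obtain n p s where "q ^ n = p + s * r" "p \<in> P" by (auto simp: avoids_powers_def)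
  hence "s * r - q ^ n = (- 1) * p" by simp
  thus ?thesis using scaleP \<open>p \<in> P\<close> by metis
qed

lemma maximal_avoiding_prime:
  assumes P: "maximal_avoiding q P" and ab: "a * b \<in> P"
  shows "a \<in> P \<or> b \<in> P"
proof (rule ccontr)
  have sP: "is_ideal P" and qP: "\<And>n. q ^ n \<notin> P" using P by (auto simp: maximal_avoiding_def avoids_powers_def)
  assume "\<not> ?thesis"
  then obtain s n t m where st: "s * a - q ^ n \<in> P" "t * b - q ^ m \<in> P"
    using maximal_avoiding_inverse[OF P] by metis
  have "q ^ (n + m) = (s * t) * (a * b) - (t * b) * (s * a - q ^ n) - q ^ n * (t * b - q ^ m)"
    by (simp add: algebra_simps power_add)
  also have "\<dots> \<in> P"
    by (intro ideal_diff[OF sP] ideal_mult[OF sP] ab st)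
  finally show False using qP by blast
qed

text \<open>
  Two congruences modulo an ideal: if \<open>s L\<close> is congruent to \<open>q\<close>, then \<open>c q R\<close> is congruent to
  \<open>c s (L R)\<close>; and congruent factors have congruent products.
\<close>

lemma cofactor_identity:
  fixes c :: "'a::comm_ring_1"
  shows "c * q * R = c * s * (L * R) - (c * R) * (s * L - q)"
  by (simp add: algebra_simps)

lemma product_congruence_identity:
  fixes p :: "'a::comm_ring_1"
  shows "p * r - a * b = r * (p - a) + a * (r - b)"
  by (simp add: algebra_simps)

text \<open>
  The strong Nullstellensatz, without an additional variable. Let \<open>P\<close> be maximal among the ideals
  that contain \<open>J\<close> and no power of \<open>q\<close>. The field of complex numbers is uncountable, while polynomials
  have countably many coefficients; this forces a polynomial \<open>z\<^sub>k - a\<close> into \<open>P\<close> for every \<open>k\<close>. For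
  otherwise each \<open>z\<^sub>k - a\<close> has an inverse \<open>s a\<close> up to a power of \<open>q\<close>, uncountably many of these have
  the same exponents and supports in a common finite set, so finitely many of them are linearly
  dependent. Multiplied by all their factors \<open>z\<^sub>k - a\<close>, this dependence becomes a nonzero
  polynomial in \<open>z\<^sub>k\<close> alone that lies in \<open>P\<close>, and one of its linear factors is in \<open>P\<close>, which is prime.
  The point with the coordinates \<open>a\<close> is then a zero of \<open>J\<close> but not of \<open>q\<close>.
\<close>

theorem power_in_ideal_if_vanishes:
  fixes q :: "'d::finite mpoly"
  assumes J: "is_ideal J" and van: "\<And>z. z \<in> zero_set J \<Longrightarrow> poly_eval q z = 0"
  shows "\<exists>n. q ^ n \<in> J"
proof (rule ccontr)
  assume "\<not> ?thesis"
  hence "avoids_powers q J" using J by (auto simp: avoids_powers_def)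
  then obtain P where P: "J \<subseteq> P" "maximal_avoiding q P"
    using exists_maximal_avoiding by metis
  have sP: "is_ideal P" and qP: "\<And>n. q ^ n \<notin> P"
    using P by (auto simp: maximal_avoiding_def avoids_powers_def)
  note addP = ideal_add[OF sP] and scaleP = ideal_mult[OF sP]
    and diffP = ideal_diff[OF sP] and sumP = ideal_sum[OF sP]
    and inv = maximal_avoiding_inverse[OF P(2)] and prime = maximal_avoiding_prime[OF P(2)]
  have const_P: "const_poly c \<notin> P" if "c \<noteq> 0" for c
  proof
    assume "const_poly c \<in> P"
    hence "const_poly (inverse c) * const_poly c \<in> P" by (rule scaleP)
    thus False using qP[of 0] that by (simp add: mult_single)
  qed
  have ex_root: "\<exists>a. var_poly k - const_poly a \<in> P" for k
  proof (rule ccontr)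
    assume "\<not> ?thesis"
    hence no: "var_poly k - const_poly a \<notin> P" for a by auto
    have subst_notin: "subst_var k u \<notin> P" if "u \<noteq> 0" for u
      using that
    proof (induction "degree u" arbitrary: u)
      case 0
      then obtain c where "u = [:c:]" "c \<noteq> 0" by (metis degree_eq_zeroE pCons_eq_0_iff)
      thus ?case using const_P by simp
    next
      case (Suc n)
      hence "\<not> constant (poly u)" by (simp add: constant_degree)
      then obtain a where "poly u a = 0" using fundamental_theorem_of_algebra by blast
      then obtain v where v: "u = [:- a, 1:] * v" by (auto simp: poly_eq_0_iff_dvd)
      hence "v \<noteq> 0" using Suc.prems by auto
      hence "degree u = Suc (degree v)" unfolding v by (subst degree_mult_eq) auto
      hence "subst_var k v \<notin> P" using Suc \<open>v \<noteq> 0\<close> by auto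
      thus ?case unfolding v subst_var_mult subst_var_linear using prime no by blast
    qed
    obtain s e where se: "s a * (var_poly k - const_poly a) - q ^ (e a) \<in> P" for a
      using inv[OF no] by metis
    \<comment> \<open>A bound on all exponents, so that boundedly many coefficients occur once it is fixed.\<close>
    define height where "height = (\<lambda>p :: 'd mpoly. Max (insert 0 ((\<lambda>(\<gamma>, i). Poly_Mapping.lookup \<gamma> i) ` (Poly_Mapping.keys p \<times> UNIV))))"
    have height: "Poly_Mapping.lookup \<gamma> i \<le> height p" if "\<gamma> \<in> Poly_Mapping.keys p" for \<gamma> i p
      unfolding height_def using that by (intro Max_ge) (auto intro!: image_eqI[of _ _ "(\<gamma>, i)"])
    have "\<exists>y. \<not> countable ((\<lambda>a. (e a, height (s a))) -` {y})"
    proof (rule ccontr)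
      assume "\<not> ?thesis"
      hence "countable (\<Union>y. (\<lambda>a. (e a, height (s a))) -` {y})" by (intro countable_UN) auto
      moreover have "(\<Union>y. (\<lambda>a. (e a, height (s a))) -` {y}) = UNIV" by auto
      ultimately show False using uncountable_UNIV_complex by simp
    qed
    then obtain n N where un: "\<not> countable ((\<lambda>a. (e a, height (s a))) -` {(n, N)})" by auto
    define G where "G = {\<gamma> :: 'd \<Rightarrow>\<^sub>0 nat. \<forall>i. Poly_Mapping.lookup \<gamma> i \<le> N}"
    have "Poly_Mapping.lookup ` G \<subseteq> PiE UNIV (\<lambda>_. {..N})" by (auto simp: G_def)
    hence "finite (Poly_Mapping.lookup ` G)" by (rule finite_subset) (auto intro: finite_PiE)
    hence finG: "finite G" by (rule finite_imageD) (auto simp: inj_on_def lookup_inject)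
    obtain F where F: "finite F" "card F = Suc (card G)" "F \<subseteq> (\<lambda>a. (e a, height (s a))) -` {(n, N)}"
      using infinite_arbitrarily_large[of "(\<lambda>a. (e a, height (s a))) -` {(n, N)}" "Suc (card G)"]
        un countable_finite by metis
    have keysG: "Poly_Mapping.keys (s a) \<subseteq> G" if "a \<in> F" for a
      using F that height[of _ "s a"] by (auto simp: G_def)
    have "\<exists>c. (\<exists>x\<in>F. c x \<noteq> 0) \<and> (\<forall>g\<in>G. (\<Sum>x\<in>F. c x * Poly_Mapping.lookup (s x) g) = 0)"
      by (rule underdetermined_system) (use F finG in auto)
    then obtain c a0 where c: "a0 \<in> F" "c a0 \<noteq> 0"
      "\<And>g. g \<in> G \<Longrightarrow> (\<Sum>x\<in>F. c x * Poly_Mapping.lookup (s x) g) = 0" by auto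
    have lk: "Poly_Mapping.lookup (const_poly b * p) \<gamma> = b * Poly_Mapping.lookup p \<gamma>" for b and p :: "'d mpoly" and \<gamma>
      unfolding mult_map_scale_conv_mult[symmetric] by (simp add: Poly_Mapping.map.rep_eq when_def)
    have rel: "(\<Sum>x\<in>F. const_poly (c x) * s x) = 0"
    proof (rule poly_mapping_eqI)
      fix \<gamma>
      have "Poly_Mapping.lookup (s x) \<gamma> = 0" if "x \<in> F" "\<gamma> \<notin> G" for x
        using keysG[OF that(1)] that(2) by (auto simp: in_keys_iff)
      thus "Poly_Mapping.lookup (\<Sum>x\<in>F. const_poly (c x) * s x) \<gamma> = Poly_Mapping.lookup 0 \<gamma>"
        using c(3) by (cases "\<gamma> \<in> G") (simp_all add: lookup_sum lk)
    qed
    \<comment> \<open>The polynomial in one variable that arises from the dependence; only the summand of \<open>a0\<close> survives at \<open>a0\<close>.\<close>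
    define u where "u = (\<Sum>x\<in>F. smult (c x) (\<Prod>y\<in>F - {x}. [:- y, 1:]))"
    have "poly u a0 = (\<Sum>x\<in>F. c x * (\<Prod>y\<in>F - {x}. a0 - y))"
      by (simp add: u_def poly_sum poly_prod)
    also have "\<dots> = c a0 * (\<Prod>y\<in>F - {a0}. a0 - y) + (\<Sum>x\<in>F - {a0}. c x * (\<Prod>y\<in>F - {x}. a0 - y))"
      using F c(1) by (simp add: sum.remove)
    also have "(\<Sum>x\<in>F - {a0}. c x * (\<Prod>y\<in>F - {x}. a0 - y)) = 0"
      using F(1) c(1) by (intro sum.neutral ballI) (auto simp: prod_zero_iff)
    finally have "poly u a0 \<noteq> 0" using F(1) c(2) by (auto simp: prod_zero_iff)
    hence "u \<noteq> 0" by auto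
    let ?L = "\<lambda>a. var_poly k - const_poly a"
    have "q ^ n * subst_var k u = (\<Sum>x\<in>F. const_poly (c x) * q ^ n * (\<Prod>y\<in>F - {x}. ?L y))"
      unfolding u_def subst_var_sum subst_var_smult subst_var_prod subst_var_linear sum_distrib_left
      by (simp only: mult.left_commute[of "q ^ n"] mult.assoc)
    also have "\<dots> = (\<Sum>x\<in>F. const_poly (c x) * s x) * (\<Prod>y\<in>F. ?L y)
        - (\<Sum>x\<in>F. (const_poly (c x) * (\<Prod>y\<in>F - {x}. ?L y)) * (s x * ?L x - q ^ e x))"
      unfolding sum_distrib_right sum_subtractf[symmetric]
    proof (rule sum.cong)
      fix x assume x: "x \<in> F"
      have "e x = n" using F x by auto
      thus "const_poly (c x) * q ^ n * (\<Prod>y\<in>F - {x}. ?L y) =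
          const_poly (c x) * s x * (\<Prod>y\<in>F. ?L y)
          - (const_poly (c x) * (\<Prod>y\<in>F - {x}. ?L y)) * (s x * ?L x - q ^ e x)"
        unfolding prod.remove[OF F(1) x] by (simp only: cofactor_identity)
    qed simp
    also have "\<dots> \<in> P" unfolding rel mult_zero_left
      by (intro diffP ideal_0[OF sP] sumP scaleP se)
    finally have "q ^ n \<in> P \<or> subst_var k u \<in> P" by (rule prime)
    thus False using qP subst_notin[OF \<open>u \<noteq> 0\<close>] by blast
  qed
  then obtain a where a: "var_poly k - const_poly (a k) \<in> P" for k by metis
  define z where "z = (\<chi> k. a k)"
  let ?ok = "\<lambda>p. p - const_poly (poly_eval p z) \<in> P"
  have ok_const: "?ok (const_poly c)" for c using ideal_0[OF sP] by simp
  have ok_var: "?ok (var_poly k)" for k using a[of k] unfolding poly_eval_single monom_eval_single mult_1_left z_def vec_lambda_beta .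
  have ok_add: "?ok (p + r)" if "?ok p" "?ok r" for p r
  proof -
    have "p + r - const_poly (poly_eval (p + r) z) = (p - const_poly (poly_eval p z)) + (r - const_poly (poly_eval r z))"
      by (simp add: single_add)
    also have "\<dots> \<in> P" by (rule addP[OF that])
    finally show ?thesis .
  qed
  have ok_mult: "?ok (p * r)" if "?ok p" "?ok r" for p r
  proof -
    have "p * r - const_poly (poly_eval (p * r) z)
        = r * (p - const_poly (poly_eval p z)) + const_poly (poly_eval p z) * (r - const_poly (poly_eval r z))"
      using product_congruence_identity[of p r "const_poly (poly_eval p z)" "const_poly (poly_eval r z)"]
      by (simp add: mult_single)
    also have "\<dots> \<in> P" by (rule addP[OF scaleP[OF that(1)] scaleP[OF that(2)]])
    finally show ?thesis .
  qed
  have ok_1: "?ok 1" and ok_0: "?ok 0" using ok_const[of 1] ok_const[of 0] by simp_all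
  have ok_power: "?ok (p ^ m)" if "?ok p" for p m
  proof (induction m)
    case (Suc m)
    show ?case unfolding power_Suc by (rule ok_mult[OF that Suc])
  qed (use ok_1 in \<open>simp only: power_0\<close>)
  have ok_prod: "?ok (\<Prod>x\<in>A. f x)" if "\<And>x. x \<in> A \<Longrightarrow> ?ok (f x)" for A :: "'d set" and f
    using finite[of A] that
  proof (induction A rule: finite_induct)
    case (insert x A)
    show ?case unfolding prod.insert[OF insert.hyps]
      by (intro ok_mult insert.IH insert.prems) auto
  qed (use ok_1 in \<open>simp only: prod.empty\<close>)
  have ok_sum: "?ok (\<Sum>x\<in>A. f x)" if "finite A" "\<And>x. x \<in> A \<Longrightarrow> ?ok (f x)"
    for A :: "('d \<Rightarrow>\<^sub>0 nat) set" and f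
    using that
  proof (induction A rule: finite_induct)
    case (insert x A)
    show ?case unfolding sum.insert[OF insert.hyps]
      by (intro ok_add insert.IH insert.prems) auto
  qed (use ok_0 in \<open>simp only: sum.empty\<close>)
  have ok_single: "?ok (Poly_Mapping.single \<gamma> c)" for \<gamma> c
  proof -
    have "?ok (const_poly c * Poly_Mapping.single \<gamma> 1)"
      unfolding monom_poly_prod[of \<gamma>] by (intro ok_mult ok_const ok_prod ok_power ok_var)
    thus ?thesis by (simp add: mult_single)
  qed
  have ok: "?ok p" for p
    using ok_sum[OF finite_keys[of p], of "\<lambda>\<gamma>. Poly_Mapping.single \<gamma> (Poly_Mapping.lookup p \<gamma>)"] ok_single
    by (simp only: sum_single_keys)
  have "poly_eval p z = 0" if "p \<in> J" for p
  proof -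
    have "p - (p - const_poly (poly_eval p z)) \<in> P" using P(1) that ok[of p] by (intro diffP[of p "p - const_poly (poly_eval p z)"]) auto
    thus ?thesis using const_P by auto
  qed
  hence "poly_eval q z = 0" by (intro van) (auto simp: zero_set_def)
  hence "q ^ 1 \<in> P" using ok[of q] by simp
  thus False using qP by blast
qed

definition mdeg :: "('d::finite \<Rightarrow>\<^sub>0 nat) \<Rightarrow> nat"
  where "mdeg \<gamma> = (\<Sum>i\<in>UNIV. Poly_Mapping.lookup \<gamma> i)"

text \<open>
  A power of each variable lies in the ideal, and a monomial of degree at least the sum of these
  exponents is divisible by one of the powers.
\<close>

lemma contains_high_monomials:
  fixes J :: "'d::finite mpoly set"
  assumes J: "is_ideal J" and Z: "zero_set J \<subseteq> {0}"
  shows "\<exists>N. \<forall>\<gamma>. N \<le> mdeg \<gamma> \<longrightarrow> Poly_Mapping.single \<gamma> 1 \<in> J"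
proof -
  have "\<exists>n. var_poly k ^ n \<in> J" for k
  proof (rule power_in_ideal_if_vanishes[OF J])
    fix z assume "z \<in> zero_set J"
    hence "z = 0" using Z by auto
    thus "poly_eval (var_poly k) z = 0" unfolding poly_eval_single monom_eval_single by simp
  qed
  then obtain n where n: "var_poly k ^ n k \<in> J" for k by metis
  have "Poly_Mapping.single \<gamma> 1 \<in> J" if deg: "(\<Sum>k\<in>UNIV. n k) \<le> mdeg \<gamma>" for \<gamma>
  proof -
    have "\<exists>k. n k \<le> Poly_Mapping.lookup \<gamma> k"
    proof (rule ccontr)
      assume "\<not> ?thesis"
      hence "mdeg \<gamma> < (\<Sum>k\<in>UNIV. n k)"
        unfolding mdeg_def by (intro sum_strict_mono) (auto simp: not_le)
      thus False using deg by simp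
    qed
    then obtain k where k: "n k \<le> Poly_Mapping.lookup \<gamma> k" by auto
    have "Poly_Mapping.single \<gamma> 1 = var_poly k ^ Poly_Mapping.lookup \<gamma> k
        * (\<Prod>j\<in>UNIV - {k}. var_poly j ^ Poly_Mapping.lookup \<gamma> j)"
      unfolding monom_poly_prod[of \<gamma>] by (simp add: prod.remove)
    also have "var_poly k ^ Poly_Mapping.lookup \<gamma> k
        = var_poly k ^ (Poly_Mapping.lookup \<gamma> k - n k) * (var_poly k ^ n k :: 'd mpoly)"
      using k by (simp only: power_add[symmetric] le_add_diff_inverse2)
    finally show ?thesis using n[of k]
      by (simp only: mult.commute[of _ "\<Prod>j\<in>UNIV - {k}. var_poly j ^ Poly_Mapping.lookup \<gamma> j"] ideal_mult[OF J])
  qed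
  thus ?thesis by blast
qed

section \<open>Shifts and inner products in the Hardy space\<close>

lemma mdeg_add [simp]: "mdeg (\<gamma> + \<delta>) = mdeg \<gamma> + mdeg \<delta>"
  by (simp add: mdeg_def lookup_add sum.distrib)

lemma mdeg_single [simp]: "mdeg (Poly_Mapping.single i n) = n"
  by (simp add: mdeg_def lookup_single when_def)

lemma lookup_le_mdeg: "Poly_Mapping.lookup \<gamma> i \<le> mdeg \<gamma>"
  unfolding mdeg_def by (rule member_le_sum) auto

lemma finite_mdeg_le: "finite {\<gamma> :: 'd::finite \<Rightarrow>\<^sub>0 nat. mdeg \<gamma> \<le> n}"
proof (rule finite_imageD)
  have "Poly_Mapping.lookup ` {\<gamma> :: 'd \<Rightarrow>\<^sub>0 nat. mdeg \<gamma> \<le> n} \<subseteq> PiE UNIV (\<lambda>_. {..n})"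
    using lookup_le_mdeg order_trans by fastforce
  thus "finite (Poly_Mapping.lookup ` {\<gamma> :: 'd \<Rightarrow>\<^sub>0 nat. mdeg \<gamma> \<le> n})"
    by (rule finite_subset) (auto intro: finite_PiE)
qed (auto simp: inj_on_def lookup_inject)

lemma finite_mdeg_eq: "finite {\<gamma> :: 'd::finite \<Rightarrow>\<^sub>0 nat. mdeg \<gamma> = n}"
  by (rule finite_subset[OF _ finite_mdeg_le[of n]]) auto

text \<open>
  This is meaningful for square-summable families only; elsewhere the value is unspecified.
\<close>

definition hardy_of_coeff :: "(('d::finite \<Rightarrow>\<^sub>0 nat) \<Rightarrow> complex) \<Rightarrow> 'd hardy"
  where "hardy_of_coeff a = Abs_hardy (power_series a)"

lemma hardy_coeff_of_coeff:
  assumes "square_summable a"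
  shows "hardy_coeff (hardy_of_coeff a) = a"
  by (rule hardy_coeff_eqI[OF assms])
     (use assms in \<open>auto simp: hardy_of_coeff_def intro!: Abs_hardy_inverse\<close>)

lemma hardy_eqI: "(\<And>\<gamma>. hardy_coeff f \<gamma> = hardy_coeff g \<gamma>) \<Longrightarrow> f = g"
  by (auto simp: hardy_eq_iff)

lemma hardy_coeff_of_poly [simp]: "hardy_coeff (hardy_of_poly p) = Poly_Mapping.lookup p"
proof (rule hardy_coeff_eqI)
  show "square_summable (Poly_Mapping.lookup p)" by (rule square_summable_finite) simp
  show "hardy_fun (hardy_of_poly p) = power_series (Poly_Mapping.lookup p)"
  proof
    fix z
    have "(\<Sum>\<^sub>\<infinity>\<gamma>. Poly_Mapping.lookup p \<gamma> * monom_eval \<gamma> z) =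
        (\<Sum>\<^sub>\<infinity>\<gamma>\<in>Poly_Mapping.keys p. Poly_Mapping.lookup p \<gamma> * monom_eval \<gamma> z)"
      by (rule infsum_cong_neutral) (auto simp: in_keys_iff)
    thus "hardy_fun (hardy_of_poly p) z = power_series (Poly_Mapping.lookup p) z"
      by (simp add: hardy_of_poly.rep_eq power_series_def poly_eval_def)
  qed
qed

lemma hardy_coeff_uminus [simp]: "hardy_coeff (- f) = (\<lambda>\<gamma>. - hardy_coeff f \<gamma>)"
proof -
  have "hardy_coeff (f + - f) \<gamma> = 0" for \<gamma> unfolding right_minus by simp
  thus ?thesis unfolding hardy_coeff_add by (simp add: fun_eq_iff eq_neg_iff_add_eq_0 add.commute)
qed

lemma hardy_coeff_diff [simp]: "hardy_coeff (f - g) = (\<lambda>\<gamma>. hardy_coeff f \<gamma> - hardy_coeff g \<gamma>)"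
  using hardy_coeff_add[of f "- g"] by simp

lemma hardy_coeff_sum: "hardy_coeff (\<Sum>x\<in>A. f x) \<gamma> = (\<Sum>x\<in>A. hardy_coeff (f x) \<gamma>)"
  by (induction A rule: infinite_finite_induct) auto

lemma hardy_coeff_mult_var:
  "hardy_coeff (mult_var i f) \<gamma> =
    (if 0 < Poly_Mapping.lookup \<gamma> i then hardy_coeff f (\<gamma> - Poly_Mapping.single i 1) else 0)"
proof -
  let ?e = "\<lambda>\<gamma>. \<gamma> + Poly_Mapping.single i (1 :: nat)"
  have unshift: "?e (\<gamma> - Poly_Mapping.single i 1) = \<gamma>" if "0 < Poly_Mapping.lookup \<gamma> i" for \<gamma> :: "'a \<Rightarrow>\<^sub>0 nat"
  proof (rule poly_mapping_eqI)
    fix k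
    have "Poly_Mapping.lookup (\<gamma> - Poly_Mapping.single i 1) k
        = Poly_Mapping.lookup \<gamma> k - Poly_Mapping.lookup (Poly_Mapping.single i 1) k"
      by transfer simp
    thus "Poly_Mapping.lookup (?e (\<gamma> - Poly_Mapping.single i 1)) k = Poly_Mapping.lookup \<gamma> k"
      using that by (auto simp: lookup_add lookup_single when_def)
  qed
  define b where "b = (\<lambda>\<gamma>. if 0 < Poly_Mapping.lookup \<gamma> i then hardy_coeff f (\<gamma> - Poly_Mapping.single i 1) else 0)"
  have inj: "inj ?e" by (auto simp: inj_def)
  have range: "\<gamma> \<in> range ?e \<longleftrightarrow> 0 < Poly_Mapping.lookup \<gamma> i" for \<gamma>
    using unshift[of \<gamma>] by (auto simp: lookup_add intro: range_eqI[OF sym])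
  have be: "b (?e \<gamma>) = hardy_coeff f \<gamma>" for \<gamma> by (simp add: b_def lookup_add)
  have b0: "b \<gamma> = 0" if "\<gamma> \<notin> range ?e" for \<gamma> using that unfolding range by (simp add: b_def)
  have "(\<lambda>\<gamma>. (cmod (b \<gamma>))\<^sup>2) summable_on range ?e"
    using square_summable_hardy_coeff[of f]
    unfolding summable_on_reindex[OF inj] o_def be square_summable_def .
  hence bs: "square_summable b"
    unfolding square_summable_def
    by (subst summable_on_cong_neutral[where T = "range ?e"]) (auto simp: b0)
  have "power_series b z = z $ i * hardy_fun f z" for z
  proof (cases "z \<in> polydisc")
    case True
    have "(\<Sum>\<^sub>\<infinity>\<gamma>. b \<gamma> * monom_eval \<gamma> z) = (\<Sum>\<^sub>\<infinity>\<gamma>\<in>range ?e. b \<gamma> * monom_eval \<gamma> z)"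
      by (rule infsum_cong_neutral) (auto simp: b0)
    also have "\<dots> = (\<Sum>\<^sub>\<infinity>\<gamma>. z $ i * (hardy_coeff f \<gamma> * monom_eval \<gamma> z))"
      unfolding infsum_reindex[OF inj] o_def be monom_eval_add monom_eval_single
      by (simp add: mult_ac)
    also have "\<dots> = z $ i * (\<Sum>\<^sub>\<infinity>\<gamma>. hardy_coeff f \<gamma> * monom_eval \<gamma> z)"
      by (rule infsum_cmult_right')
    finally show ?thesis using True by (simp add: power_series_def hardy_fun_eq)
  qed (simp add: power_series_def hardy_fun_eq)
  hence "hardy_coeff (mult_var i f) = b"
    by (intro hardy_coeff_eqI bs) (auto simp: mult_var.rep_eq)
  thus ?thesis by (simp add: b_def)
qed

lemma hardy_coeff_mult_var_add [simp]:
  "hardy_coeff (mult_var i f) (\<gamma> + Poly_Mapping.single i (Suc 0)) = hardy_coeff f \<gamma>"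
  by (simp add: hardy_coeff_mult_var lookup_add)

lemma mult_var_add: "mult_var i (f + g) = mult_var i f + mult_var i g"
  by (rule hardy_eqI) (simp add: hardy_coeff_mult_var)

lemma mult_var_scaleC: "mult_var i (scaleC c f) = scaleC c (mult_var i f)"
  by (rule hardy_eqI) (simp add: hardy_coeff_mult_var)

definition backward_shift :: "'d \<Rightarrow> 'd::finite hardy \<Rightarrow> 'd hardy"
  where "backward_shift i f = hardy_of_coeff (\<lambda>\<gamma>. hardy_coeff f (\<gamma> + Poly_Mapping.single i 1))"

lemma hardy_coeff_backward_shift [simp]:
  "hardy_coeff (backward_shift i f) = (\<lambda>\<gamma>. hardy_coeff f (\<gamma> + Poly_Mapping.single i (Suc 0)))"
proof -
  let ?e = "\<lambda>\<gamma>. \<gamma> + Poly_Mapping.single i (1 :: nat)"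
  have inj: "inj ?e" by (auto simp: inj_def)
  have "(\<lambda>\<gamma>. (cmod (hardy_coeff f \<gamma>))\<^sup>2) summable_on range ?e"
    using square_summable_hardy_coeff[of f] unfolding square_summable_def
    by (rule summable_on_subset_banach) auto
  hence "square_summable (\<lambda>\<gamma>. hardy_coeff f (?e \<gamma>))"
    unfolding summable_on_reindex[OF inj] o_def square_summable_def .
  thus ?thesis unfolding backward_shift_def by (subst hardy_coeff_of_coeff) auto
qed

lemma backward_shift_add: "backward_shift i (f + g) = backward_shift i f + backward_shift i g"
  by (rule hardy_eqI) simp

lemma backward_shift_diff: "backward_shift i (f - g) = backward_shift i f - backward_shift i g"
  by (rule hardy_eqI) simp

lemma backward_shift_scaleC: "backward_shift i (scaleC c f) = scaleC c (backward_shift i f)"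
  by (rule hardy_eqI) simp

lemma backward_shift_0 [simp]: "backward_shift i 0 = 0"
  by (rule hardy_eqI) simp

lemma backward_shift_commute: "backward_shift i (backward_shift j f) = backward_shift j (backward_shift i f)"
  by (rule hardy_eqI) (simp add: add_ac)

lemma backward_shift_mult_var: "backward_shift i (mult_var i f) = f"
  by (rule hardy_eqI) simp

lemma backward_shift_mult_var_commute:
  assumes "i \<noteq> j"
  shows "backward_shift i (mult_var j f) = mult_var j (backward_shift i f)"
proof (rule hardy_eqI)
  fix \<gamma>
  have "\<gamma> + Poly_Mapping.single i (Suc 0) - Poly_Mapping.single j 1
      = \<gamma> - Poly_Mapping.single j 1 + Poly_Mapping.single i (Suc 0)" if "0 < Poly_Mapping.lookup \<gamma> j"
    using that assms
    by (intro poly_mapping_eqI, transfer) (auto simp: when_def)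
  thus "hardy_coeff (backward_shift i (mult_var j f)) \<gamma> = hardy_coeff (mult_var j (backward_shift i f)) \<gamma>"
    using assms by (simp add: hardy_coeff_mult_var lookup_add lookup_single when_def)
qed

lemma cinner_scaleC_right: "cinner f (scaleC c g) = cnj c * cinner f g"
  by (subst (1 2) cinner_commute) (simp add: cinner_scaleC_left)

lemma cinner_add_right: "cinner f (g + h) = cinner f g + cinner f h"
  by (subst (1 2 3) cinner_commute) (simp add: cinner_add_left)

lemma cinner_0_left [simp]: "cinner 0 g = 0" and cinner_0_right [simp]: "cinner g 0 = 0"
  by (simp_all add: cinner_def)

lemma cinner_uminus_left: "cinner (- f) g = - cinner f g"
  using cinner_add_left[of f "- f" g] by (simp add: eq_neg_iff_add_eq_0 add.commute)

lemma cinner_diff_left: "cinner (f - g) h = cinner f h - cinner g h"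
  using cinner_add_left[of f "- g" h] by (simp add: cinner_uminus_left)

lemma cinner_diff_right: "cinner f (g - h) = cinner f g - cinner f h"
  by (subst (1 2 3) cinner_commute) (simp add: cinner_diff_left)

lemma norm_hardy_sq: "(norm f)\<^sup>2 = (\<Sum>\<^sub>\<infinity>\<gamma>. (cmod (hardy_coeff f \<gamma>))\<^sup>2)"
  by (simp add: power2_norm_eq_inner inner_hardy_def cinner_self)

lemma cinner_self_norm: "cinner f f = complex_of_real ((norm f)\<^sup>2)"
  by (simp add: norm_hardy_sq cinner_self)

lemma norm_scaleC [simp]: "norm (scaleC c f) = cmod c * norm f"
proof -
  have "complex_of_real ((norm (scaleC c f))\<^sup>2) = (c * cnj c) * cinner f f"
    unfolding cinner_self_norm[symmetric] cinner_scaleC_left cinner_scaleC_right by simp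
  also have "\<dots> = complex_of_real ((cmod c * norm f)\<^sup>2)"
    unfolding complex_norm_square[symmetric] cinner_self_norm
    by (simp add: power_mult_distrib)
  finally have "complex_of_real ((norm (scaleC c f))\<^sup>2) = complex_of_real ((cmod c * norm f)\<^sup>2)" .
  hence "(norm (scaleC c f))\<^sup>2 = (cmod c * norm f)\<^sup>2" by (simp only: of_real_eq_iff)
  thus ?thesis by (simp add: power2_eq_iff_nonneg)
qed

text \<open>
  The Cauchy-Schwarz inequality for the real part gives the complex one after a rotation of \<open>f\<close>.
\<close>

lemma cinner_bound: "cmod (cinner f g) \<le> norm f * norm g"
proof -
  define x where "x = cinner f g"
  define c where "c = cnj x / complex_of_real (cmod x)"
  have "c * x = (x * cnj x) / complex_of_real (cmod x)" by (simp add: c_def)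
  also have "\<dots> = complex_of_real (cmod x)"
    unfolding complex_norm_square[symmetric] by (simp add: power2_eq_square)
  finally have "Re (c * cinner f g) = cmod (cinner f g)" by (simp add: x_def)
  hence "cmod (cinner f g) = inner (scaleC c f) g"
    by (simp add: inner_hardy_def cinner_scaleC_left)
  also have "\<dots> \<le> norm (scaleC c f) * norm g" by (rule norm_cauchy_schwarz)
  also have "\<dots> \<le> norm f * norm g"
    by (intro mult_right_mono) (auto simp: c_def norm_divide)
  finally show ?thesis .
qed

lemma mult_var_adjoint: "cinner (mult_var i f) g = cinner f (backward_shift i g)"
proof -
  let ?e = "\<lambda>\<gamma>. \<gamma> + Poly_Mapping.single i (1 :: nat)"
  have inj: "inj ?e" by (auto simp: inj_def)
  have out: "hardy_coeff (mult_var i f) \<gamma> = 0" if "\<gamma> \<notin> range ?e" for \<gamma>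
  proof (rule ccontr)
    assume "\<not> ?thesis"
    hence "0 < Poly_Mapping.lookup \<gamma> i" by (auto simp: hardy_coeff_mult_var split: if_splits)
    hence "\<gamma> = ?e (\<gamma> - Poly_Mapping.single i 1)"
      by (intro poly_mapping_eqI, transfer) (auto simp: when_def)
    thus False using that by blast
  qed
  have "cinner (mult_var i f) g
      = (\<Sum>\<^sub>\<infinity>\<gamma>\<in>range ?e. hardy_coeff (mult_var i f) \<gamma> * cnj (hardy_coeff g \<gamma>))"
    unfolding cinner_def by (rule infsum_cong_neutral) (auto simp: out)
  also have "\<dots> = cinner f (backward_shift i g)"
    unfolding infsum_reindex[OF inj] o_def cinner_def by simp
  finally show ?thesis .
qed

lemma backward_shift_adjoint: "cinner (backward_shift i f) g = cinner f (mult_var i g)"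
  by (subst (1 2) cinner_commute) (simp add: mult_var_adjoint)

lemma norm_mult_var [simp]: "norm (mult_var i f) = norm f"
proof -
  have "complex_of_real ((norm (mult_var i f))\<^sup>2) = complex_of_real ((norm f)\<^sup>2)"
    by (simp only: cinner_self_norm[symmetric] mult_var_adjoint backward_shift_mult_var)
  thus ?thesis by (simp only: of_real_eq_iff power2_eq_iff_nonneg[OF norm_ge_zero norm_ge_zero])
qed

section \<open>The grading by total degree\<close>

definition homogeneous :: "nat \<Rightarrow> 'd::finite hardy \<Rightarrow> bool"
  where "homogeneous n f \<longleftrightarrow> (\<forall>\<gamma>. hardy_coeff f \<gamma> \<noteq> 0 \<longrightarrow> mdeg \<gamma> = n)"

definition component :: "nat \<Rightarrow> 'd::finite hardy \<Rightarrow> 'd hardy"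
  where "component n f = hardy_of_coeff (\<lambda>\<gamma>. if mdeg \<gamma> = n then hardy_coeff f \<gamma> else 0)"

lemma hardy_coeff_component [simp]:
  "hardy_coeff (component n f) = (\<lambda>\<gamma>. if mdeg \<gamma> = n then hardy_coeff f \<gamma> else 0)"
  unfolding component_def
  by (intro hardy_coeff_of_coeff square_summable_finite finite_subset[OF _ finite_mdeg_eq[of n]]) auto

lemma homogeneous_component [simp]: "homogeneous n (component n f)"
  by (auto simp: homogeneous_def)

lemma component_add: "component n (f + g) = component n f + component n g"
  and component_diff: "component n (f - g) = component n f - component n g"
  and component_scaleC: "component n (scaleC c f) = scaleC c (component n f)"
  and component_0 [simp]: "component n 0 = 0"
  by (rule hardy_eqI; simp)+

lemma component_homogeneous: "homogeneous n f \<Longrightarrow> component m f = (if m = n then f else 0)"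
  by (auto intro!: hardy_eqI simp: homogeneous_def)

lemma component_mult_var: "component (Suc n) (mult_var i f) = mult_var i (component n f)"
proof (rule hardy_eqI)
  fix \<gamma>
  show "hardy_coeff (component (Suc n) (mult_var i f)) \<gamma> = hardy_coeff (mult_var i (component n f)) \<gamma>"
  proof (cases "0 < Poly_Mapping.lookup \<gamma> i")
    case True
    have "\<gamma> = \<gamma> - Poly_Mapping.single i 1 + Poly_Mapping.single i 1"
      using True by (intro poly_mapping_eqI, transfer) (auto simp: when_def)
    hence "mdeg \<gamma> = mdeg (\<gamma> - Poly_Mapping.single i 1) + 1" by (metis mdeg_add mdeg_single)
    thus ?thesis using True by (simp add: hardy_coeff_mult_var)
  qed (simp add: hardy_coeff_mult_var)
qed

lemma component_0_mult_var: "component 0 (mult_var i f) = 0"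
proof (rule hardy_eqI)
  fix \<gamma>
  show "hardy_coeff (component 0 (mult_var i f)) \<gamma> = hardy_coeff 0 \<gamma>"
    using lookup_le_mdeg[of \<gamma> i] by (simp add: hardy_coeff_mult_var)
qed

lemma component_backward_shift: "component n (backward_shift i f) = backward_shift i (component (Suc n) f)"
  by (rule hardy_eqI) simp

lemma homogeneous_iff_component: "homogeneous n f \<longleftrightarrow> component n f = f"
  by (metis component_homogeneous homogeneous_component)

lemma homogeneous_backward_shift: "homogeneous (Suc n) f \<Longrightarrow> homogeneous n (backward_shift i f)"
  by (simp add: homogeneous_iff_component component_backward_shift)

lemma homogeneous_add: "homogeneous n f \<Longrightarrow> homogeneous n g \<Longrightarrow> homogeneous n (f + g)"
  and homogeneous_scaleC: "homogeneous n f \<Longrightarrow> homogeneous n (scaleC c f)"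
  and homogeneous_0 [simp]: "homogeneous n 0"
  by (simp_all add: homogeneous_iff_component component_add component_diff component_scaleC)

lemma cinner_homogeneous:
  assumes "homogeneous n f"
  shows "cinner f g = (\<Sum>\<gamma> | mdeg \<gamma> = n. hardy_coeff f \<gamma> * cnj (hardy_coeff g \<gamma>))"
proof -
  have "cinner f g = (\<Sum>\<^sub>\<infinity>\<gamma>\<in>{\<gamma>. mdeg \<gamma> = n}. hardy_coeff f \<gamma> * cnj (hardy_coeff g \<gamma>))"
    unfolding cinner_def using assms
    by (intro infsum_cong_neutral) (auto simp: homogeneous_def)
  thus ?thesis by (simp add: finite_mdeg_eq)
qed

lemma norm_homogeneous:
  assumes "homogeneous n f"
  shows "(norm f)\<^sup>2 = (\<Sum>\<gamma> | mdeg \<gamma> = n. (cmod (hardy_coeff f \<gamma>))\<^sup>2)"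
proof -
  have "(norm f)\<^sup>2 = (\<Sum>\<^sub>\<infinity>\<gamma>\<in>{\<gamma>. mdeg \<gamma> = n}. (cmod (hardy_coeff f \<gamma>))\<^sup>2)"
    unfolding norm_hardy_sq using assms
    by (intro infsum_cong_neutral) (auto simp: homogeneous_def)
  thus ?thesis by (simp add: finite_mdeg_eq)
qed

text \<open>
  An unordered sum can be evaluated along any exhaustion by finite sets, here by the total degree.
\<close>

lemma sums_by_degree:
  fixes h :: "('d::finite \<Rightarrow>\<^sub>0 nat) \<Rightarrow> 'b::{comm_monoid_add, t2_space}"
  assumes "h summable_on UNIV"
  shows "(\<lambda>n. \<Sum>\<gamma> | mdeg \<gamma> = n. h \<gamma>) sums infsum h UNIV"
proof -
  have "(sum h \<longlongrightarrow> infsum h UNIV) (finite_subsets_at_top UNIV)"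
    using has_sum_infsum[OF assms] by (simp add: has_sum_def)
  moreover have "filterlim (\<lambda>N. {\<gamma> :: 'd \<Rightarrow>\<^sub>0 nat. mdeg \<gamma> < N}) (finite_subsets_at_top UNIV) sequentially"
    unfolding filterlim_finite_subsets_at_top
  proof safe
    fix X :: "('d \<Rightarrow>\<^sub>0 nat) set" assume "finite X"
    hence "\<forall>\<^sub>F N in sequentially. \<forall>\<gamma>\<in>X. mdeg \<gamma> < N"
      by (subst eventually_ball_finite_distrib) (auto intro: eventually_gt_at_top)
    thus "\<forall>\<^sub>F N in sequentially. finite {\<gamma> :: 'd \<Rightarrow>\<^sub>0 nat. mdeg \<gamma> < N} \<and> X \<subseteq> {\<gamma>. mdeg \<gamma> < N} \<and> {\<gamma>. mdeg \<gamma> < N} \<subseteq> UNIV"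
    proof eventually_elim
      case (elim N)
      have "finite {\<gamma> :: 'd \<Rightarrow>\<^sub>0 nat. mdeg \<gamma> < N}"
        by (rule finite_subset[OF _ finite_mdeg_le[of N]]) auto
      thus ?case using elim by auto
    qed
  qed
  ultimately have "(\<lambda>N. sum h {\<gamma>. mdeg \<gamma> < N}) \<longlonglongrightarrow> infsum h UNIV"
    by (rule filterlim_compose)
  moreover have "sum h {\<gamma>. mdeg \<gamma> < N} = (\<Sum>n<N. \<Sum>\<gamma> | mdeg \<gamma> = n. h \<gamma>)" for N
  proof -
    have "(\<Sum>n<N. \<Sum>\<gamma> | mdeg \<gamma> = n. h \<gamma>) = sum h (\<Union>n\<in>{..<N}. {\<gamma>. mdeg \<gamma> = n})"
      by (rule sum.UNION_disjoint[symmetric]) (auto simp: finite_mdeg_eq)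
    also have "(\<Union>n\<in>{..<N}. {\<gamma>. mdeg \<gamma> = n}) = {\<gamma> :: 'd \<Rightarrow>\<^sub>0 nat. mdeg \<gamma> < N}" by auto
    finally show ?thesis by simp
  qed
  ultimately show ?thesis by (simp add: sums_def)
qed

lemma cinner_sums: "(\<lambda>n. cinner (component n f) (component n g)) sums cinner f g"
proof -
  have "cinner (component n f) (component n g)
      = (\<Sum>\<gamma> | mdeg \<gamma> = n. hardy_coeff f \<gamma> * cnj (hardy_coeff g \<gamma>))" for n
    by (subst cinner_homogeneous[OF homogeneous_component]) simp
  thus ?thesis using sums_by_degree[OF cinner_summable[of f g]] by (simp add: cinner_def)
qed

lemma norm_component_sq:
  "(norm (component n f))\<^sup>2 = (\<Sum>\<gamma> | mdeg \<gamma> = n. (cmod (hardy_coeff f \<gamma>))\<^sup>2)"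
  by (subst norm_homogeneous[OF homogeneous_component]) simp

lemma norm_sq_sums: "(\<lambda>n. (norm (component n f))\<^sup>2) sums (norm f)\<^sup>2"
proof -
  have "(\<lambda>\<gamma>. (cmod (hardy_coeff f \<gamma>))\<^sup>2) summable_on UNIV"
    using square_summable_hardy_coeff[of f] by (simp only: square_summable_def)
  from sums_by_degree[OF this] show ?thesis
    by (simp only: norm_component_sq norm_hardy_sq[of f])
qed

lemma norm_component_le: "norm (component n f) \<le> norm f"
proof -
  have "(\<Sum>m\<in>{n}. (norm (component m f))\<^sup>2) \<le> (norm f)\<^sup>2"
    using norm_sq_sums[of f] by (intro sum_le_suminf[of _ "{n}", THEN order_trans])
      (auto simp: sums_iff)
  thus ?thesis by (simp add: power2_le_iff_abs_le)
qed

lemma square_summable_by_degree: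
  fixes a :: "('d::finite \<Rightarrow>\<^sub>0 nat) \<Rightarrow> complex"
  assumes bound: "\<And>N. (\<Sum>n<N. \<Sum>\<gamma> | mdeg \<gamma> = n. (cmod (a \<gamma>))\<^sup>2) \<le> B"
  shows "square_summable a"
  unfolding square_summable_def
proof (rule nonneg_bounded_partial_sums_imp_summable_on)
  show "\<forall>\<^sub>F X in finite_subsets_at_top UNIV. (\<Sum>\<gamma>\<in>X. (cmod (a \<gamma>))\<^sup>2) \<le> B"
    unfolding eventually_finite_subsets_at_top
  proof (intro exI[of _ "{}"] conjI allI impI; clarsimp?)
    fix X :: "('d \<Rightarrow>\<^sub>0 nat) set" assume X: "finite X"
    define N where "N = Suc (Max (insert 0 (mdeg ` X)))"
    have N: "mdeg \<gamma> < N" if "\<gamma> \<in> X" for \<gamma>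
      using X that by (auto simp: N_def less_Suc_eq_le)
    have "(\<Sum>\<gamma>\<in>X. (cmod (a \<gamma>))\<^sup>2) \<le> (\<Sum>\<gamma>\<in>(\<Union>n\<in>{..<N}. {\<gamma>. mdeg \<gamma> = n}). (cmod (a \<gamma>))\<^sup>2)"
      using N by (intro sum_mono2) (auto simp: finite_mdeg_eq)
    also have "\<dots> = (\<Sum>n<N. \<Sum>\<gamma> | mdeg \<gamma> = n. (cmod (a \<gamma>))\<^sup>2)"
      by (rule sum.UNION_disjoint) (auto simp: finite_mdeg_eq)
    finally show "(\<Sum>\<gamma>\<in>X. (cmod (a \<gamma>))\<^sup>2) \<le> B" using bound[of N] by simp
  qed
qed auto

lemma exists_with_components:
  fixes g :: "nat \<Rightarrow> 'd::finite hardy"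
  assumes hom: "\<And>n. homogeneous n (g n)" and bound: "\<And>N. (\<Sum>n<N. (norm (g n))\<^sup>2) \<le> B"
  shows "\<exists>f. \<forall>n. component n f = g n"
proof -
  let ?a = "\<lambda>\<gamma>. hardy_coeff (g (mdeg \<gamma>)) \<gamma>"
  have "(\<Sum>\<gamma> | mdeg \<gamma> = n. (cmod (?a \<gamma>))\<^sup>2) = (norm (g n))\<^sup>2" for n
    unfolding norm_homogeneous[OF hom] by (rule sum.cong) auto
  hence s: "square_summable ?a"
    using bound by (intro square_summable_by_degree[of _ B]) simp
  have "component n (hardy_of_coeff ?a) = g n" for n
    using hom[of n] by (intro hardy_eqI) (auto simp: hardy_coeff_of_coeff[OF s] homogeneous_def)
  thus ?thesis by blast
qed

section \<open>Linear maps on finite-dimensional subspaces\<close>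

definition linear_on :: "'d::finite hardy set \<Rightarrow> ('d hardy \<Rightarrow> 'd hardy) \<Rightarrow> bool"
  where "linear_on V W \<longleftrightarrow> (\<forall>f\<in>V. W f \<in> V) \<and> (\<forall>f\<in>V. \<forall>g\<in>V. W (f + g) = W f + W g)
    \<and> (\<forall>c. \<forall>f\<in>V. W (scaleC c f) = scaleC c (W f))"

lemma scaleC_0_left [simp]: "scaleC 0 f = 0" and scaleC_0_right [simp]: "scaleC c 0 = 0"
  and scaleC_1 [simp]: "scaleC 1 f = f"
  by (rule hardy_eqI; simp)+

lemma linear_on_0:
  assumes "hardy.subspace V" "linear_on V W"
  shows "W 0 = 0"
proof -
  have "W (scaleC 0 0) = scaleC 0 (W 0)"
    using assms hardy.subspace_0 unfolding linear_on_def by blast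
  thus ?thesis by simp
qed

lemma linear_on_shift:
  assumes V: "hardy.subspace V" and W: "linear_on V W"
  shows "linear_on V (\<lambda>f. W f - scaleC a f)"
  unfolding linear_on_def
proof (intro conjI ballI allI)
  fix f g c assume f: "f \<in> V" and g: "g \<in> V"
  show "W f - scaleC a f \<in> V"
    using f V W hardy.subspace_diff hardy.subspace_scale unfolding linear_on_def by blast
  have "W (f + g) = W f + W g" using f g W unfolding linear_on_def by blast
  thus "W (f + g) - scaleC a (f + g) = W f - scaleC a f + (W g - scaleC a g)"
    by (intro hardy_eqI) (simp add: algebra_simps)
next
  fix f c assume f: "f \<in> V"
  have "W (scaleC c f) = scaleC c (W f)" using f W unfolding linear_on_def by blast
  thus "W (scaleC c f) - scaleC a (scaleC c f) = scaleC c (W f - scaleC a f)"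
    by (intro hardy_eqI) (simp add: algebra_simps)
qed

text \<open>
  The vector \<open>p(W) f\<close>, by Horner's scheme.
\<close>

definition poly_apply :: "('d::finite hardy \<Rightarrow> 'd hardy) \<Rightarrow> complex poly \<Rightarrow> 'd hardy \<Rightarrow> 'd hardy"
  where "poly_apply W p f = fold_coeffs (\<lambda>a g. scaleC a f + W g) p 0"

context
  fixes V :: "'d::finite hardy set" and W
  assumes V: "hardy.subspace V" and W: "linear_on V W"
begin

lemma poly_apply_0 [simp]: "poly_apply W 0 f = 0"
  by (simp add: poly_apply_def)

lemma poly_apply_pCons [simp]: "poly_apply W (pCons a p) f = scaleC a f + W (poly_apply W p f)"
  by (cases "pCons a p = 0") (auto simp: poly_apply_def linear_on_0[OF V W])

lemma poly_apply_in:
  assumes "f \<in> V"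
  shows "poly_apply W p f \<in> V"
proof (induction p)
  case (pCons a p)
  thus ?case using assms W hardy.subspace_add[OF V] hardy.subspace_scale[OF V]
    by (simp add: linear_on_def)
qed (simp add: hardy.subspace_0[OF V])

lemma poly_apply_add:
  assumes "f \<in> V"
  shows "poly_apply W (p + q) f = poly_apply W p f + poly_apply W q f"
proof (induction p q rule: poly_induct2)
  case (pCons a p b q)
  have "W (poly_apply W p f + poly_apply W q f) = W (poly_apply W p f) + W (poly_apply W q f)"
    using W poly_apply_in[OF assms] unfolding linear_on_def by blast
  thus ?case by (simp add: pCons.IH hardy.scale_left_distrib)
qed simp

lemma poly_apply_smult:
  assumes "f \<in> V"
  shows "poly_apply W (smult c p) f = scaleC c (poly_apply W p f)"
proof (induction p)
  case (pCons a p)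
  have "W (scaleC c (poly_apply W p f)) = scaleC c (W (poly_apply W p f))"
    using W poly_apply_in[OF assms] unfolding linear_on_def by blast
  thus ?case by (simp add: pCons.IH hardy.scale_right_distrib)
qed simp

lemma poly_apply_linear_factor:
  assumes "f \<in> V"
  shows "poly_apply W ([:- a, 1:] * p) f = W (poly_apply W p f) - scaleC a (poly_apply W p f)"
proof -
  have "[:- a, 1:] * p = smult (- a) p + pCons 0 p" by simp
  hence "poly_apply W ([:- a, 1:] * p) f = scaleC (- a) (poly_apply W p f) + W (poly_apply W p f)"
    by (simp only: poly_apply_add[OF assms] poly_apply_smult[OF assms] poly_apply_pCons scaleC_0_left add_0_left)
  thus ?thesis by (simp add: hardy.scale_minus_left)
qed

lemma poly_apply_sum:
  assumes "f \<in> V"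
  shows "poly_apply W (\<Sum>k\<in>A. p k) f = (\<Sum>k\<in>A. poly_apply W (p k) f)"
  by (induction A rule: infinite_finite_induct) (simp_all add: poly_apply_add[OF assms])

text \<open>
  The iterates of a vector are linearly dependent, so some nonzero polynomial in \<open>W\<close> annihilates it.
  For one of least degree, split off a linear factor with root \<open>a\<close>; the cofactor applied to the vector
  is an eigenvector.
\<close>

lemma exists_eigenvector:
  assumes B: "finite B" "V \<subseteq> hardy.span B" and ne: "V \<noteq> {0}"
  shows "\<exists>a. \<exists>f\<in>V. f \<noteq> 0 \<and> W f = scaleC a f"
proof -
  obtain v where v: "v \<in> V" "v \<noteq> 0" using ne hardy.subspace_0[OF V] by auto
  have "\<exists>u. poly_apply W (monom 1 k) v = (\<Sum>b\<in>B. scaleC (u b) b)" for k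
    using poly_apply_in[OF v(1)] B hardy.span_finite[OF B(1)] by blast
  then obtain u where u: "poly_apply W (monom 1 k) v = (\<Sum>b\<in>B. scaleC (u k b) b)" for k by metis
  have "\<exists>c. (\<exists>k\<in>{..card B}. c k \<noteq> 0) \<and> (\<forall>b\<in>B. (\<Sum>k\<le>card B. c k * u k b) = 0)"
    by (rule underdetermined_system) (use B in auto)
  then obtain c k0 where c: "k0 \<le> card B" "c k0 \<noteq> 0" "\<And>b. b \<in> B \<Longrightarrow> (\<Sum>k\<le>card B. c k * u k b) = 0"
    by auto
  define p0 where "p0 = (\<Sum>k\<le>card B. smult (c k) (monom 1 k))"
  have "coeff p0 k0 = c k0" using c(1) by (simp add: p0_def coeff_sum if_distrib cong: if_cong)
  hence p0: "p0 \<noteq> 0" using c(2) by auto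
  have "poly_apply W p0 v = (\<Sum>k\<le>card B. \<Sum>b\<in>B. scaleC (c k * u k b) b)"
    unfolding p0_def poly_apply_sum[OF v(1)] poly_apply_smult[OF v(1)] u
    by (simp add: hardy.scale_sum_right)
  also have "\<dots> = (\<Sum>b\<in>B. scaleC (\<Sum>k\<le>card B. c k * u k b) b)"
    by (subst sum.swap) (simp add: hardy.scale_sum_left)
  also have "\<dots> = 0" using c(3) by (intro sum.neutral) simp
  finally have "p0 \<noteq> 0 \<and> poly_apply W p0 v = 0" using p0 by simp
  then obtain p where p: "p \<noteq> 0" "poly_apply W p v = 0"
    and least: "\<And>r. r \<noteq> 0 \<Longrightarrow> poly_apply W r v = 0 \<Longrightarrow> degree p \<le> degree r"
    using ex_has_least_nat[of "\<lambda>p. p \<noteq> 0 \<and> poly_apply W p v = 0" p0 degree] by metis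
  have "degree p \<noteq> 0"
  proof
    assume "degree p = 0"
    then obtain a where "p = [:a:]" by (metis degree_eq_zeroE)
    hence "a \<noteq> 0" "scaleC a v = 0" using p by (auto simp: linear_on_0[OF V W])
    thus False using v(2) by simp
  qed
  hence "\<not> constant (poly p)" by (simp add: constant_degree)
  then obtain a where "poly p a = 0" using fundamental_theorem_of_algebra by blast
  then obtain r where r: "p = [:- a, 1:] * r" by (auto simp: poly_eq_0_iff_dvd)
  have "r \<noteq> 0" using r p by auto
  hence "degree p = Suc (degree r)" unfolding r by (subst degree_mult_eq) auto
  hence "poly_apply W r v \<noteq> 0" using least[of r] \<open>r \<noteq> 0\<close> by auto
  moreover have "W (poly_apply W r v) = scaleC a (poly_apply W r v)"
    using p(2) unfolding r poly_apply_linear_factor[OF v(1)] by simp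
  ultimately show ?thesis using poly_apply_in[OF v(1)] by blast
qed

end

text \<open>
  The product of the operators \<open>W - a\<close>, the head of the list being applied first.
\<close>

fun shift_product :: "('d::finite hardy \<Rightarrow> 'd hardy) \<Rightarrow> complex list \<Rightarrow> 'd hardy \<Rightarrow> 'd hardy"
  where
    "shift_product W [] f = f"
  | "shift_product W (a # as) f = shift_product W as (W f - scaleC a f)"

lemma linear_on_span_image:
  assumes W: "linear_on V W" and V: "hardy.subspace V" and S: "S \<subseteq> V" and f: "f \<in> hardy.span S"
  shows "f \<in> V \<and> W f \<in> hardy.span (W ` S)"
  using f
proof (induction rule: hardy.span_induct_alt)
  case base
  thus ?case using hardy.subspace_0[OF V] linear_on_0[OF V W] hardy.span_zero by simp
next
  case (step c x y)
  have x: "x \<in> V" using step S by auto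
  have "W (scaleC c x + y) = scaleC c (W x) + W y"
    using W x step hardy.subspace_scale[OF V] unfolding linear_on_def by metis
  moreover have "W x \<in> hardy.span (W ` S)" using step by (intro hardy.span_base) auto
  ultimately show ?case
    using step x hardy.span_add hardy.span_scale hardy.subspace_add[OF V] hardy.subspace_scale[OF V]
    by metis
qed

text \<open>
  A weak form of the Cayley-Hamilton theorem that keeps track of the roots. For an eigenvalue \<open>a\<close> the
  image of \<open>W - a\<close> is spanned by fewer vectors, because an eigenvector can be exchanged for one of
  the generators and is mapped to zero; the induction continues on that image.
\<close>

lemma shift_product_eq_0:
  assumes "finite B" "linear_on (hardy.span B) W"
    and "\<And>a f. f \<in> hardy.span B \<Longrightarrow> f \<noteq> 0 \<Longrightarrow> W f = scaleC a f \<Longrightarrow> a \<in> \<Lambda>"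
  shows "\<exists>as. set as \<subseteq> \<Lambda> \<and> (\<forall>f\<in>hardy.span B. shift_product W as f = 0)"
  using assms
proof (induction "card B" arbitrary: B rule: less_induct)
  case less
  let ?V = "hardy.span B"
  have V: "hardy.subspace ?V" by simp
  note W = less.prems(2)
  show ?case
  proof (cases "?V = {0}")
    case True
    thus ?thesis by (intro exI[of _ "[]"]) auto
  next
    case False
    obtain a v where v: "v \<in> ?V" "v \<noteq> 0" "W v = scaleC a v"
      using exists_eigenvector[OF V W less.prems(1) _ False] by auto
    define Y where "Y = (\<lambda>f. W f - scaleC a f)"
    have Y: "linear_on ?V Y" unfolding Y_def by (rule linear_on_shift[OF V W])
    obtain u where u: "v = (\<Sum>b\<in>B. scaleC (u b) b)"
      using v(1) hardy.span_finite[OF less.prems(1)] by auto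
    obtain b where b: "b \<in> B" "u b \<noteq> 0"
      using u v(2) by (metis (no_types, lifting) scaleC_0_left sum.neutral)
    let ?D = "B - {b}"
    have "b \<in> hardy.span (insert v ?D)"
    proof -
      have "v = scaleC (u b) b + (\<Sum>x\<in>?D. scaleC (u x) x)"
        using u sum.remove[OF less.prems(1) b(1)] by metis
      hence "scaleC (u b) b = v - (\<Sum>x\<in>?D. scaleC (u x) x)" by simp
      moreover have "v - (\<Sum>x\<in>?D. scaleC (u x) x) \<in> hardy.span (insert v ?D)"
        by (intro hardy.span_diff hardy.span_sum hardy.span_scale) (auto intro: hardy.span_base)
      ultimately have "scaleC (inverse (u b)) (scaleC (u b) b) \<in> hardy.span (insert v ?D)"
        by (metis hardy.span_scale)
      thus ?thesis using b by simp
    qed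
    hence "B \<subseteq> hardy.span (insert v ?D)" by (auto intro: hardy.span_base)
    hence V_le: "?V \<subseteq> hardy.span (insert v ?D)" by (rule hardy.span_minimal) simp
    have D: "?D \<subseteq> ?V" by (auto intro: hardy.span_base)
    define C where "C = Y ` ?D"
    have Y_in: "Y f \<in> hardy.span C" if f: "f \<in> ?V" for f
    proof -
      obtain k where k: "f - scaleC k v \<in> hardy.span ?D"
        using f V_le hardy.span_breakdown_eq by blast
      have "Y (f - scaleC k v) = Y f"
      proof -
        have "Y (f - scaleC k v + scaleC k v) = Y (f - scaleC k v) + scaleC k (Y v)"
          using Y v(1) f hardy.subspace_diff[OF V] hardy.subspace_scale[OF V]
          unfolding linear_on_def by metis
        thus ?thesis using v(3) by (simp add: Y_def)
      qed
      thus ?thesis using linear_on_span_image[OF Y V D k] by (simp add: C_def)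
    qed
    have C: "C \<subseteq> ?V" using Y D unfolding C_def linear_on_def by auto
    have span_C: "hardy.span C \<subseteq> ?V" using C by (rule hardy.span_minimal) simp
    have "W x \<in> hardy.span C" if x: "x \<in> C" for x
    proof -
      obtain d where d: "d \<in> ?V" "x = Y d" using x D unfolding C_def by auto
      have "W d \<in> ?V" "W (scaleC a d) = scaleC a (W d)" using W d unfolding linear_on_def by auto
      moreover have "W (W d - scaleC a d + scaleC a d) = W (W d - scaleC a d) + W (scaleC a d)"
        using W d \<open>W d \<in> ?V\<close> hardy.subspace_diff[OF V] hardy.subspace_scale[OF V]
        unfolding linear_on_def by metis
      ultimately have "W x = Y (W d)" unfolding d Y_def by simp
      thus ?thesis using Y_in \<open>W d \<in> ?V\<close> by simp
    qed
    hence "W ` C \<subseteq> hardy.span C" by auto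
    hence "hardy.span (W ` C) \<subseteq> hardy.span C" by (rule hardy.span_minimal) simp
    hence "W f \<in> hardy.span C" if "f \<in> hardy.span C" for f
      using linear_on_span_image[OF W V C that] by auto
    hence W_C: "linear_on (hardy.span C) W"
      using W span_C unfolding linear_on_def by blast
    have "finite C" "card C < card B"
      using less.prems(1) b(1) card_image_le[of ?D Y] card_Diff1_less[of B b] by (auto simp: C_def)
    then obtain as where as: "set as \<subseteq> \<Lambda>" "\<And>f. f \<in> hardy.span C \<Longrightarrow> shift_product W as f = 0"
      using less.hyps[of C] W_C less.prems(3) span_C by blast
    moreover have "a \<in> \<Lambda>" using less.prems(3) v by blast
    moreover have "shift_product W (a # as) f = 0" if "f \<in> ?V" for f
      using as(2)[OF Y_in[OF that]] by (simp add: Y_def)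
    ultimately show ?thesis by (intro exI[of _ "a # as"]) auto
  qed
qed

text \<open>
  A Gram-Schmidt step: a new generator is replaced by its component \<open>e\<close> orthogonal to the previous
  ones.
\<close>

lemma exists_projection_finite:
  assumes "finite B"
  shows "\<exists>g\<in>hardy.span B. \<forall>h\<in>hardy.span B. cinner (f - g) h = 0"
  using assms
proof (induction B arbitrary: f rule: finite_induct)
  case empty
  show ?case by (intro bexI[of _ 0]) auto
next
  case (insert b B)
  obtain p where p: "p \<in> hardy.span B" "\<And>h. h \<in> hardy.span B \<Longrightarrow> cinner (b - p) h = 0"
    using insert.IH by blast
  obtain g where g: "g \<in> hardy.span B" "\<And>h. h \<in> hardy.span B \<Longrightarrow> cinner (f - g) h = 0"
    using insert.IH by blast
  define e where "e = b - p"
  define c where "c = cinner f e / cinner e e"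
  have e_perp: "cinner e h = 0" "cinner h e = 0" if "h \<in> hardy.span B" for h
    using p(2)[OF that] cinner_commute[of h e] by (simp_all add: e_def)
  have e_c: "c * cinner e e = cinner f e"
    by (cases "e = 0") (auto simp: c_def cinner_self_norm)
  have sub: "hardy.span B \<subseteq> hardy.span (insert b B)" by (rule hardy.span_mono) auto
  have "g + scaleC c e \<in> hardy.span (insert b B)"
    unfolding e_def using g p sub
    by (intro hardy.span_add hardy.span_scale hardy.span_diff) (auto intro: hardy.span_base)
  moreover have "cinner (f - (g + scaleC c e)) h = 0" if h: "h \<in> hardy.span (insert b B)" for h
  proof -
    obtain k where k: "h - scaleC k b \<in> hardy.span B" using h hardy.span_breakdown_eq by blast
    define h1 where "h1 = h - scaleC k b + scaleC k p"
    have h1: "h1 \<in> hardy.span B"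
      unfolding h1_def using k p by (intro hardy.span_add hardy.span_scale)
    have "h = scaleC k e + h1"
      by (rule hardy_eqI) (simp add: h1_def e_def algebra_simps)
    moreover have "f - (g + scaleC c e) = (f - g) - scaleC c e" by simp
    moreover have "cinner (f - g) e = cinner f e" using e_perp(2)[OF g(1)] by (simp add: cinner_diff_left)
    ultimately show ?thesis using g(2)[OF h1] e_perp(1)[OF h1] e_c
      by (simp only: cinner_diff_left[of "f - g"] cinner_add_right cinner_scaleC_left cinner_scaleC_right)
         simp
  qed
  ultimately show ?case by blast
qed

lemma linear_backward_shift: "Vector_Spaces.linear scaleC scaleC (backward_shift i)"
  by unfold_locales (simp_all add: backward_shift_add backward_shift_scaleC)

lemma finite_dim_basis:
  assumes "finite B" "V \<subseteq> hardy.span B"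
  obtains C where "finite C" "C \<subseteq> V" "hardy.independent C" "V \<subseteq> hardy.span C" "card C = hardy.dim V"
proof -
  obtain C where C: "C \<subseteq> V" "hardy.independent C" "V \<subseteq> hardy.span C" "card C = hardy.dim V"
    using hardy.basis_exists[of V] by blast
  moreover have "finite C" using hardy.independent_span_bound[of B C] assms C by auto
  ultimately show ?thesis using that by blast
qed

lemma injective_linear_dim:
  assumes fin: "finite BU" "U \<subseteq> hardy.span BU" "finite BV" "V \<subseteq> hardy.span BV"
    and U: "hardy.subspace U" and V: "hardy.subspace V"
    and T: "Vector_Spaces.linear scaleC scaleC T" "T ` U \<subseteq> V"
    and inj: "\<And>f. f \<in> U \<Longrightarrow> T f = 0 \<Longrightarrow> f = 0"
  shows "hardy.dim U \<le> hardy.dim V" and "hardy.dim U = hardy.dim V \<Longrightarrow> T ` U = V"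
proof -
  interpret T: Vector_Spaces.linear scaleC scaleC T by (rule T)
  obtain C where C: "finite C" "C \<subseteq> U" "hardy.independent C" "U \<subseteq> hardy.span C" "card C = hardy.dim U"
    using finite_dim_basis[OF fin(1,2)] by blast
  obtain D where D: "finite D" "D \<subseteq> V" "hardy.independent D" "V \<subseteq> hardy.span D" "card D = hardy.dim V"
    using finite_dim_basis[OF fin(3,4)] by blast
  have span_C: "hardy.span C \<subseteq> U" by (rule hardy.span_minimal[OF C(2) U])
  have inj_C: "inj_on T (hardy.span C)"
  proof (rule inj_onI)
    fix x y assume "x \<in> hardy.span C" "y \<in> hardy.span C" "T x = T y"
    hence "x - y \<in> U" "T (x - y) = 0" using span_C hardy.span_diff by (auto simp: T.diff)
    thus "x = y" using inj[of "x - y"] by simp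
  qed
  have ind: "hardy.independent (T ` C)"
    by (rule T.independent_injective_image[OF C(3) inj_C])
  have card_TC: "card (T ` C) = hardy.dim U"
    using card_image[OF inj_on_subset[OF inj_C]] hardy.span_superset C(5) by metis
  have TC: "T ` C \<subseteq> V" using T(2) C(2) by auto
  have bound: "card S \<le> hardy.dim V" if "hardy.independent S" "S \<subseteq> V" for S
    using hardy.independent_span_bound[OF D(1) that(1)] that(2) D(4,5) by auto
  show "hardy.dim U \<le> hardy.dim V" using bound[OF ind TC] card_TC by simp
  assume eq: "hardy.dim U = hardy.dim V"
  have "V \<subseteq> hardy.span (T ` C)"
  proof (rule ccontr)
    assume "\<not> ?thesis"
    then obtain v where v: "v \<in> V" "v \<notin> hardy.span (T ` C)" by auto
    hence "hardy.independent (insert v (T ` C))" using ind hardy.independent_insertI by blast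
    hence "card (insert v (T ` C)) \<le> hardy.dim V" using bound v TC by blast
    moreover have "v \<notin> T ` C" using v hardy.span_superset by blast
    ultimately show False using C(1) card_TC eq by simp
  qed
  moreover have "hardy.span (T ` C) = T ` hardy.span C" by (rule T.span_image)
  ultimately show "T ` U = V" using T(2) span_C by blast
qed

lemma nonincreasing_nat_eventually_constant:
  fixes u :: "nat \<Rightarrow> nat"
  assumes "\<And>n. N \<le> n \<Longrightarrow> u (Suc n) \<le> u n"
  shows "\<exists>m\<ge>N. \<forall>n\<ge>m. u n = u m"
proof -
  obtain m where m: "N \<le> m" "\<And>n. N \<le> n \<Longrightarrow> u m \<le> u n"
    using ex_has_least_nat[of "\<lambda>n. N \<le> n" N u] by blast
  have "u n = u m" if "m \<le> n" for n
    using that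
  proof (induction n rule: dec_induct)
    case (step n)
    have "N \<le> n" using m(1) step by simp
    thus ?case using assms[of n] m(2)[of "Suc n"] step by simp
  qed simp
  thus ?thesis using m(1) by blast
qed

section \<open>Recurrences with unimodular roots\<close>

text \<open>
  The product of the difference operators that send \<open>b\<close> to \<open>b (k + 1) - a b k\<close>, for the \<open>a\<close> in the list.
\<close>

fun recurrence :: "complex list \<Rightarrow> (nat \<Rightarrow> complex) \<Rightarrow> nat \<Rightarrow> complex"
  where
    "recurrence [] b = b"
  | "recurrence (a # as) b = recurrence as (\<lambda>k. b (Suc k) - a * b k)"

lemma recurrence_cong:
  assumes "\<And>m. m \<le> k + length as \<Longrightarrow> b m = b' m"
  shows "recurrence as b k = recurrence as b' k"
  using assms
proof (induction as arbitrary: b b')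
  case (Cons a as)
  show ?case unfolding recurrence.simps
    by (rule Cons.IH) (simp add: Cons.prems)
qed simp

lemma recurrence_shift: "recurrence as (\<lambda>k. b (k + r)) k = recurrence as b (k + r)"
proof (induction as arbitrary: b)
  case (Cons a as)
  show ?case using Cons.IH[of "\<lambda>k. b (Suc k) - a * b k"] by simp
qed simp

lemma recurrence_sum:
  assumes "finite A"
  shows "recurrence as (\<lambda>k. \<Sum>x\<in>A. w x * b x k) k = (\<Sum>x\<in>A. w x * recurrence as (b x) k)"
proof (induction as arbitrary: b)
  case (Cons a as)
  have "(\<Sum>x\<in>A. w x * b x (Suc k)) - a * (\<Sum>x\<in>A. w x * b x k)
      = (\<Sum>x\<in>A. w x * (b x (Suc k) - a * b x k))" for k
    by (simp add: right_diff_distrib sum_subtractf sum_distrib_left mult_ac)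
  thus ?case using Cons.IH[of "\<lambda>x k. b x (Suc k) - a * b x k"] by simp
qed simp

text \<open>
  Induction on the number of roots. Subtract from \<open>b\<close> its average over a window of half the length,
  rotated by the powers of the root \<open>a\<close>. The difference is a combination of terms of
  \<open>b (k + 1) - a b k\<close>, so the remaining recurrence annihilates it and the induction hypothesis bounds
  its first term; the average itself is at most the sum divided by the length of the window, because
  \<open>|a| = 1\<close>.
\<close>

lemma first_term_bound:
  assumes "\<And>a. a \<in> set as \<Longrightarrow> cmod a = 1"
  shows "\<exists>C\<ge>0. \<forall>K b. (\<forall>k. k + length as \<le> K \<longrightarrow> recurrence as b k = 0) \<longrightarrow>
    cmod (b 0) * real (Suc K) \<le> C * (\<Sum>k\<le>K. cmod (b k))"
  using assms
proof (induction as)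
  case Nil
  show ?case by (intro exI[of _ 0]) auto
next
  case (Cons a as)
  have a: "cmod a = 1" "a \<noteq> 0" using Cons.prems[of a] by auto
  obtain C where C: "C \<ge> 0" "\<And>K b. (\<And>k. k + length as \<le> K \<Longrightarrow> recurrence as b k = 0) \<Longrightarrow>
      cmod (b 0) * real (Suc K) \<le> C * (\<Sum>k\<le>K. cmod (b k))"
    using Cons by fastforce
  have "cmod (b 0) * real (Suc K) \<le> (4 * C + 2) * (\<Sum>k\<le>K. cmod (b k))"
    if zero: "\<And>k. k + length (a # as) \<le> K \<Longrightarrow> recurrence (a # as) b k = 0" for K b
  proof -
    \<comment> \<open>Both the window and the range that is left for the induction hypothesis are at least \<open>(K + 1) / 2\<close> long.\<close>
    define H where "H = K div 2"
    define S where "S = (\<Sum>k\<le>K. cmod (b k))"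
    define h where "h = real (Suc H)"
    have h: "h > 0" by (simp add: h_def)
    define e where "e = (\<lambda>k. b (Suc k) - a * b k)"
    define d where "d = (\<lambda>s k. \<Sum>r<s. (1 / a ^ Suc r) * e (k + r))"
    define c where "c = (\<lambda>k. \<Sum>s\<le>H. (- 1 / of_nat (Suc H)) * d s k)"
    have d: "d s k = b (k + s) / a ^ s - b k" for s k
    proof (induction s)
      case (Suc s)
      have "d (Suc s) k = d s k + (1 / a ^ Suc s) * e (k + s)" by (simp add: d_def)
      also have "\<dots> = b (k + Suc s) / a ^ Suc s - b k"
        unfolding Suc.IH using a(2) by (simp add: e_def field_simps)
      finally show ?case .
    qed (simp add: d_def)
    have c: "c k = b k - (\<Sum>s\<le>H. b (k + s) / a ^ s) / of_nat (Suc H)" for k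
    proof -
      have "c k = (- 1 / of_nat (Suc H)) * ((\<Sum>s\<le>H. b (k + s) / a ^ s) - of_nat (Suc H) * b k)"
        unfolding c_def d sum_distrib_left[symmetric] sum_subtractf by simp
      also have "\<dots> = b k - (\<Sum>s\<le>H. b (k + s) / a ^ s) / of_nat (Suc H)"
        by (simp add: field_simps del: of_nat_Suc)
      finally show ?thesis .
    qed
    have "recurrence as c k = 0" if k: "k + length as \<le> K - H" for k
    proof -
      have "recurrence as (d s) k = 0" if s: "s \<le> H" for s
      proof -
        have "recurrence as (d s) k = (\<Sum>r<s. (1 / a ^ Suc r) * recurrence as (\<lambda>k. e (k + r)) k)"
          unfolding d_def by (rule recurrence_sum) simp
        also have "\<dots> = 0"
        proof (intro sum.neutral ballI)
          fix r assume r: "r \<in> {..<s}"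
          have "H \<le> K" by (simp add: H_def)
          hence "recurrence (a # as) b (k + r) = 0" using k s r by (intro zero) simp
          thus "(1 / a ^ Suc r) * recurrence as (\<lambda>k. e (k + r)) k = 0"
            unfolding recurrence_shift by (simp add: e_def)
        qed
        finally show ?thesis .
      qed
      thus ?thesis unfolding c_def by (subst recurrence_sum) auto
    qed
    hence c0: "cmod (c 0) * real (Suc (K - H)) \<le> C * (\<Sum>k\<le>K - H. cmod (c k))"
      by (rule C(2))
    have avg: "cmod ((\<Sum>s\<le>H. b (k + s) / a ^ s) / of_nat (Suc H)) \<le> (\<Sum>s\<le>H. cmod (b (k + s))) / h" for k
    proof -
      have "cmod (\<Sum>s\<le>H. b (k + s) / a ^ s) \<le> (\<Sum>s\<le>H. cmod (b (k + s)))"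
        by (rule order_trans[OF norm_sum]) (simp add: norm_divide norm_power a)
      thus ?thesis unfolding norm_divide h_def by (simp add: divide_right_mono del: of_nat_Suc)
    qed
    have window: "(\<Sum>k\<le>K - H. cmod (b (k + s))) \<le> S" if "s \<le> H" for s
    proof -
      have "H \<le> K" by (simp add: H_def)
      have "(\<Sum>k\<le>K - H. cmod (b (k + s))) = (\<Sum>m\<in>(\<lambda>k. k + s) ` {..K - H}. cmod (b m))"
        by (subst sum.reindex) (auto simp: inj_on_def)
      also have "\<dots> \<le> S" unfolding S_def using \<open>H \<le> K\<close> that by (intro sum_mono2) auto
      finally show ?thesis .
    qed
    have "(\<Sum>k\<le>K - H. cmod (c k)) \<le> (\<Sum>k\<le>K - H. cmod (b k) + (\<Sum>s\<le>H. cmod (b (k + s))) / h)"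
    proof (rule sum_mono)
      fix k
      show "cmod (c k) \<le> cmod (b k) + (\<Sum>s\<le>H. cmod (b (k + s))) / h"
        unfolding c using avg[of k] norm_triangle_ineq4[of "b k" "(\<Sum>s\<le>H. b (k + s) / a ^ s) / of_nat (Suc H)"]
        by linarith
    qed
    also have "\<dots> = (\<Sum>k\<le>K - H. cmod (b (k + 0))) + (\<Sum>s\<le>H. \<Sum>k\<le>K - H. cmod (b (k + s))) / h"
      by (simp add: sum.distrib sum_divide_distrib[symmetric] sum.swap[of _ "{..H}"])
    also have "\<dots> \<le> S + (\<Sum>s\<le>H. S) / h"
      using h by (intro add_mono window divide_right_mono sum_mono) auto
    also have "\<dots> = 2 * S" using h by (simp add: h_def)
    finally have "C * (\<Sum>k\<le>K - H. cmod (c k)) \<le> C * (2 * S)"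
      using C(1) by (rule mult_left_mono)
    with c0 have c0': "cmod (c 0) * real (Suc (K - H)) \<le> 2 * C * S" by simp
    have "(\<Sum>s\<le>H. cmod (b s)) \<le> S" unfolding S_def by (intro sum_mono2) (auto simp: H_def)
    hence "(\<Sum>s\<le>H. cmod (b (0 + s))) / h \<le> S / h" using h by (simp add: divide_right_mono)
    moreover have "b 0 = c 0 + (\<Sum>s\<le>H. b (0 + s) / a ^ s) / of_nat (Suc H)" unfolding c[of 0] by simp
    ultimately have "cmod (b 0) \<le> cmod (c 0) + S / h"
      using avg[of 0] norm_triangle_ineq[of "c 0" "(\<Sum>s\<le>H. b (0 + s) / a ^ s) / of_nat (Suc H)"]
      by simp
    hence "cmod (b 0) * real (Suc K) \<le> (cmod (c 0) + S / h) * real (Suc K)"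
      by (rule mult_right_mono) simp
    also have "\<dots> = cmod (c 0) * real (Suc K) + S / h * real (Suc K)" by (rule distrib_right)
    also have "\<dots> \<le> cmod (c 0) * (2 * real (Suc (K - H))) + S / h * (2 * h)"
    proof (rule add_mono)
      show "cmod (c 0) * real (Suc K) \<le> cmod (c 0) * (2 * real (Suc (K - H)))"
        by (intro mult_left_mono) (auto simp: H_def)
      have "K \<le> Suc (2 * H)" by (simp add: H_def)
      hence "real (Suc K) \<le> real (2 * Suc H)" unfolding of_nat_le_iff by simp
      hence "real (Suc K) \<le> 2 * h" by (simp add: h_def)
      moreover have "0 \<le> S" by (simp add: S_def sum_nonneg)
      ultimately show "S / h * real (Suc K) \<le> S / h * (2 * h)"
        using h by (intro mult_left_mono) auto
    qed
    also have "\<dots> \<le> 4 * C * S + 2 * S"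
    proof -
      have "cmod (c 0) * (2 * real (Suc (K - H))) = 2 * (cmod (c 0) * real (Suc (K - H)))" by (simp only: mult_ac)
      moreover have "S / h * (2 * h) = 2 * S" using h by simp
      moreover have "2 * (cmod (c 0) * real (Suc (K - H))) \<le> 4 * C * S" using c0' by linarith
      ultimately show ?thesis by linarith
    qed
    finally show ?thesis by (simp add: S_def distrib_right)
  qed
  thus ?case using C(1) by (intro exI[of _ "4 * C + 2"]) auto
qed

lemma first_term_square_bound:
  assumes "\<And>a. a \<in> set as \<Longrightarrow> cmod a = 1"
  shows "\<exists>C\<ge>0. \<forall>K b. (\<forall>k. k + length as \<le> K \<longrightarrow> recurrence as b k = 0) \<longrightarrow>
    (cmod (b 0))\<^sup>2 * real (Suc K) \<le> C * (\<Sum>k\<le>K. (cmod (b k))\<^sup>2)"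
proof -
  obtain C where C: "C \<ge> 0" "\<And>K b. (\<And>k. k + length as \<le> K \<Longrightarrow> recurrence as b k = 0) \<Longrightarrow>
      cmod (b 0) * real (Suc K) \<le> C * (\<Sum>k\<le>K. cmod (b k))"
    using first_term_bound[OF assms] by metis
  have "(cmod (b 0))\<^sup>2 * real (Suc K) \<le> C\<^sup>2 * (\<Sum>k\<le>K. (cmod (b k))\<^sup>2)"
    if "\<And>k. k + length as \<le> K \<Longrightarrow> recurrence as b k = 0" for K b
  proof -
    have "(cmod (b 0) * real (Suc K))\<^sup>2 \<le> (C * (\<Sum>k\<le>K. cmod (b k)))\<^sup>2"
      by (intro power_mono C(2) that) simp_all
    also have "\<dots> = C\<^sup>2 * (\<Sum>k\<le>K. 1 * cmod (b k))\<^sup>2" by (simp add: power_mult_distrib)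
    also have "\<dots> \<le> C\<^sup>2 * ((\<Sum>k\<le>K. 1\<^sup>2) * (\<Sum>k\<le>K. (cmod (b k))\<^sup>2))"
      by (intro mult_left_mono Cauchy_Schwarz_ineq_sum) simp
    finally have "((cmod (b 0))\<^sup>2 * real (Suc K)) * real (Suc K)
        \<le> (C\<^sup>2 * (\<Sum>k\<le>K. (cmod (b k))\<^sup>2)) * real (Suc K)"
      by (simp add: power_mult_distrib power2_eq_square mult_ac del: of_nat_Suc)
    thus ?thesis by (rule mult_right_le_imp_le) simp
  qed
  thus ?thesis by (intro exI[of _ "C\<^sup>2"]) auto
qed

section \<open>Pencils of backward shifts and coefficients along lines\<close>

lemma homogeneous_in_span:
  assumes "homogeneous n f"
  shows "f \<in> hardy.span ((\<lambda>\<gamma>. hardy_of_poly (Poly_Mapping.single \<gamma> 1)) ` {\<gamma>. mdeg \<gamma> = n})"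
proof -
  let ?m = "\<lambda>\<gamma>. hardy_of_poly (Poly_Mapping.single \<gamma> (1::complex))"
  have "f = (\<Sum>\<gamma> | mdeg \<gamma> = n. scaleC (hardy_coeff f \<gamma>) (?m \<gamma>))"
  proof (rule hardy_eqI)
    fix \<delta>
    have "hardy_coeff (\<Sum>\<gamma> | mdeg \<gamma> = n. scaleC (hardy_coeff f \<gamma>) (?m \<gamma>)) \<delta>
        = (\<Sum>\<gamma> | mdeg \<gamma> = n. if \<gamma> = \<delta> then hardy_coeff f \<delta> else 0)"
      unfolding hardy_coeff_sum
      by (rule sum.cong) (auto simp: lookup_single when_def)
    also have "\<dots> = hardy_coeff f \<delta>"
      using assms by (auto simp: finite_mdeg_eq homogeneous_def)
    finally show "hardy_coeff f \<delta> = hardy_coeff (\<Sum>\<gamma> | mdeg \<gamma> = n. scaleC (hardy_coeff f \<gamma>) (?m \<gamma>)) \<delta>"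
      by simp
  qed
  also have "\<dots> \<in> hardy.span (?m ` {\<gamma>. mdeg \<gamma> = n})"
    by (intro hardy.span_sum hardy.span_scale hardy.span_base) auto
  finally show ?thesis .
qed

fun pencil_product :: "'d \<Rightarrow> 'd \<Rightarrow> complex list \<Rightarrow> 'd::finite hardy \<Rightarrow> 'd hardy"
  where
    "pencil_product i j [] f = f"
  | "pencil_product i j (a # as) f = pencil_product i j as (backward_shift i f - scaleC a (backward_shift j f))"

lemma lookup_minus_nat:
  "Poly_Mapping.lookup (\<gamma> - \<delta>) k = Poly_Mapping.lookup \<gamma> k - Poly_Mapping.lookup (\<delta> :: 'd \<Rightarrow>\<^sub>0 nat) k"
  by transfer simp

text \<open>
  The points of the line through \<open>\<beta> + K e\<^sub>j\<close> in the direction \<open>e\<^sub>i - e\<^sub>j\<close>.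
\<close>

definition transfer_exponent :: "'d \<Rightarrow> 'd \<Rightarrow> ('d::finite \<Rightarrow>\<^sub>0 nat) \<Rightarrow> nat \<Rightarrow> nat \<Rightarrow> ('d \<Rightarrow>\<^sub>0 nat)"
  where "transfer_exponent i j \<beta> K k = \<beta> + Poly_Mapping.single i k + Poly_Mapping.single j (K - k)"

text \<open>
  Along such a line, the operator \<open>T\<^sub>i - a T\<^sub>j\<close> on power series is the difference operator with root
  \<open>a\<close> on coefficients, at the cost of shortening the line by one.
\<close>

lemma recurrence_pencil_product:
  assumes "k + length as \<le> K"
  shows "recurrence as (\<lambda>k. hardy_coeff f (transfer_exponent i j \<beta> K k)) k
    = hardy_coeff (pencil_product i j as f) (transfer_exponent i j \<beta> (K - length as) k)"
  using assms
proof (induction as arbitrary: f K)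
  case (Cons a as)
  define K' where "K' = K - 1"
  have K: "K = Suc K'" using Cons.prems by (simp add: K'_def)
  let ?f = "backward_shift i f - scaleC a (backward_shift j f)"
  have "recurrence (a # as) (\<lambda>k. hardy_coeff f (transfer_exponent i j \<beta> K k)) k
      = recurrence as (\<lambda>k. hardy_coeff ?f (transfer_exponent i j \<beta> K' k)) k"
    unfolding recurrence.simps
  proof (rule recurrence_cong)
    fix m assume "m \<le> k + length as"
    hence m: "m \<le> K'" using Cons.prems K by simp
    have "transfer_exponent i j \<beta> K (Suc m) = transfer_exponent i j \<beta> K' m + Poly_Mapping.single i (Suc 0)"
      using single_add[of i m "Suc 0"] by (simp add: transfer_exponent_def K add_ac)
    moreover have "transfer_exponent i j \<beta> K m = transfer_exponent i j \<beta> K' m + Poly_Mapping.single j (Suc 0)"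
      using single_add[of j "K' - m" "Suc 0"] m by (simp add: transfer_exponent_def K add_ac Suc_diff_le)
    ultimately show "hardy_coeff f (transfer_exponent i j \<beta> K (Suc m)) - a * hardy_coeff f (transfer_exponent i j \<beta> K m)
        = hardy_coeff ?f (transfer_exponent i j \<beta> K' m)"
      by simp
  qed
  also have "\<dots> = hardy_coeff (pencil_product i j as ?f) (transfer_exponent i j \<beta> (K' - length as) k)"
    using Cons.prems K by (intro Cons.IH) simp
  finally show ?case using K by simp
qed simp

text \<open>
  The terms whose exponent vector lies on the face of the orthant where the exponent of \<open>z\<^sub>i\<close> is zero.
\<close>

definition face_part :: "'d \<Rightarrow> 'd::finite hardy \<Rightarrow> 'd hardy"
  where "face_part i f = f - mult_var i (backward_shift i f)"

lemma hardy_coeff_face_part [simp]: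
  "hardy_coeff (face_part i f) = (\<lambda>\<gamma>. if Poly_Mapping.lookup \<gamma> i = 0 then hardy_coeff f \<gamma> else 0)"
proof
  fix \<gamma>
  have "\<gamma> - Poly_Mapping.single i 1 + Poly_Mapping.single i (Suc 0) = \<gamma>" if "0 < Poly_Mapping.lookup \<gamma> i"
    using that by (intro poly_mapping_eqI) (auto simp: lookup_minus_nat lookup_add lookup_single when_def)
  thus "hardy_coeff (face_part i f) \<gamma> = (if Poly_Mapping.lookup \<gamma> i = 0 then hardy_coeff f \<gamma> else 0)"
    by (simp add: face_part_def hardy_coeff_mult_var)
qed

lemma homogeneous_face_part: "homogeneous n f \<Longrightarrow> homogeneous n (face_part i f)"
  by (auto simp: homogeneous_def)

lemma cinner_face_part: "cinner f g = cinner (backward_shift i f) (backward_shift i g) + cinner (face_part i f) (face_part i g)"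
proof -
  have "backward_shift i (face_part i f) = 0"
    by (rule hardy_eqI) (simp add: lookup_add)
  hence "cinner (face_part i f) (mult_var i (backward_shift i g)) = 0"
    by (simp add: backward_shift_adjoint[symmetric])
  moreover have "cinner f g = cinner (mult_var i (backward_shift i f) + face_part i f) g"
    by (simp add: face_part_def)
  moreover have "cinner (face_part i f) g = cinner (face_part i f) (mult_var i (backward_shift i g) + face_part i g)"
    by (simp add: face_part_def)
  ultimately show ?thesis by (simp add: cinner_add_left cinner_add_right mult_var_adjoint)
qed

lemma norm_face_part: "(norm f)\<^sup>2 = (norm (backward_shift i f))\<^sup>2 + (norm (face_part i f))\<^sup>2"
proof -
  have "complex_of_real ((norm f)\<^sup>2) = complex_of_real ((norm (backward_shift i f))\<^sup>2 + (norm (face_part i f))\<^sup>2)"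
    unfolding of_real_add cinner_self_norm[symmetric] by (rule cinner_face_part)
  thus ?thesis by (simp only: of_real_eq_iff)
qed

lemma norm_face_part_le: "norm (face_part i f) \<le> norm f"
proof (rule power2_le_imp_le)
  show "(norm (face_part i f))\<^sup>2 \<le> (norm f)\<^sup>2" using norm_face_part[of f i] by simp
qed simp

text \<open>
  The lines with direction \<open>e\<^sub>i - e\<^sub>j\<close> that start on the face do not meet: a point determines \<open>k\<close> as
  its exponent of \<open>z\<^sub>i\<close>, and with it the starting point.
\<close>

lemma face_transfer_sum_le:
  fixes f :: "'d::finite hardy"
  assumes "i \<noteq> j" "homogeneous n f"
  shows "(\<Sum>\<gamma> | mdeg \<gamma> = n \<and> Poly_Mapping.lookup \<gamma> i = 0. \<Sum>k\<le>Poly_Mapping.lookup \<gamma> j.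
      (cmod (hardy_coeff f (transfer_exponent i j (\<gamma> - Poly_Mapping.single j (Poly_Mapping.lookup \<gamma> j))
        (Poly_Mapping.lookup \<gamma> j) k)))\<^sup>2) \<le> (norm f)\<^sup>2"
proof -
  let ?A = "{\<gamma> :: 'd \<Rightarrow>\<^sub>0 nat. mdeg \<gamma> = n \<and> Poly_Mapping.lookup \<gamma> i = 0}"
  let ?mv = "\<lambda>\<gamma> k. transfer_exponent i j (\<gamma> - Poly_Mapping.single j (Poly_Mapping.lookup \<gamma> j))
        (Poly_Mapping.lookup \<gamma> j) k"
  let ?P = "SIGMA \<gamma>:?A. {..Poly_Mapping.lookup \<gamma> j}"
  have lk: "Poly_Mapping.lookup (?mv \<gamma> k) x = (if x = i then Poly_Mapping.lookup \<gamma> i + k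
      else if x = j then Poly_Mapping.lookup \<gamma> j - k else Poly_Mapping.lookup \<gamma> x)" for \<gamma> k x
    using assms(1) by (auto simp: transfer_exponent_def lookup_add lookup_minus_nat lookup_single when_def)
  have inj: "inj_on (\<lambda>(\<gamma>, k). ?mv \<gamma> k) ?P"
  proof (rule inj_onI, clarsimp)
    fix \<gamma> k \<gamma>' k'
    assume 0: "Poly_Mapping.lookup \<gamma> i = 0" "Poly_Mapping.lookup \<gamma>' i = 0"
      and k: "k \<le> Poly_Mapping.lookup \<gamma> j" "k' \<le> Poly_Mapping.lookup \<gamma>' j"
      and eq: "?mv \<gamma> k = ?mv \<gamma>' k'"
    have *: "Poly_Mapping.lookup (?mv \<gamma> k) x = Poly_Mapping.lookup (?mv \<gamma>' k') x" for x
      by (simp only: eq)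
    have kk: "k = k'" using *[of i] unfolding lk using 0 by simp
    have "Poly_Mapping.lookup \<gamma> x = Poly_Mapping.lookup \<gamma>' x" for x
      using *[of x] k 0 kk unfolding lk by (auto split: if_splits)
    thus "\<gamma> = \<gamma>' \<and> k = k'" using kk by (simp add: poly_mapping_eqI)
  qed
  have deg: "mdeg (?mv \<gamma> k) = mdeg \<gamma>" if "k \<le> Poly_Mapping.lookup \<gamma> j" for \<gamma> k
  proof -
    have "\<gamma> - Poly_Mapping.single j (Poly_Mapping.lookup \<gamma> j) + Poly_Mapping.single j (Poly_Mapping.lookup \<gamma> j) = \<gamma>"
      by (rule poly_mapping_eqI) (auto simp: lookup_minus_nat lookup_add lookup_single when_def)
    hence "mdeg (\<gamma> - Poly_Mapping.single j (Poly_Mapping.lookup \<gamma> j)) + Poly_Mapping.lookup \<gamma> j = mdeg \<gamma>"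
      by (metis mdeg_add mdeg_single)
    thus ?thesis using that by (simp add: transfer_exponent_def)
  qed
  have finA: "finite ?A" by (rule finite_subset[OF _ finite_mdeg_eq[of n]]) auto
  have "(\<Sum>\<gamma>\<in>?A. \<Sum>k\<le>Poly_Mapping.lookup \<gamma> j. (cmod (hardy_coeff f (?mv \<gamma> k)))\<^sup>2)
      = (\<Sum>p\<in>?P. (cmod (hardy_coeff f ((\<lambda>(\<gamma>, k). ?mv \<gamma> k) p)))\<^sup>2)"
    by (subst sum.Sigma) (auto simp: finA case_prod_beta)
  also have "\<dots> = (\<Sum>\<delta>\<in>(\<lambda>(\<gamma>, k). ?mv \<gamma> k) ` ?P. (cmod (hardy_coeff f \<delta>))\<^sup>2)"
    by (subst sum.reindex[OF inj]) simp
  also have "\<dots> \<le> (\<Sum>\<delta> | mdeg \<delta> = n. (cmod (hardy_coeff f \<delta>))\<^sup>2)"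
    using deg by (intro sum_mono2) (auto simp: finite_mdeg_eq)
  also have "\<dots> = (norm f)\<^sup>2" by (simp only: norm_homogeneous[OF assms(2)])
  finally show ?thesis .
qed

section \<open>Graded co-invariant subspaces\<close>

text \<open>
  What the analysis needs of the quotient module. The parameter \<open>c\<close> in \<open>pencil_injective\<close> may
  be zero, which makes the backward shifts themselves injective in high degrees.
\<close>

locale graded_coinvariant =
  fixes M :: "'d::finite hardy set"
  assumes subspace: "hardy.subspace M"
    and component_in: "f \<in> M \<Longrightarrow> component n f \<in> M"
    and in_if_components: "(\<And>n. component n f \<in> M) \<Longrightarrow> f \<in> M"
    and backward_shift_in: "f \<in> M \<Longrightarrow> backward_shift i f \<in> M"
    and pencil_injective: "i \<noteq> j \<Longrightarrow> cmod c \<noteq> 1 \<Longrightarrow>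
      \<exists>N. \<forall>n\<ge>N. \<forall>f\<in>M. homogeneous n f \<longrightarrow> backward_shift i f = scaleC c (backward_shift j f) \<longrightarrow> f = 0"
    and two_variables: "\<exists>j. j \<noteq> (i :: 'd)"
begin

definition part :: "nat \<Rightarrow> 'd hardy set"
  where "part n = {f \<in> M. homogeneous n f}"

lemma subspace_part: "hardy.subspace (part n)"
  using hardy.subspace_0[OF subspace] hardy.subspace_add[OF subspace] hardy.subspace_scale[OF subspace]
  by (intro hardy.subspaceI) (auto simp: part_def homogeneous_add homogeneous_scaleC)

lemma part_finite_dim: "\<exists>B. finite B \<and> part n \<subseteq> hardy.span B"
  using homogeneous_in_span finite_mdeg_eq[of n]
  by (intro exI[of _ "(\<lambda>\<gamma>. hardy_of_poly (Poly_Mapping.single \<gamma> 1)) ` {\<gamma>. mdeg \<gamma> = n}"])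
     (auto simp: part_def)

lemma backward_shift_part: "f \<in> part (Suc n) \<Longrightarrow> backward_shift i f \<in> part n"
  by (auto simp: part_def backward_shift_in homogeneous_backward_shift)

lemma backward_shift_eventually_injective:
  "\<exists>N. \<forall>n\<ge>N. \<forall>f\<in>part n. backward_shift i f = 0 \<longrightarrow> f = 0"
proof -
  obtain j where "j \<noteq> i" using two_variables by blast
  thus ?thesis using pencil_injective[of i j 0] by (auto simp: part_def)
qed

text \<open>
  An injective map between spaces of finite dimension does not decrease the dimension, so the
  dimensions of the parts are eventually nonincreasing, hence constant, and the shifts become onto.
\<close>

lemma backward_shift_eventually_bijective:
  "\<exists>m. \<forall>n\<ge>m. hardy.dim (part n) = hardy.dim (part m) \<and>
    (\<forall>i. backward_shift i ` part (Suc n) = part n \<and>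
      (\<forall>f\<in>part n. backward_shift i f = 0 \<longrightarrow> f = 0))"
proof -
  have "\<exists>N. \<forall>i. \<forall>n\<ge>N i. \<forall>f\<in>part n. backward_shift i f = 0 \<longrightarrow> f = 0"
    using backward_shift_eventually_injective by (intro choice allI)
  then obtain N where N: "\<And>i n f. N i \<le> n \<Longrightarrow> f \<in> part n \<Longrightarrow> backward_shift i f = 0 \<Longrightarrow> f = 0"
    by blast
  define L where "L = Max (range N)"
  have L: "N i \<le> L" for i unfolding L_def by (rule Max_ge) auto
  have inj: "f = 0" if "L \<le> n" "f \<in> part n" "backward_shift i f = 0" for i n f
    using N[of i n f] L[of i] that by simp
  have dims: "hardy.dim (part (Suc n)) \<le> hardy.dim (part n)"
    "hardy.dim (part (Suc n)) = hardy.dim (part n) \<Longrightarrow> backward_shift i ` part (Suc n) = part n"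
    if n: "L \<le> n" for n i
  proof -
    obtain B B' where B: "finite B" "part (Suc n) \<subseteq> hardy.span B" "finite B'" "part n \<subseteq> hardy.span B'"
      using part_finite_dim by metis
    have im: "backward_shift i ` part (Suc n) \<subseteq> part n" using backward_shift_part by blast
    have "f = 0" if "f \<in> part (Suc n)" "backward_shift i f = 0" for f
      using inj[of "Suc n" f i] n that by simp
    note * = injective_linear_dim[OF B subspace_part subspace_part linear_backward_shift im this]
    show "hardy.dim (part (Suc n)) \<le> hardy.dim (part n)"
      "hardy.dim (part (Suc n)) = hardy.dim (part n) \<Longrightarrow> backward_shift i ` part (Suc n) = part n"
      by (rule *; assumption)+
  qed
  obtain m where m: "L \<le> m" "\<And>n. m \<le> n \<Longrightarrow> hardy.dim (part n) = hardy.dim (part m)"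
    using nonincreasing_nat_eventually_constant[of L "\<lambda>n. hardy.dim (part n)"] dims(1) by blast
  have "backward_shift i ` part (Suc n) = part n" if "m \<le> n" for i n
    using dims(2)[of n i] m(1) m(2)[of n] m(2)[of "Suc n"] that by simp
  thus ?thesis using m inj by (intro exI[of _ m]) (meson order_trans)
qed

lemma pencil_product_in_part: "f \<in> part (length as + n) \<Longrightarrow> pencil_product i j as f \<in> part n"
proof (induction as arbitrary: f)
  case (Cons a as)
  have "backward_shift i f - scaleC a (backward_shift j f) \<in> part (length as + n)"
    using Cons.prems backward_shift_part hardy.subspace_diff[OF subspace_part] hardy.subspace_scale[OF subspace_part]
    by simp
  thus ?case using Cons.IH by simp
qed simp

lemma funpow_backward_shift_part: "f \<in> part (s + n) \<Longrightarrow> (backward_shift j ^^ s) f \<in> part n"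
  by (induction s arbitrary: f) (auto simp: funpow_Suc_right backward_shift_part simp del: funpow.simps)

lemma funpow_backward_shift_pencil:
  "(backward_shift j ^^ s) (backward_shift i f - scaleC a (backward_shift j f))
    = backward_shift i ((backward_shift j ^^ s) f) - scaleC a (backward_shift j ((backward_shift j ^^ s) f))"
  by (induction s) (auto simp: backward_shift_diff backward_shift_scaleC backward_shift_commute[of j i])

lemma funpow_backward_shift_pencil_product:
  "(backward_shift j ^^ s) (pencil_product i j as f) = pencil_product i j as ((backward_shift j ^^ s) f)"
  by (induction as arbitrary: f) (auto simp: funpow_backward_shift_pencil)

text \<open>
  Choose \<open>m\<close> such that the shifts are bijective from degree \<open>m\<close> on, and let \<open>W = T\<^sub>i T\<^sub>j\<^sup>-\<^sup>1\<close> on the part of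
  degree \<open>m\<close>. An eigenvector of \<open>W\<close> with eigenvalue \<open>a\<close> can be lifted along \<open>T\<^sub>j\<close> to every higher degree,
  where it is in the kernel of \<open>T\<^sub>i - a T\<^sub>j\<close>, so \<open>|a| = 1\<close>. A product of factors \<open>W - a\<close> vanishes;
  since \<open>T\<^sub>i - a T\<^sub>j = (W - a) T\<^sub>j\<close> and \<open>T\<^sub>j\<close> commutes with \<open>T\<^sub>i\<close> and is injective, the corresponding
  product of pencils vanishes in all higher degrees.
\<close>

lemma pencil_product_eventually_0:
  assumes ij: "i \<noteq> j"
  shows "\<exists>as m. (\<forall>a\<in>set as. cmod a = 1) \<and> (\<forall>n\<ge>m. \<forall>f\<in>part n. pencil_product i j as f = 0)"
proof -
  let ?T = "backward_shift i" and ?S = "backward_shift j"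
  obtain m where m: "\<And>n. m \<le> n \<Longrightarrow> ?S ` part (Suc n) = part n"
    "\<And>n f. m \<le> n \<Longrightarrow> f \<in> part n \<Longrightarrow> ?S f = 0 \<Longrightarrow> f = 0"
    using backward_shift_eventually_bijective by blast
  have inj_pow: "f = 0" if "m \<le> n" "f \<in> part (s + n)" "(?S ^^ s) f = 0" for n s f
    using that
  proof (induction s arbitrary: f)
    case (Suc s)
    have "(?S ^^ s) (?S f) = 0" using Suc.prems(3) by (simp add: funpow_swap1)
    hence "?S f = 0" using Suc.IH[of "?S f"] Suc.prems backward_shift_part by simp
    thus ?case using m(2)[of "Suc s + n" f] Suc.prems by simp
  qed simp
  have surj_pow: "\<exists>x\<in>part (s + n). (?S ^^ s) x = v" if n: "m \<le> n" and v: "v \<in> part n" for n s v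
  proof (induction s)
    case 0
    thus ?case using v by simp
  next
    case (Suc s)
    then obtain x where x: "x \<in> part (s + n)" "(?S ^^ s) x = v" by blast
    then obtain y where "y \<in> part (Suc (s + n))" "?S y = x" using m(1)[of "s + n"] n by force
    thus ?case using x by (intro bexI[of _ y]) (simp_all add: funpow_swap1)
  qed
  have inj_S: "x = y" if "x \<in> part (Suc m)" "y \<in> part (Suc m)" "?S x = ?S y" for x y
    using m(2)[of "Suc m" "x - y"] that hardy.subspace_diff[OF subspace_part] by (simp add: backward_shift_diff)
  \<comment> \<open>The inverse of \<open>?S\<close> that defines \<open>W\<close>.\<close>
  define R where "R = inv_into (part (Suc m)) ?S"
  have R: "R v \<in> part (Suc m)" "?S (R v) = v" if "v \<in> part m" for v
    using that m(1)[of m] inv_into_into[of v ?S "part (Suc m)"] f_inv_into_f[of v ?S "part (Suc m)"]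
    unfolding R_def by auto
  define W where "W = (\<lambda>v. ?T (R v))"
  have W_S: "W (?S x) = ?T x" if "x \<in> part (Suc m)" for x
    unfolding W_def using inj_S[of "R (?S x)" x] R[of "?S x"] that backward_shift_part by auto
  have lin: "linear_on (part m) W"
    unfolding linear_on_def
  proof (intro conjI ballI allI)
    fix v assume v: "v \<in> part m"
    show "W v \<in> part m" unfolding W_def using R(1)[OF v] by (rule backward_shift_part)
    show "W (scaleC c v) = scaleC c (W v)" for c
      using W_S[of "scaleC c (R v)"] R[OF v] hardy.subspace_scale[OF subspace_part]
      by (simp add: backward_shift_scaleC W_def)
    show "W (v + w) = W v + W w" if w: "w \<in> part m" for w
      using W_S[of "R v + R w"] R[OF v] R[OF w] hardy.subspace_add[OF subspace_part]
      by (simp add: backward_shift_add W_def)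
  qed
  obtain B where B: "finite B" "hardy.span B = part m"
  proof -
    obtain B0 where "finite B0" "part m \<subseteq> hardy.span B0" using part_finite_dim by blast
    then obtain C where C: "finite C" "C \<subseteq> part m" "part m \<subseteq> hardy.span C" using finite_dim_basis by metis
    moreover have "hardy.span C \<subseteq> part m" by (rule hardy.span_minimal[OF C(2) subspace_part])
    ultimately show ?thesis using that by blast
  qed
  have eig: "a \<in> {a. cmod a = 1}" if v: "v \<in> hardy.span B" "v \<noteq> 0" "W v = scaleC a v" for a v
  proof (rule ccontr)
    assume "a \<notin> {a. cmod a = 1}"
    then obtain N where N: "\<And>n f. N \<le> n \<Longrightarrow> f \<in> part n \<Longrightarrow> ?T f = scaleC a (?S f) \<Longrightarrow> f = 0"
      using pencil_injective[OF ij, of a] unfolding part_def by blast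
    obtain x where x: "x \<in> part (Suc N + m)" "(?S ^^ Suc N) x = v"
      using surj_pow[of m v "Suc N"] v(1) B(2) by auto
    define y where "y = ?T x - scaleC a (?S x)"
    have "y \<in> part (N + m)"
      unfolding y_def using x(1) backward_shift_part hardy.subspace_diff[OF subspace_part] hardy.subspace_scale[OF subspace_part] by simp
    moreover have "(?S ^^ N) y = 0"
    proof -
      have xN: "(?S ^^ N) x \<in> part (Suc m)" using x(1) funpow_backward_shift_part[of x N "Suc m"] by simp
      have "?S ((?S ^^ N) x) = v" using x(2) by simp
      thus ?thesis unfolding y_def funpow_backward_shift_pencil
        using W_S[OF xN] v(3) by simp
    qed
    ultimately have "y = 0" using inj_pow[of m y N] by simp
    hence "x = 0" using N[of "Suc N + m" x] x(1) by (simp add: y_def)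
    moreover have "(?S ^^ s) 0 = 0" for s by (induction s) auto
    ultimately show False using x(2) v(2) by metis
  qed
  have lin_B: "linear_on (hardy.span B) W" using lin B(2) by simp
  have "\<exists>as. set as \<subseteq> {a. cmod a = 1} \<and> (\<forall>f\<in>hardy.span B. shift_product W as f = 0)"
    by (rule shift_product_eq_0[OF B(1) lin_B]) (rule eig)
  then obtain as where as: "set as \<subseteq> {a. cmod a = 1}" "\<And>f. f \<in> part m \<Longrightarrow> shift_product W as f = 0"
    using B(2) by blast
  have push: "pencil_product i j ls x = shift_product W ls ((?S ^^ length ls) x)" if "x \<in> part (length ls + m)" for ls x
    using that
  proof (induction ls arbitrary: x)
    case (Cons a ls)
    define y where "y = ?T x - scaleC a (?S x)"
    have y: "y \<in> part (length ls + m)"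
      unfolding y_def using Cons.prems backward_shift_part hardy.subspace_diff[OF subspace_part] hardy.subspace_scale[OF subspace_part] by simp
    have "(?S ^^ length ls) x \<in> part (Suc m)" using Cons.prems funpow_backward_shift_part[of x "length ls" "Suc m"] by simp
    hence "(?S ^^ length ls) y = W ((?S ^^ length (a # ls)) x) - scaleC a ((?S ^^ length (a # ls)) x)"
      unfolding y_def funpow_backward_shift_pencil by (simp add: W_S)
    thus ?case using Cons.IH[OF y] by (simp add: y_def)
  qed simp
  have "pencil_product i j as f = 0" if n: "length as + m \<le> n" and f: "f \<in> part n" for n f
  proof -
    define s where "s = n - (length as + m)"
    have s: "n = s + (length as + m)" using n by (simp add: s_def)
    have "(?S ^^ s) f \<in> part (length as + m)" using f unfolding s by (rule funpow_backward_shift_part)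
    hence "pencil_product i j as ((?S ^^ s) f) = 0"
      using push as(2) funpow_backward_shift_part by metis
    hence "(?S ^^ s) (pencil_product i j as f) = 0" by (simp add: funpow_backward_shift_pencil_product)
    moreover have "f \<in> part (length as + (s + m))" using f unfolding s by (simp add: add_ac)
    hence "pencil_product i j as f \<in> part (s + m)" by (rule pencil_product_in_part)
    ultimately show ?thesis using inj_pow[of m _ s] by simp
  qed
  thus ?thesis using as(1) by blast
qed

end

section \<open>Decay on the faces\<close>

lemma cinner_component_left:
  assumes "homogeneous k h"
  shows "cinner (component n f) h = (if n = k then cinner f h else 0)"
proof (cases "n = k")
  case True
  have "cinner f h = cnj (cinner h f)" by (rule cinner_commute)
  also have "\<dots> = cnj (cinner h (component n f))"
    unfolding cinner_homogeneous[OF assms] using True by simp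
  also have "\<dots> = cinner (component n f) h" by (rule cinner_commute[symmetric])
  finally show ?thesis using True by simp
next
  case False
  have "cinner (component n f) h = cnj (cinner h (component n f))" by (rule cinner_commute)
  also have "\<dots> = 0" unfolding cinner_homogeneous[OF assms] using False by simp
  finally show ?thesis using False by simp
qed

lemma cinner_component_component: "cinner (component n f) (component n h) = cinner (component n f) h"
  unfolding cinner_homogeneous[OF homogeneous_component] by (rule sum.cong) auto

text \<open>
  If no exponent other than the \<open>i\<close>-th reached \<open>n/d\<close>, the \<open>d - 1\<close> of them could not add up to \<open>n\<close>.
\<close>

lemma exists_large_other_exponent:
  fixes \<gamma> :: "'d::finite \<Rightarrow>\<^sub>0 nat"
  assumes "mdeg \<gamma> = n" "Poly_Mapping.lookup \<gamma> i = 0" "j \<noteq> i"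
  shows "\<exists>j. j \<noteq> i \<and> n \<le> CARD('d) * Poly_Mapping.lookup \<gamma> j"
proof (rule ccontr)
  assume "\<not> ?thesis"
  hence less: "CARD('d) * Poly_Mapping.lookup \<gamma> j < n" if "j \<noteq> i" for j using that by force
  have "n = (\<Sum>j\<in>UNIV. Poly_Mapping.lookup \<gamma> j)" using assms(1) by (simp add: mdeg_def)
  also have "\<dots> = (\<Sum>j\<in>UNIV - {i}. Poly_Mapping.lookup \<gamma> j)"
    using assms(2) by (subst sum.remove[of UNIV i]) auto
  finally have "CARD('d) * n = (\<Sum>j\<in>UNIV - {i}. CARD('d) * Poly_Mapping.lookup \<gamma> j)"
    by (simp add: sum_distrib_left)
  also have "\<dots> < (\<Sum>j\<in>UNIV - {i}. n)"
    using less assms(3) by (intro sum_strict_mono) auto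
  also have "\<dots> \<le> CARD('d) * n" by (auto simp: card_Diff_singleton)
  finally show False by simp
qed

context graded_coinvariant
begin

lemma transfer_bound:
  assumes "i \<noteq> j"
  shows "\<exists>m C. 0 \<le> C \<and> (\<forall>n\<ge>m. \<forall>f\<in>part n. \<forall>\<gamma>.
    (cmod (hardy_coeff f \<gamma>))\<^sup>2 * real (Suc (Poly_Mapping.lookup \<gamma> j)) \<le>
      C * (\<Sum>k\<le>Poly_Mapping.lookup \<gamma> j. (cmod (hardy_coeff f (transfer_exponent i j
        (\<gamma> - Poly_Mapping.single j (Poly_Mapping.lookup \<gamma> j)) (Poly_Mapping.lookup \<gamma> j) k)))\<^sup>2))"
proof -
  obtain as m where as: "\<And>a. a \<in> set as \<Longrightarrow> cmod a = 1"
    and zero: "\<And>n f. m \<le> n \<Longrightarrow> f \<in> part n \<Longrightarrow> pencil_product i j as f = 0"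
    using pencil_product_eventually_0[OF assms] by blast
  obtain C where C: "0 \<le> C" "\<And>K b. (\<And>k. k + length as \<le> K \<Longrightarrow> recurrence as b k = 0) \<Longrightarrow>
      (cmod (b 0))\<^sup>2 * real (Suc K) \<le> C * (\<Sum>k\<le>K. (cmod (b k))\<^sup>2)"
    using first_term_square_bound[OF as] by metis
  have "(cmod (hardy_coeff f \<gamma>))\<^sup>2 * real (Suc (Poly_Mapping.lookup \<gamma> j)) \<le>
      C * (\<Sum>k\<le>Poly_Mapping.lookup \<gamma> j. (cmod (hardy_coeff f (transfer_exponent i j
        (\<gamma> - Poly_Mapping.single j (Poly_Mapping.lookup \<gamma> j)) (Poly_Mapping.lookup \<gamma> j) k)))\<^sup>2)"
    if "m \<le> n" "f \<in> part n" for n f \<gamma>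
  proof -
    define K where "K = Poly_Mapping.lookup \<gamma> j"
    define b where "b = (\<lambda>k. hardy_coeff f (transfer_exponent i j (\<gamma> - Poly_Mapping.single j K) K k))"
    have "transfer_exponent i j (\<gamma> - Poly_Mapping.single j K) K 0 = \<gamma>"
      by (rule poly_mapping_eqI)
         (auto simp: transfer_exponent_def K_def lookup_minus_nat lookup_add lookup_single when_def)
    hence "b 0 = hardy_coeff f \<gamma>" by (simp add: b_def)
    moreover have "recurrence as b k = 0" if "k + length as \<le> K" for k
      unfolding b_def recurrence_pencil_product[OF that] using zero \<open>m \<le> n\<close> \<open>f \<in> part n\<close> by simp
    ultimately show ?thesis using C(2)[of K b] by (simp only: b_def K_def)
  qed
  thus ?thesis using C(1) by blast
qed

text \<open>
  For \<open>\<gamma>\<close> on the face, \<open>transfer_bound\<close> along a direction \<open>e\<^sub>i - e\<^sub>j\<close> with \<open>\<gamma>\<^sub>j \<ge> n/d\<close> bounds the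
  squared coefficient at \<open>\<gamma>\<close> by \<open>C/n\<close> times the sum of squares over a line; for each \<open>j\<close> these sums add up to
  at most the squared norm. In the finitely many low degrees the constant \<open>L + 1\<close> suffices.
\<close>

lemma face_part_bound:
  "\<exists>C\<ge>0. \<forall>n. \<forall>f\<in>part n. (norm (face_part i f))\<^sup>2 * real (Suc n) \<le> C * (norm f)\<^sup>2"
proof -
  let ?mv = "\<lambda>j \<gamma> k. transfer_exponent i j (\<gamma> - Poly_Mapping.single j (Poly_Mapping.lookup \<gamma> j))
        (Poly_Mapping.lookup \<gamma> j) k"
  let ?S = "\<lambda>f j \<gamma>. \<Sum>k\<le>Poly_Mapping.lookup \<gamma> j. (cmod (hardy_coeff f (?mv j \<gamma> k)))\<^sup>2"
  have "\<forall>j. \<exists>m C. j \<noteq> i \<longrightarrow> 0 \<le> C \<and> (\<forall>n\<ge>m. \<forall>f\<in>part n. \<forall>\<gamma>.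
      (cmod (hardy_coeff f \<gamma>))\<^sup>2 * real (Suc (Poly_Mapping.lookup \<gamma> j)) \<le> C * ?S f j \<gamma>)"
    using transfer_bound[of i] by metis
  then obtain m C where "\<forall>j. j \<noteq> i \<longrightarrow> 0 \<le> C j \<and> (\<forall>n\<ge>m j. \<forall>f\<in>part n. \<forall>\<gamma>.
      (cmod (hardy_coeff f \<gamma>))\<^sup>2 * real (Suc (Poly_Mapping.lookup \<gamma> j)) \<le> C j * ?S f j \<gamma>)"
    by metis
  hence C: "0 \<le> C j" and S: "m j \<le> n \<Longrightarrow> f \<in> part n \<Longrightarrow>
      (cmod (hardy_coeff f \<gamma>))\<^sup>2 * real (Suc (Poly_Mapping.lookup \<gamma> j)) \<le> C j * ?S f j \<gamma>"
    if "j \<noteq> i" for j n f \<gamma>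
    using that by blast+
  define L where "L = Max (range m)"
  have L: "m j \<le> L" for j unfolding L_def by (rule Max_ge) auto
  define D where "D = real CARD('d)"
  have D: "0 \<le> D" by (simp add: D_def)
  define E where "E = (\<Sum>j\<in>UNIV - {i}. D * C j)"
  have E: "0 \<le> E" unfolding E_def using C D by (intro sum_nonneg) auto
  have large: "(norm (face_part i f))\<^sup>2 * real (Suc n) \<le> E * (norm f)\<^sup>2" if n: "L \<le> n" and f: "f \<in> part n" for n f
  proof -
    let ?A = "{\<gamma> :: 'd \<Rightarrow>\<^sub>0 nat. mdeg \<gamma> = n \<and> Poly_Mapping.lookup \<gamma> i = 0}"
    have hom: "homogeneous n f" using f by (simp add: part_def)
    have S0: "0 \<le> ?S f j \<gamma>" for j \<gamma> by (intro sum_nonneg) auto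
    have pt: "(cmod (hardy_coeff f \<gamma>))\<^sup>2 * real (Suc n) \<le> (\<Sum>j\<in>UNIV - {i}. D * C j * ?S f j \<gamma>)"
      if \<gamma>: "\<gamma> \<in> ?A" for \<gamma>
    proof -
      obtain j0 where "j0 \<noteq> i" using two_variables by blast
      then obtain j where j: "j \<noteq> i" "n \<le> CARD('d) * Poly_Mapping.lookup \<gamma> j"
        using exists_large_other_exponent[of \<gamma> n i] \<gamma> by blast
      have "Suc n \<le> CARD('d) * Suc (Poly_Mapping.lookup \<gamma> j)"
      proof -
        have "0 < CARD('d)" by simp
        thus ?thesis using j(2) unfolding mult_Suc_right by linarith
      qed
      hence "real (Suc n) \<le> real (CARD('d) * Suc (Poly_Mapping.lookup \<gamma> j))" by (simp only: of_nat_le_iff)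
      hence "(cmod (hardy_coeff f \<gamma>))\<^sup>2 * real (Suc n) \<le> (cmod (hardy_coeff f \<gamma>))\<^sup>2 * (D * real (Suc (Poly_Mapping.lookup \<gamma> j)))"
        unfolding D_def of_nat_mult by (intro mult_left_mono) auto
      also have "\<dots> = D * ((cmod (hardy_coeff f \<gamma>))\<^sup>2 * real (Suc (Poly_Mapping.lookup \<gamma> j)))" by (simp only: mult_ac)
      also have "\<dots> \<le> D * (C j * ?S f j \<gamma>)"
        using D L[of j] n by (intro mult_left_mono S[OF j(1) _ f]) auto
      also have "\<dots> = D * C j * ?S f j \<gamma>" by (simp only: mult.assoc)
      also have "\<dots> \<le> (\<Sum>j\<in>UNIV - {i}. D * C j * ?S f j \<gamma>)"
        using j(1) by (intro member_le_sum[of j "UNIV - {i}" "\<lambda>j. D * C j * ?S f j \<gamma>"] mult_nonneg_nonneg D C S0) auto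
      finally show ?thesis .
    qed
    have "(norm (face_part i f))\<^sup>2 = (\<Sum>\<gamma>\<in>?A. (cmod (hardy_coeff f \<gamma>))\<^sup>2)"
      unfolding norm_homogeneous[OF homogeneous_face_part[OF hom]]
      by (rule sum.mono_neutral_cong_right) (auto simp: finite_mdeg_eq)
    hence "(norm (face_part i f))\<^sup>2 * real (Suc n) = (\<Sum>\<gamma>\<in>?A. (cmod (hardy_coeff f \<gamma>))\<^sup>2 * real (Suc n))"
      by (simp only: sum_distrib_right)
    also have "\<dots> \<le> (\<Sum>\<gamma>\<in>?A. \<Sum>j\<in>UNIV - {i}. D * C j * ?S f j \<gamma>)" by (rule sum_mono) (rule pt)
    also have "\<dots> = (\<Sum>j\<in>UNIV - {i}. D * C j * (\<Sum>\<gamma>\<in>?A. ?S f j \<gamma>))"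
      by (subst sum.swap) (simp only: sum_distrib_left)
    also have "\<dots> \<le> (\<Sum>j\<in>UNIV - {i}. D * C j * (norm f)\<^sup>2)"
    proof (rule sum_mono)
      fix j assume "j \<in> UNIV - {i}"
      hence ij: "i \<noteq> j" by auto
      show "D * C j * (\<Sum>\<gamma>\<in>?A. ?S f j \<gamma>) \<le> D * C j * (norm f)\<^sup>2"
        using face_transfer_sum_le[OF ij hom] D C[of j] ij by (intro mult_left_mono) auto
    qed
    also have "\<dots> = E * (norm f)\<^sup>2" by (simp only: E_def sum_distrib_right)
    finally show ?thesis .
  qed
  have "(norm (face_part i f))\<^sup>2 * real (Suc n) \<le> (E + real (Suc L)) * (norm f)\<^sup>2" if f: "f \<in> part n" for n f
  proof (cases "L \<le> n")
    case True
    thus ?thesis using large[OF True f] by (simp add: distrib_right add_increasing2)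
  next
    case False
    have "(norm (face_part i f))\<^sup>2 * real (Suc n) \<le> (norm f)\<^sup>2 * real (Suc L)"
      using False norm_face_part_le[of i f] by (intro mult_mono power_mono) auto
    thus ?thesis using E by (simp add: distrib_right add_increasing mult.commute)
  qed
  thus ?thesis using E by (intro exI[of _ "E + real (Suc L)"]) auto
qed

text \<open>
  In high degrees \<open>f = T\<^sub>i g\<close>, and the difference of \<open>g\<close> and \<open>z\<^sub>i f\<close> is the face part of \<open>g\<close>. The bound of
  \<open>face_part_bound\<close> is in terms of \<open>g\<close>, whose norm exceeds that of \<open>f\<close> by the face part itself; this
  excess is absorbed once \<open>n \<ge> 2 C\<close>. In low degrees take \<open>g = 0\<close>.
\<close>

lemma lift_bound:
  "\<exists>C\<ge>0. \<forall>n. \<forall>f\<in>part n. \<exists>g\<in>M. (norm (mult_var i f - g))\<^sup>2 * real (Suc n) \<le> C * (norm f)\<^sup>2"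
proof -
  obtain C where "0 \<le> C \<and> (\<forall>n. \<forall>f\<in>part n. (norm (face_part i f))\<^sup>2 * real (Suc n) \<le> C * (norm f)\<^sup>2)"
    using face_part_bound[of i] ..
  hence C: "0 \<le> C" "\<And>n f. f \<in> part n \<Longrightarrow> (norm (face_part i f))\<^sup>2 * real (Suc n) \<le> C * (norm f)\<^sup>2"
    by auto
  obtain m where "\<forall>n\<ge>m. hardy.dim (part n) = hardy.dim (part m) \<and>
    (\<forall>i. backward_shift i ` part (Suc n) = part n \<and> (\<forall>f\<in>part n. backward_shift i f = 0 \<longrightarrow> f = 0))"
    using backward_shift_eventually_bijective ..
  hence m: "backward_shift i ` part (Suc n) = part n" if "m \<le> n" for n using that by blast
  obtain p :: nat where p: "2 * C \<le> real p" using real_arch_simple by blast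
  define L where "L = max m p"
  define B where "B = 2 * C + real (Suc L)"
  have "\<exists>g\<in>M. (norm (mult_var i f - g))\<^sup>2 * real (Suc n) \<le> B * (norm f)\<^sup>2" if f: "f \<in> part n" for n f
  proof (cases "L \<le> n")
    case True
    then obtain g where g: "g \<in> part (Suc n)" "backward_shift i g = f"
      using m[of n] f unfolding L_def by force
    let ?q = "(norm (face_part i g))\<^sup>2"
    have "norm (mult_var i f - g) = norm (face_part i g)"
      unfolding face_part_def g(2) by (rule norm_minus_commute)
    moreover have "?q * real (Suc n) \<le> B * (norm f)\<^sup>2"
    proof -
      have "?q * real (Suc (Suc n)) \<le> C * ((norm f)\<^sup>2 + ?q)"
        using C(2)[OF g(1)] norm_face_part[of g i] g(2) by simp
      hence "?q * (real n + 2) \<le> C * (norm f)\<^sup>2 + C * ?q" by (simp add: algebra_simps)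
      moreover have "2 * C * ?q \<le> real n * ?q"
        using p True by (intro mult_right_mono) (auto simp: L_def)
      ultimately have "?q * (real n + 1) \<le> 2 * (C * (norm f)\<^sup>2)"
      proof -
        have "?q * (real n + 2) = real n * ?q + 2 * ?q" "?q * (real n + 1) = real n * ?q + ?q"
          "2 * C * ?q = 2 * (C * ?q)" "0 \<le> ?q"
          by (simp_all add: algebra_simps)
        with \<open>?q * (real n + 2) \<le> C * (norm f)\<^sup>2 + C * ?q\<close> \<open>2 * C * ?q \<le> real n * ?q\<close> show ?thesis
          by linarith
      qed
      moreover have "0 \<le> real (Suc L) * (norm f)\<^sup>2" by simp
      moreover have "B * (norm f)\<^sup>2 = 2 * (C * (norm f)\<^sup>2) + real (Suc L) * (norm f)\<^sup>2"
        by (simp only: B_def distrib_right mult.assoc)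
      moreover have "?q * real (Suc n) = ?q * (real n + 1)" by simp
      ultimately show ?thesis by linarith
    qed
    moreover have "g \<in> M" using g(1) by (simp add: part_def)
    ultimately show ?thesis by metis
  next
    case False
    have "(norm (mult_var i f - 0))\<^sup>2 * real (Suc n) \<le> (norm f)\<^sup>2 * real (Suc L)"
      using False by (intro mult_mono) auto
    moreover have "0 \<le> C * (norm f)\<^sup>2" using C(1) by simp
    ultimately have "(norm (mult_var i f - 0))\<^sup>2 * real (Suc n) \<le> B * (norm f)\<^sup>2"
      unfolding B_def by (simp add: algebra_simps)
    thus ?thesis using hardy.subspace_0[OF subspace] by blast
  qed
  moreover have "0 \<le> B" using C(1) by (simp add: B_def)
  ultimately show ?thesis by blast
qed

lemma part_dim_bounded: "\<exists>D. \<forall>n. hardy.dim (part n) \<le> D"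
proof -
  obtain m where "\<forall>n\<ge>m. hardy.dim (part n) = hardy.dim (part m) \<and>
    (\<forall>i. backward_shift i ` part (Suc n) = part n \<and> (\<forall>f\<in>part n. backward_shift i f = 0 \<longrightarrow> f = 0))"
    using backward_shift_eventually_bijective ..
  hence m: "hardy.dim (part n) = hardy.dim (part m)" if "m \<le> n" for n using that by blast
  have "hardy.dim (part n) \<le> Max ((\<lambda>n. hardy.dim (part n)) ` {..m})" for n
  proof (cases "n \<le> m")
    case False
    hence "hardy.dim (part n) = hardy.dim (part m)" by (intro m) simp
    also have "\<dots> \<le> Max ((\<lambda>n. hardy.dim (part n)) ` {..m})" by (rule Max_ge) auto
    finally show ?thesis .
  qed (rule Max_ge; auto)
  thus ?thesis by (intro exI allI)
qed

end

section \<open>Quotient modules of homogeneous ideals\<close>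

lemma hardy_of_poly_add: "hardy_of_poly (p + q) = hardy_of_poly p + hardy_of_poly q"
  by (rule hardy_eqI) (simp add: lookup_add)

lemma hardy_of_poly_0 [simp]: "hardy_of_poly 0 = 0"
  by (rule hardy_eqI) simp

lemma hardy_of_poly_sum: "hardy_of_poly (\<Sum>x\<in>A. p x) = (\<Sum>x\<in>A. hardy_of_poly (p x))"
  by (induction A rule: infinite_finite_induct) (simp_all add: hardy_of_poly_add)

lemma hardy_of_poly_var_mult: "hardy_of_poly (var_poly i * p) = mult_var i (hardy_of_poly p)"
proof -
  have "poly_eval (var_poly i * p) z = z $ i * poly_eval p z" for z
    by (simp only: poly_eval_mult poly_eval_single monom_eval_single mult_1_left)
  thus ?thesis
    by (simp add: hardy_fun_inject[symmetric] hardy_of_poly.rep_eq mult_var.rep_eq fun_eq_iff)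
qed

lemma hardy_of_poly_const_mult: "hardy_of_poly (const_poly c * p) = scaleC c (hardy_of_poly p)"
  by (simp add: hardy_fun_inject[symmetric] hardy_of_poly.rep_eq scaleC.rep_eq fun_eq_iff)

lemma bounded_linear_cinner: "bounded_linear (cinner f)"
proof (rule bounded_linear_intro)
  show "cinner f (x + y) = cinner f x + cinner f y" for x y by (rule cinner_add_right)
  show "cinner f (r *\<^sub>R x) = r *\<^sub>R cinner f x" for r x
    by (simp add: scaleR_hardy_def cinner_scaleC_right scaleR_conv_of_real)
  show "norm (cinner f x) \<le> norm x * norm f" for x
    using cinner_bound[of f x] by (simp add: mult.commute)
qed

lemma quotient_module_iff:
  "f \<in> quotient_module I \<longleftrightarrow> (\<forall>p\<in>I. cinner f (hardy_of_poly p) = 0)"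
proof
  assume "f \<in> quotient_module I"
  thus "\<forall>p\<in>I. cinner f (hardy_of_poly p) = 0"
    using closure_subset[of "hardy_of_poly ` I"] by (auto simp: quotient_module_def)
next
  assume perp: "\<forall>p\<in>I. cinner f (hardy_of_poly p) = 0"
  have "closed {g. cinner f g = 0}"
    by (intro closed_Collect_eq continuous_on_const linear_continuous_on bounded_linear_cinner)
  hence "closure (hardy_of_poly ` I) \<subseteq> {g. cinner f g = 0}"
    using perp by (intro closure_minimal) auto
  thus "f \<in> quotient_module I" by (auto simp: quotient_module_def)
qed

lemma homogeneous_hardy_of_poly:
  "(\<And>\<gamma>. \<gamma> \<in> Poly_Mapping.keys p \<Longrightarrow> mdeg \<gamma> = n) \<Longrightarrow> homogeneous n (hardy_of_poly p)"
  by (auto simp: homogeneous_def in_keys_iff)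

text \<open>
  An element of the ideal is a sum of products of a single term and a homogeneous generator; such a
  product is homogeneous and lies in the ideal, so it is orthogonal to \<open>f\<close> and therefore to each
  component of \<open>f\<close>.
\<close>

lemma quotient_module_component:
  assumes B: "\<And>p. p \<in> B \<Longrightarrow> homogeneous_poly p" and I: "I = module.span (*) B"
    and f: "f \<in> quotient_module I"
  shows "component n f \<in> quotient_module I"
proof -
  have I_ideal: "is_ideal I" unfolding I by (rule is_ideal_span)
  have "cinner (component n f) (hardy_of_poly p) = 0" if "p \<in> module.span (*) B" for p
    using that
  proof (induction rule: module.span_induct_alt[OF module_mult, consumes 1, case_names base step])
    case base
    show ?case by simp
  next
    case (step c b p)
    obtain m where m: "\<And>\<gamma>. \<gamma> \<in> Poly_Mapping.keys b \<Longrightarrow> mdeg \<gamma> = m"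
      using B[OF step(1)] by (auto simp: homogeneous_poly_def mdeg_def)
    have "b \<in> I" unfolding I using step(1) by (rule module.span_base[OF module_mult])
    have mono: "cinner (component n f) (hardy_of_poly (Poly_Mapping.single \<gamma> a * b)) = 0" for \<gamma> a
    proof -
      have "mdeg \<delta> = mdeg \<gamma> + m" if "\<delta> \<in> Poly_Mapping.keys (Poly_Mapping.single \<gamma> a * b)" for \<delta>
      proof -
        have "\<delta> \<in> {x + y | x y. x \<in> Poly_Mapping.keys (Poly_Mapping.single \<gamma> a) \<and> y \<in> Poly_Mapping.keys b}"
          using that keys_mult[of "Poly_Mapping.single \<gamma> a" b] by blast
        thus ?thesis using m by (auto split: if_splits)
      qed
      hence hom: "homogeneous (mdeg \<gamma> + m) (hardy_of_poly (Poly_Mapping.single \<gamma> a * b))"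
        by (rule homogeneous_hardy_of_poly)
      have "Poly_Mapping.single \<gamma> a * b \<in> I" using \<open>b \<in> I\<close> by (rule ideal_mult[OF I_ideal])
      hence "cinner f (hardy_of_poly (Poly_Mapping.single \<gamma> a * b)) = 0"
        using f quotient_module_iff by blast
      thus ?thesis by (simp add: cinner_component_left[OF hom])
    qed
    have "c * b = (\<Sum>\<gamma>\<in>Poly_Mapping.keys c. Poly_Mapping.single \<gamma> (Poly_Mapping.lookup c \<gamma>) * b)"
      by (simp only: sum_distrib_right[symmetric] sum_single_keys)
    hence "cinner (component n f) (hardy_of_poly (c * b))
        = (\<Sum>\<gamma>\<in>Poly_Mapping.keys c. cinner (component n f) (hardy_of_poly (Poly_Mapping.single \<gamma> (Poly_Mapping.lookup c \<gamma>) * b)))"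
      by (simp only: hardy_of_poly_sum linear_sum[OF bounded_linear.linear[OF bounded_linear_cinner]])
    also have "\<dots> = 0" using mono by simp
    finally show ?case using step(2) by (simp add: hardy_of_poly_add cinner_add_right)
  qed
  thus ?thesis unfolding quotient_module_iff I by blast
qed

lemma frontier_polydiscI:
  fixes w :: "complex ^ 'd::finite"
  assumes le: "\<And>i. cmod (w $ i) \<le> 1" and k: "cmod (w $ k) = 1"
  shows "w \<in> frontier polydisc"
proof -
  have "polydisc = (\<Inter>i. {z :: complex ^ 'd. cmod (z $ i) < 1})" by (auto simp: polydisc_def)
  moreover have "open {z :: complex ^ 'd. cmod (z $ i) < 1}" for i
    by (intro open_Collect_less continuous_intros)
  ultimately have "open (polydisc :: (complex ^ 'd) set)"
    using open_INT[of UNIV "\<lambda>i. {z :: complex ^ 'd. cmod (z $ i) < 1}"] by simp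
  hence "w \<notin> interior polydisc" using k by (simp add: interior_open polydisc_def) (metis less_irrefl)
  moreover have "w \<in> closure polydisc"
  proof (rule Lim_in_closed_set)
    show "closed (closure (polydisc :: (complex ^ 'd) set))" by simp
    have "((\<lambda>t. t *\<^sub>R w) \<longlongrightarrow> 1 *\<^sub>R w) (at_left (1::real))"
      by (intro tendsto_intros)
    thus "((\<lambda>t. t *\<^sub>R w) \<longlongrightarrow> w) (at_left (1::real))" by simp
    have "t *\<^sub>R w \<in> polydisc" if "0 < t" "t < 1" for t :: real
    proof -
      have "cmod ((t *\<^sub>R w) $ i) < 1" for i
      proof -
        have "cmod ((t *\<^sub>R w) $ i) = t * cmod (w $ i)" using that by simp
        also have "\<dots> \<le> t * 1" using that le[of i] by (intro mult_left_mono) auto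
        finally show ?thesis using that by linarith
      qed
      thus ?thesis by (simp add: polydisc_def)
    qed
    hence "\<forall>\<^sub>F t in at_left (1::real). t *\<^sub>R w \<in> polydisc"
      unfolding eventually_at_left_field by (intro exI[of _ 0]) auto
    thus "\<forall>\<^sub>F t in at_left (1::real). t *\<^sub>R w \<in> closure polydisc"
      by (rule eventually_mono) (rule subsetD[OF closure_subset])
  qed simp
  ultimately show ?thesis by (simp add: frontier_def)
qed

lemma poly_eval_homogeneous:
  assumes "homogeneous_poly p"
  shows "\<exists>n. \<forall>t z. poly_eval p (t *s z) = t ^ n * poly_eval p z"
proof -
  obtain n where n: "\<And>\<gamma>. \<gamma> \<in> Poly_Mapping.keys p \<Longrightarrow> mdeg \<gamma> = n"
    using assms by (auto simp: homogeneous_poly_def mdeg_def)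
  have "monom_eval \<gamma> (t *s z) = t ^ mdeg \<gamma> * monom_eval \<gamma> z" for \<gamma> t z
    by (simp add: monom_eval_def power_mult_distrib prod.distrib mdeg_def power_sum)
  hence "poly_eval p (t *s z) = t ^ n * poly_eval p z" for t z
    unfolding poly_eval_def sum_distrib_left using n by (intro sum.cong) (auto simp: mult_ac)
  thus ?thesis by blast
qed

lemma zero_set_span: "zero_set (module.span (*) B) = zero_set B"
proof
  show "zero_set (module.span (*) B) \<subseteq> zero_set B"
    using module.span_base[OF module_mult, of _ B] by (auto simp: zero_set_def)
  show "zero_set B \<subseteq> zero_set (module.span (*) B)"
  proof
    fix z assume z: "z \<in> zero_set B"
    have "poly_eval p z = 0" if "p \<in> module.span (*) B" for p
      using that
      by (induction rule: module.span_induct_alt[OF module_mult, consumes 1, case_names base step])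
         (use z in \<open>auto simp: zero_set_def\<close>)
    thus "z \<in> zero_set (module.span (*) B)" by (simp add: zero_set_def)
  qed
qed

lemma zero_set_cone:
  assumes "homogeneous_ideal I" "z \<in> zero_set I"
  shows "t *s z \<in> zero_set I"
proof -
  obtain B where B: "\<forall>p\<in>B. homogeneous_poly p" "I = module.span (*) B"
    using assms(1) by (auto simp: homogeneous_ideal_def)
  have "poly_eval p (t *s z) = 0" if "p \<in> B" for p
    using assms(2) poly_eval_homogeneous[of p] B that unfolding B zero_set_span
    by (auto simp: zero_set_def)
  thus ?thesis unfolding B zero_set_span by (simp add: zero_set_def)
qed

text \<open>
  The zero set is a cone, so a nonzero point can be scaled until its largest coordinate is
  unimodular; it is then on the boundary of the polydisc.
\<close>

lemma zero_set_equal_moduli: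
  assumes "homogeneous_ideal I" "zero_set I \<inter> frontier polydisc \<subseteq> torus"
    and z: "z \<in> zero_set I" "z \<noteq> 0"
  shows "cmod (z $ i) = cmod (z $ j)" "z $ i \<noteq> 0"
proof -
  define r where "r = Max (range (\<lambda>k. cmod (z $ k)))"
  have r: "cmod (z $ k) \<le> r" for k unfolding r_def by (rule Max_ge) auto
  have "r \<in> range (\<lambda>k. cmod (z $ k))" unfolding r_def by (rule Max_in) auto
  then obtain k0 where k0: "cmod (z $ k0) = r" by auto
  have "r > 0"
  proof (rule ccontr)
    assume "\<not> r > 0"
    hence "cmod (z $ k) \<le> 0" for k using r[of k] by linarith
    hence "z $ k = 0" for k by simp
    thus False using z(2) by (simp add: vec_eq_iff)
  qed
  define w where "w = complex_of_real (inverse r) *s z"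
  have w: "cmod (w $ k) = cmod (z $ k) / r" for k
    using \<open>r > 0\<close> by (simp add: w_def norm_mult norm_inverse divide_inverse mult.commute)
  have "w \<in> frontier polydisc"
    by (rule frontier_polydiscI[of _ k0]) (use w r k0 \<open>r > 0\<close> in auto)
  moreover have "w \<in> zero_set I" unfolding w_def using assms(1) z(1) by (rule zero_set_cone)
  ultimately have "w \<in> torus" using assms(2) by blast
  hence "cmod (w $ k) = 1" for k by (simp add: torus_def)
  hence "cmod (z $ k) / r = 1" for k by (simp only: w)
  hence *: "cmod (z $ k) = r" for k using \<open>r > 0\<close> by (metis divide_eq_1_iff)
  show "cmod (z $ i) = cmod (z $ j)" by (simp only: *)
  show "z $ i \<noteq> 0" using *[of i] \<open>r > 0\<close> by (metis norm_zero less_irrefl)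
qed

text \<open>
  An \<open>f\<close> in the kernel of \<open>T\<^sub>i - c T\<^sub>j\<close> is orthogonal to the ideal \<open>J\<close> generated by \<open>I\<close> and
  \<open>z\<^sub>i - cnj c z\<^sub>j\<close>, whose only possible zero is the origin. In high degrees \<open>J\<close> contains all
  monomials.
\<close>

lemma quotient_module_pencil_injective:
  assumes hom: "homogeneous_ideal I" and front: "zero_set I \<inter> frontier polydisc \<subseteq> torus"
    and c: "cmod c \<noteq> 1"
  shows "\<exists>N. \<forall>n\<ge>N. \<forall>f\<in>quotient_module I. homogeneous n f \<longrightarrow>
    backward_shift i f = scaleC c (backward_shift j f) \<longrightarrow> f = 0"
proof -
  define q where "q = var_poly i - const_poly (cnj c) * var_poly j"
  define J where "J = module.span (*) (insert q I)"
  have "zero_set J \<subseteq> {0}"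
  proof
    fix z assume "z \<in> zero_set J"
    hence z: "z \<in> zero_set I" "poly_eval q z = 0"
      unfolding J_def zero_set_span by (auto simp: zero_set_def)
    have "poly_eval q z = z $ i - cnj c * z $ j"
      unfolding q_def poly_eval_diff poly_eval_mult poly_eval_single monom_eval_single by simp
    with z(2) have "cmod (z $ i) = cmod c * cmod (z $ j)"
      by (metis complex_mod_cnj eq_iff_diff_eq_0 norm_mult)
    thus "z \<in> {0}" using zero_set_equal_moduli(1)[OF hom front z(1), of i j] zero_set_equal_moduli(2)[OF hom front z(1), of j] c
      by (cases "z = 0") auto
  qed
  hence "\<exists>N. \<forall>\<gamma>. N \<le> mdeg \<gamma> \<longrightarrow> Poly_Mapping.single \<gamma> 1 \<in> J"
    using is_ideal_span unfolding J_def by (intro contains_high_monomials)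
  then obtain N where "\<forall>\<gamma>. N \<le> mdeg \<gamma> \<longrightarrow> Poly_Mapping.single \<gamma> 1 \<in> J" ..
  hence N: "Poly_Mapping.single \<gamma> 1 \<in> J" if "N \<le> mdeg \<gamma>" for \<gamma> using that by simp
  obtain B where I: "I = module.span (*) B" using hom by (auto simp: homogeneous_ideal_def)
  have I_ideal: "is_ideal I" unfolding I by (rule is_ideal_span)
  have "f = 0" if n: "N \<le> n" and f: "f \<in> quotient_module I" "homogeneous n f"
    and eq: "backward_shift i f = scaleC c (backward_shift j f)" for n f
  proof -
    define K where "K = {p. \<forall>s. cinner f (hardy_of_poly (s * p)) = 0}"
    have "is_ideal K"
    proof (rule is_idealI)
      show "0 \<in> K" by (simp add: K_def)
      show "x + y \<in> K" if "x \<in> K" "y \<in> K" for x y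
        using that by (simp add: K_def distrib_left hardy_of_poly_add cinner_add_right)
      show "s * x \<in> K" if "x \<in> K" for s x
        using that by (simp add: K_def mult.assoc[symmetric])
    qed
    moreover have "I \<subseteq> K"
      using f(1) ideal_mult[OF I_ideal] unfolding K_def quotient_module_iff by blast
    moreover have "q \<in> K"
      unfolding K_def
    proof (intro CollectI allI)
      fix s
      have "s * q = var_poly i * s - const_poly (cnj c) * (var_poly j * s)"
        by (simp only: q_def right_diff_distrib mult_ac)
      hence "s * q + const_poly (cnj c) * (var_poly j * s) = var_poly i * s" by simp
      hence "hardy_of_poly (s * q) + scaleC (cnj c) (mult_var j (hardy_of_poly s)) = mult_var i (hardy_of_poly s)"
        by (simp only: hardy_of_poly_add[symmetric] hardy_of_poly_var_mult[symmetric] hardy_of_poly_const_mult[symmetric])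
      hence "cinner f (hardy_of_poly (s * q)) + c * cinner f (mult_var j (hardy_of_poly s)) = cinner f (mult_var i (hardy_of_poly s))"
        by (metis cinner_add_right cinner_scaleC_right complex_cnj_cnj)
      thus "cinner f (hardy_of_poly (s * q)) = 0"
        by (simp add: backward_shift_adjoint[symmetric] eq cinner_scaleC_left)
    qed
    ultimately have "J \<subseteq> K" unfolding J_def by (intro module.span_minimal[OF module_mult]) auto
    show "f = 0"
    proof (rule hardy_eqI)
      fix \<gamma>
      show "hardy_coeff f \<gamma> = hardy_coeff 0 \<gamma>"
      proof (cases "mdeg \<gamma> = n")
        case True
        hence "Poly_Mapping.single \<gamma> 1 \<in> K" using N[of \<gamma>] n \<open>J \<subseteq> K\<close> by auto
        hence "cinner f (hardy_of_poly (1 * Poly_Mapping.single \<gamma> 1)) = 0" unfolding K_def by blast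
        moreover have "cinner f (hardy_of_poly (Poly_Mapping.single \<gamma> 1)) = hardy_coeff f \<gamma>"
        proof -
          have "cinner f (hardy_of_poly (Poly_Mapping.single \<gamma> 1))
              = (\<Sum>\<delta> | mdeg \<delta> = n. if \<delta> = \<gamma> then hardy_coeff f \<gamma> else 0)"
            unfolding cinner_homogeneous[OF f(2)] by (rule sum.cong) (auto simp: lookup_single when_def)
          thus ?thesis using True by (simp add: finite_mdeg_eq)
        qed
        ultimately show ?thesis by simp
      next
        case False
        thus ?thesis using f(2) by (auto simp: homogeneous_def)
      qed
    qed
  qed
  thus ?thesis by blast
qed

theorem graded_coinvariant_quotient_module:
  fixes I :: "'d::finite mpoly set"
  assumes two: "CARD('d) \<ge> 2" and hom: "homogeneous_ideal I"
    and front: "zero_set I \<inter> frontier polydisc \<subseteq> torus"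
  shows "graded_coinvariant (quotient_module I)"
proof
  obtain B where B: "\<And>p. p \<in> B \<Longrightarrow> homogeneous_poly p" "I = module.span (*) B"
    using hom by (auto simp: homogeneous_ideal_def)
  have I_ideal: "is_ideal I" unfolding B(2) by (rule is_ideal_span)
  show "hardy.subspace (quotient_module I)"
    by (rule hardy.subspaceI) (auto simp: quotient_module_iff cinner_add_left cinner_scaleC_left)
  show "component n f \<in> quotient_module I" if "f \<in> quotient_module I" for f n
    using quotient_module_component[OF B that] by blast
  show "f \<in> quotient_module I" if c: "\<And>n. component n f \<in> quotient_module I" for f
    unfolding quotient_module_iff
  proof
    fix p assume "p \<in> I"
    hence "cinner (component n f) (component n (hardy_of_poly p)) = 0" for n
      unfolding cinner_component_component using c quotient_module_iff by blast
    thus "cinner f (hardy_of_poly p) = 0"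
      using cinner_sums[of f "hardy_of_poly p"] by (simp add: sums_iff)
  qed
  show "backward_shift i f \<in> quotient_module I" if f: "f \<in> quotient_module I" for f i
    unfolding quotient_module_iff
  proof
    fix p assume "p \<in> I"
    hence "var_poly i * p \<in> I" by (rule ideal_mult[OF I_ideal])
    thus "cinner (backward_shift i f) (hardy_of_poly p) = 0"
      using f unfolding quotient_module_iff backward_shift_adjoint hardy_of_poly_var_mult[symmetric] by blast
  qed
  show "\<exists>N. \<forall>n\<ge>N. \<forall>f\<in>quotient_module I. homogeneous n f \<longrightarrow>
      backward_shift i f = scaleC c (backward_shift j f) \<longrightarrow> f = 0"
    if "i \<noteq> j" "cmod c \<noteq> 1" for i j c
    by (rule quotient_module_pencil_injective[OF hom front that(2)])
  show "\<exists>j. j \<noteq> i" for i :: 'd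
  proof (rule ccontr)
    assume "\<not> ?thesis"
    hence "UNIV = {i}" by auto
    hence "CARD('d) = 1" by (metis card_1_singleton_iff is_singletonI is_singleton_altdef)
    thus False using two by simp
  qed
qed

section \<open>The cross commutators of the compressions\<close>

context graded_coinvariant
begin

lemma exists_part_projection: "\<exists>g\<in>part n. \<forall>h\<in>part n. cinner (f - g) h = 0"
proof -
  obtain B0 where "finite B0" "part n \<subseteq> hardy.span B0" using part_finite_dim by blast
  then obtain B where B: "finite B" "B \<subseteq> part n" "part n \<subseteq> hardy.span B" using finite_dim_basis by metis
  moreover have "hardy.span B \<subseteq> part n" by (rule hardy.span_minimal[OF B(2) subspace_part])
  ultimately have "hardy.span B = part n" by blast
  thus ?thesis using exists_projection_finite[OF B(1), of f] by simp
qed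

lemma component_in_part: "f \<in> M \<Longrightarrow> component n f \<in> part n"
  by (simp add: part_def component_in)

text \<open>
  The projection is assembled from the projections onto the finite-dimensional parts, whose norms
  are square-summable.
\<close>

lemma exists_projection: "\<exists>g\<in>M. \<forall>h\<in>M. cinner (f - g) h = 0"
proof -
  have "\<forall>n. \<exists>g\<in>part n. \<forall>h\<in>part n. cinner (component n f - g) h = 0"
    using exists_part_projection by blast
  then obtain g where g: "\<And>n. g n \<in> part n" "\<And>n h. h \<in> part n \<Longrightarrow> cinner (component n f - g n) h = 0"
    by metis
  have hom: "homogeneous n (g n)" for n using g(1)[of n] by (simp add: part_def)
  have le: "norm (g n) \<le> norm (component n f)" for n
  proof -
    have "cinner (g n) (g n) = cinner (component n f) (g n)"
      using g(2)[OF g(1), of n] by (simp add: cinner_diff_left)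
    hence "(norm (g n))\<^sup>2 = cmod (cinner (component n f) (g n))"
      using cinner_self_norm[of "g n"] by (metis norm_of_real abs_of_nonneg zero_le_power2)
    also have "\<dots> \<le> norm (component n f) * norm (g n)" by (rule cinner_bound)
    finally show ?thesis by (cases "norm (g n) = 0") (auto simp: power2_eq_square)
  qed
  have "(\<Sum>n<N. (norm (g n))\<^sup>2) \<le> (norm f)\<^sup>2" for N
  proof -
    have "(\<Sum>n<N. (norm (g n))\<^sup>2) \<le> (\<Sum>n<N. (norm (component n f))\<^sup>2)"
      by (intro sum_mono power_mono le) auto
    also have "\<dots> \<le> (norm f)\<^sup>2"
      using sum_le_suminf[of "\<lambda>n. (norm (component n f))\<^sup>2" "{..<N}"] norm_sq_sums[of f]
      by (simp add: sums_iff)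
    finally show ?thesis .
  qed
  hence "\<exists>G. \<forall>n. component n G = g n" by (intro exists_with_components[of g "(norm f)\<^sup>2"] hom)
  then obtain G where "\<forall>n. component n G = g n" ..
  hence G: "component n G = g n" for n ..
  have "component n G \<in> M" for n using g(1)[of n] by (simp add: part_def G)
  hence "G \<in> M" by (rule in_if_components)
  moreover have "cinner (f - G) h = 0" if h: "h \<in> M" for h
  proof -
    have "cinner (component n (f - G)) (component n h) = 0" for n
      using g(2)[OF component_in_part[OF h]] by (simp add: component_diff G)
    thus ?thesis using cinner_sums[of "f - G" h] by (simp add: sums_iff)
  qed
  ultimately show ?thesis by blast
qed

lemma eq_if_cinner_eq:
  assumes "f \<in> M" "g \<in> M" "\<And>h. h \<in> M \<Longrightarrow> cinner f h = cinner g h"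
  shows "f = g"
proof -
  have "f - g \<in> M" using assms hardy.subspace_diff[OF subspace] by blast
  hence "cinner (f - g) (f - g) = 0" using assms(3)[of "f - g"] by (simp add: cinner_diff_left)
  hence "Re (cinner (f - g) (f - g)) = 0" by (simp only: zero_complex.simps)
  thus ?thesis by (simp only: cinner_self_eq_0 right_minus_eq)
qed

lemma projection_eqI:
  assumes "g \<in> M" "\<And>h. h \<in> M \<Longrightarrow> cinner f h = cinner g h"
  shows "projection M f = g"
  unfolding projection_def
proof (rule the_equality)
  show "g \<in> M \<and> (\<forall>h\<in>M. cinner (f - g) h = 0)" using assms by (simp add: cinner_diff_left)
  show "g' = g" if "g' \<in> M \<and> (\<forall>h\<in>M. cinner (f - g') h = 0)" for g'
    using that assms by (intro eq_if_cinner_eq) (simp_all add: cinner_diff_left)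
qed

lemma projection_in: "projection M f \<in> M"
  and cinner_projection: "h \<in> M \<Longrightarrow> cinner (projection M f) h = cinner f h"
proof -
  obtain g where g: "g \<in> M" "\<And>h. h \<in> M \<Longrightarrow> cinner f h = cinner g h"
    using exists_projection[of f] by (auto simp: cinner_diff_left)
  have "projection M f = g" by (rule projection_eqI[OF g])
  thus "projection M f \<in> M" "h \<in> M \<Longrightarrow> cinner (projection M f) h = cinner f h"
    using g by simp_all
qed

lemma projection_add: "projection M (f + g) = projection M f + projection M g"
  by (intro projection_eqI)
     (simp_all add: hardy.subspace_add[OF subspace] projection_in cinner_add_left cinner_projection)

lemma projection_scaleC: "projection M (scaleC c f) = scaleC c (projection M f)"
  by (intro projection_eqI)
     (simp_all add: hardy.subspace_scale[OF subspace] projection_in cinner_scaleC_left cinner_projection)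

lemma projection_0 [simp]: "projection M 0 = 0"
  using projection_scaleC[of 0 0] by simp

lemma component_projection: "component n (projection M f) = projection M (component n f)"
proof (rule projection_eqI[symmetric])
  show "component n (projection M f) \<in> M" by (intro component_in projection_in)
  fix h assume h: "h \<in> M"
  have "cinner (component n f) h = cinner f (component n h)" for f
  proof -
    have "cinner (component n f) h = cinner (component n f) (component n h)"
      by (rule cinner_component_component[symmetric])
    also have "\<dots> = cnj (cinner (component n h) (component n f))" by (rule cinner_commute)
    also have "\<dots> = cnj (cinner (component n h) f)" by (simp only: cinner_component_component)
    also have "\<dots> = cinner f (component n h)" by (rule cinner_commute[symmetric])
    finally show ?thesis .
  qed
  thus "cinner (component n f) h = cinner (component n (projection M f)) h"
    using component_in[OF h] by (simp add: cinner_projection)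
qed

lemma norm_minus_projection_le:
  assumes "g \<in> M"
  shows "norm (f - projection M f) \<le> norm (f - g)"
proof -
  let ?r = "f - projection M f"
  have "projection M f - g \<in> M" using assms projection_in hardy.subspace_diff[OF subspace] by blast
  hence "cinner ?r (projection M f - g) = 0" by (simp only: cinner_diff_left cinner_projection right_minus_eq)
  hence "cinner ?r (f - g) = cinner ?r ?r"
    using cinner_add_right[of ?r ?r "projection M f - g"] by simp
  hence "complex_of_real ((norm ?r)\<^sup>2) = cinner ?r (f - g)" by (simp only: cinner_self_norm)
  hence "(norm ?r)\<^sup>2 = cmod (cinner ?r (f - g))"
    by (metis norm_of_real abs_of_nonneg zero_le_power2)
  also have "\<dots> \<le> norm ?r * norm (f - g)" by (rule cinner_bound)
  finally show ?thesis by (cases "norm ?r = 0") (auto simp: power2_eq_square)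
qed

lemma adjoint_onI:
  assumes "f \<in> M" "g \<in> M" "\<And>h. h \<in> M \<Longrightarrow> cinner h g = cinner (T h) f"
  shows "adjoint_on M T f = g"
  unfolding adjoint_on_def
proof (rule the_equality)
  show "g \<in> M \<and> (\<forall>h\<in>M. cinner h g = cinner (T h) f)" using assms by blast
  fix g' assume g': "g' \<in> M \<and> (\<forall>h\<in>M. cinner h g' = cinner (T h) f)"
  show "g' = g"
  proof (rule eq_if_cinner_eq)
    fix h assume "h \<in> M"
    hence "cinner h g' = cinner h g" using g' assms(3) by simp
    thus "cinner g' h = cinner g h" by (metis cinner_commute)
  qed (use g' assms in auto)
qed

lemma adjoint_compression: "f \<in> M \<Longrightarrow> adjoint_on M (compression M i) f = backward_shift i f"
proof (rule adjoint_onI)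
  fix h assume f: "f \<in> M" "h \<in> M"
  show "cinner h (backward_shift i f) = cinner (compression M i h) f"
    using f by (simp add: compression_def cinner_projection mult_var_adjoint)
qed (auto intro: backward_shift_in)

text \<open>
  The commutator of \<open>S\<^sub>i\<^sup>*\<close> and \<open>S\<^sub>j\<close> on \<open>M\<close>, extended to the whole space by the same formula.
\<close>

definition cross_commutator :: "'d \<Rightarrow> 'd \<Rightarrow> 'd hardy \<Rightarrow> 'd hardy"
  where "cross_commutator i j f =
    backward_shift i (projection M (mult_var j f)) - projection M (mult_var j (backward_shift i f))"

lemma commutator_eq_cross_commutator:
  assumes "f \<in> M"
  shows "commutator (adjoint_on M (compression M i)) (compression M j) f = cross_commutator i j f"
  using assms by (simp add: commutator_def compression_def cross_commutator_def adjoint_compression projection_in)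

lemma cross_commutator_in: "cross_commutator i j f \<in> M"
  unfolding cross_commutator_def
  by (intro hardy.subspace_diff[OF subspace] backward_shift_in projection_in)

lemma cross_commutator_add: "cross_commutator i j (f + g) = cross_commutator i j f + cross_commutator i j g"
  by (simp add: cross_commutator_def mult_var_add projection_add backward_shift_add)

lemma cross_commutator_scaleC: "cross_commutator i j (scaleC c f) = scaleC c (cross_commutator i j f)"
  by (simp add: cross_commutator_def mult_var_scaleC projection_scaleC backward_shift_scaleC
      hardy.scale_right_diff_distrib)

text \<open>
  The component of \<open>z\<^sub>i f\<close> orthogonal to the subspace.
\<close>

definition defect :: "'d \<Rightarrow> 'd hardy \<Rightarrow> 'd hardy"
  where "defect i f = mult_var i f - projection M (mult_var i f)"

text \<open>
  On the whole Hardy space, \<open>T\<^sub>i\<close> commutes with multiplication by \<open>z\<^sub>j\<close> for \<open>i \<noteq> j\<close>, and for \<open>i = j\<close> the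
  commutator is the projection onto the face part. The compression to \<open>M\<close> adds the term with the
  defects, since inserting the projection between \<open>T\<^sub>i\<close> and \<open>z\<^sub>j\<close> omits just their contribution.
\<close>

lemma cinner_cross_commutator:
  assumes f: "f \<in> M" and h: "h \<in> M"
  shows "cinner (cross_commutator i j f) h =
    (if i = j then cinner (face_part i f) (face_part i h) else 0) - cinner (defect j f) (defect i h)"
proof -
  have "cinner (defect j f) (projection M (mult_var i h)) = 0"
    by (simp add: defect_def cinner_diff_left cinner_projection projection_in)
  hence 1: "cinner (defect j f) (defect i h)
      = cinner (mult_var j f) (mult_var i h) - cinner (projection M (mult_var j f)) (mult_var i h)"
    unfolding defect_def[of i] by (simp add: cinner_diff_right) (simp add: defect_def cinner_diff_left)
  have 2: "cinner (cross_commutator i j f) h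
      = cinner (projection M (mult_var j f)) (mult_var i h) - cinner (backward_shift i f) (backward_shift j h)"
    using h by (simp add: cross_commutator_def cinner_diff_left cinner_projection backward_shift_adjoint mult_var_adjoint)
  have 3: "cinner (mult_var j f) (mult_var i h) - cinner (backward_shift i f) (backward_shift j h)
      = (if i = j then cinner (face_part i f) (face_part i h) else 0)"
  proof (cases "i = j")
    case True
    thus ?thesis using cinner_face_part[of f h i]
      by (simp add: mult_var_adjoint backward_shift_mult_var)
  next
    case False
    have "cinner (mult_var j f) (mult_var i h) = cinner (backward_shift i (mult_var j f)) h"
      by (simp only: backward_shift_adjoint)
    also have "\<dots> = cinner (backward_shift i f) (backward_shift j h)"
      by (simp only: backward_shift_mult_var_commute[OF False] mult_var_adjoint)
    finally show ?thesis using False by simp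
  qed
  show ?thesis unfolding 1 2 3[symmetric] by simp
qed

lemma cross_commutator_adjoint:
  assumes f: "f \<in> M" and h: "h \<in> M"
  shows "cinner (cross_commutator i j f) h = cinner f (cross_commutator j i h)"
proof -
  have "cinner f (cross_commutator j i h) = cnj (cinner (cross_commutator j i h) f)" by (rule cinner_commute)
  also have "\<dots> = (if i = j then cnj (cinner (face_part j h) (face_part j f)) else 0)
      - cnj (cinner (defect i h) (defect j f))"
    unfolding cinner_cross_commutator[OF h f] by auto
  also have "\<dots> = cinner (cross_commutator i j f) h"
    unfolding cinner_cross_commutator[OF f h] cinner_commute[symmetric] by auto
  finally show ?thesis ..
qed

lemma component_cross_commutator:
  assumes "f \<in> M"
  shows "component n (cross_commutator i j f) = cross_commutator i j (component n f)"
proof -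
  have 1: "component n (backward_shift i (projection M (mult_var j f)))
      = backward_shift i (projection M (mult_var j (component n f)))"
    by (simp only: component_backward_shift component_projection component_mult_var)
  have 2: "component n (projection M (mult_var j (backward_shift i f)))
      = projection M (mult_var j (backward_shift i (component n f)))"
  proof (cases n)
    case 0
    have "backward_shift i (component 0 f) = 0"
      by (rule hardy_eqI) simp
    moreover have "mult_var j 0 = (0 :: 'd hardy)" using mult_var_scaleC[of j 0 0] by simp
    ultimately show ?thesis using 0 by (simp add: component_projection component_0_mult_var)
  next
    case (Suc m)
    thus ?thesis by (simp only: component_projection component_mult_var component_backward_shift)
  qed
  show ?thesis unfolding cross_commutator_def component_diff 1 2 ..
qed

lemma uniform_bounds:
  "\<exists>C\<ge>0. \<forall>n. \<forall>f\<in>part n. \<forall>i. (norm (face_part i f))\<^sup>2 * real (Suc n) \<le> C * (norm f)\<^sup>2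
    \<and> (norm (defect i f))\<^sup>2 * real (Suc n) \<le> C * (norm f)\<^sup>2"
proof -
  obtain A where A: "\<And>i. 0 \<le> A i \<and> (\<forall>n. \<forall>f\<in>part n. (norm (face_part i f))\<^sup>2 * real (Suc n) \<le> A i * (norm f)\<^sup>2)"
    using face_part_bound by metis
  obtain B where B: "\<And>i. 0 \<le> B i \<and> (\<forall>n. \<forall>f\<in>part n. \<exists>g\<in>M. (norm (mult_var i f - g))\<^sup>2 * real (Suc n) \<le> B i * (norm f)\<^sup>2)"
    using lift_bound by metis
  define C where "C = (\<Sum>i\<in>UNIV. A i + B i)"
  have C: "A i + B i \<le> C" for i
    unfolding C_def using A B by (intro member_le_sum) (auto intro: add_nonneg_nonneg)
  have AC: "A i \<le> C" and BC: "B i \<le> C" for i using C[of i] A[of i] B[of i] by linarith+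
  have "(norm (face_part i f))\<^sup>2 * real (Suc n) \<le> C * (norm f)\<^sup>2
    \<and> (norm (defect i f))\<^sup>2 * real (Suc n) \<le> C * (norm f)\<^sup>2" if f: "f \<in> part n" for n f i
  proof
    have "(norm (face_part i f))\<^sup>2 * real (Suc n) \<le> A i * (norm f)\<^sup>2" using A f by blast
    also have "\<dots> \<le> C * (norm f)\<^sup>2" by (intro mult_right_mono AC) simp
    finally show "(norm (face_part i f))\<^sup>2 * real (Suc n) \<le> C * (norm f)\<^sup>2" .
    obtain g where g: "g \<in> M" "(norm (mult_var i f - g))\<^sup>2 * real (Suc n) \<le> B i * (norm f)\<^sup>2"
      using B f by blast
    have "(norm (defect i f))\<^sup>2 * real (Suc n) \<le> (norm (mult_var i f - g))\<^sup>2 * real (Suc n)"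
      unfolding defect_def by (intro mult_right_mono power_mono norm_minus_projection_le g(1)) auto
    also note g(2)
    also have "B i * (norm f)\<^sup>2 \<le> C * (norm f)\<^sup>2" by (intro mult_right_mono BC) simp
    finally show "(norm (defect i f))\<^sup>2 * real (Suc n) \<le> C * (norm f)\<^sup>2" .
  qed
  moreover have "0 \<le> C" using A[of undefined] AC[of undefined] by linarith
  ultimately show ?thesis by (intro exI[of _ C]) simp
qed

text \<open>
  Each of the two terms of \<open>cinner_cross_commutator\<close>, taken at \<open>h = [S\<^sub>i\<^sup>*, S\<^sub>j] f\<close>, is a product of two
  factors of order \<open>n\<^sup>-\<^sup>1\<^sup>/\<^sup>2\<close>.
\<close>

lemma cross_commutator_bound:
  "\<exists>C\<ge>0. \<forall>i j n. \<forall>f\<in>part n. norm (cross_commutator i j f) * real (Suc n) \<le> C * norm f"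
proof -
  obtain C where "0 \<le> C \<and> (\<forall>n. \<forall>f\<in>part n. \<forall>i. (norm (face_part i f))\<^sup>2 * real (Suc n) \<le> C * (norm f)\<^sup>2
    \<and> (norm (defect i f))\<^sup>2 * real (Suc n) \<le> C * (norm f)\<^sup>2)"
    using uniform_bounds ..
  hence C: "0 \<le> C" and face: "(norm (face_part i f))\<^sup>2 * real (Suc n) \<le> C * (norm f)\<^sup>2"
    and def: "(norm (defect i f))\<^sup>2 * real (Suc n) \<le> C * (norm f)\<^sup>2" if "f \<in> part n" for n f i
    using that by auto
  have prod: "x * y * s \<le> C * (a * b)"
    if "x\<^sup>2 * s \<le> C * a\<^sup>2" "y\<^sup>2 * s \<le> C * b\<^sup>2" "0 \<le> x" "0 \<le> y" "0 \<le> s" "0 \<le> a" "0 \<le> b" "0 \<le> C" for x y s a b :: real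
  proof -
    have "(x * y * s)\<^sup>2 = (x\<^sup>2 * s) * (y\<^sup>2 * s)" by (simp add: power2_eq_square mult_ac)
    also have "\<dots> \<le> (C * a\<^sup>2) * (C * b\<^sup>2)" by (rule mult_mono) (use that in auto)
    also have "\<dots> = (C * (a * b))\<^sup>2" by (simp add: power2_eq_square mult_ac)
    finally show ?thesis by (rule power2_le_imp_le) (use that in auto)
  qed
  have C0: "0 \<le> C" using C hardy.subspace_0[OF subspace_part] by blast
  have "norm (cross_commutator i j f) * real (Suc n) \<le> (2 * C) * norm f" if f: "f \<in> part n" for i j n f
  proof -
    define h where "h = cross_commutator i j f"
    have fM: "f \<in> M" using f by (simp add: part_def)
    have "component n h = h"
      using component_cross_commutator[OF fM, of n i j] f
      by (simp add: h_def part_def homogeneous_iff_component)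
    hence h: "h \<in> part n" using cross_commutator_in[of i j f] unfolding h_def[symmetric]
      by (simp add: part_def homogeneous_iff_component)
    have hM: "h \<in> M" using h by (simp add: part_def)
    have "complex_of_real ((norm h)\<^sup>2) = (if i = j then cinner (face_part i f) (face_part i h) else 0) - cinner (defect j f) (defect i h)"
      unfolding cinner_self_norm[symmetric] using cinner_cross_commutator[OF fM hM, of i j] by (simp only: h_def)
    hence "(norm h)\<^sup>2 = cmod ((if i = j then cinner (face_part i f) (face_part i h) else 0) - cinner (defect j f) (defect i h))"
      by (metis norm_of_real abs_of_nonneg zero_le_power2)
    also have "\<dots> \<le> cmod (if i = j then cinner (face_part i f) (face_part i h) else 0) + cmod (cinner (defect j f) (defect i h))"
      by (rule norm_triangle_ineq4)
    also have "\<dots> \<le> norm (face_part i f) * norm (face_part i h) + norm (defect j f) * norm (defect i h)"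
      by (intro add_mono cinner_bound) (auto intro: cinner_bound mult_nonneg_nonneg)
    finally have "(norm h)\<^sup>2 * real (Suc n) \<le> (norm (face_part i f) * norm (face_part i h) + norm (defect j f) * norm (defect i h)) * real (Suc n)"
      by (rule mult_right_mono) simp
    also have "\<dots> \<le> C * (norm f * norm h) + C * (norm f * norm h)"
      unfolding distrib_right
      by (intro add_mono prod face def f h C0) auto
    finally have le: "(norm h * real (Suc n)) * norm h \<le> (2 * C * norm f) * norm h"
      by (simp add: power2_eq_square mult_ac)
    show ?thesis
    proof (cases "h = 0")
      case True
      have "0 \<le> 2 * C * norm f" using C0 by simp
      thus ?thesis using True by (simp add: h_def)
    next
      case False
      hence "0 < norm h" by simp
      with le have "norm h * real (Suc n) \<le> 2 * C * norm f" by (rule mult_right_le_imp_le)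
      thus ?thesis by (simp only: h_def)
    qed
  qed
  thus ?thesis using C0 by (intro exI[of _ "2 * C"]) simp
qed

end

section \<open>Enumeration of singular values and compactness\<close>

text \<open>
  Multiplicities \<open>\<mu> \<sigma>\<close> on the positive reals, of which only finitely many are counted above every \<open>\<epsilon>\<close>,
  are those of a decreasing sequence: \<open>s n\<close> is the largest \<open>\<sigma>\<close> of positive multiplicity such that
  more than \<open>n\<close> values, with multiplicity, are at least \<open>\<sigma>\<close>. Then \<open>s n\<close> is at least \<open>\<sigma>\<close> if and only
  if \<open>n < N \<sigma>\<close>, and larger than \<open>\<sigma>\<close> if and only if \<open>n < N' \<sigma>\<close>, where \<open>N\<close> counts the values that are at
  least \<open>\<sigma>\<close> and \<open>N'\<close> those that are larger.
\<close>

lemma exists_decreasing_enumeration: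
  fixes \<mu> :: "real \<Rightarrow> nat"
  assumes bound: "\<And>\<epsilon> S. 0 < \<epsilon> \<Longrightarrow> finite S \<Longrightarrow> S \<subseteq> {\<epsilon>..} \<Longrightarrow> real (\<Sum>\<sigma>\<in>S. \<mu> \<sigma>) * \<epsilon> \<le> A"
  shows "\<exists>s. decseq s \<and> (\<forall>n. 0 \<le> s n) \<and> (\<forall>\<sigma>>0. finite {n. s n = \<sigma>} \<and> card {n. s n = \<sigma>} = \<mu> \<sigma>)
    \<and> (\<forall>n. s n * real (Suc n) \<le> A)"
proof -
  define P where "P = {\<sigma>. 0 < \<sigma> \<and> 0 < \<mu> \<sigma>}"
  have A0: "0 \<le> A" using bound[of 1 "{}"] by simp
  have fin: "finite (P \<inter> {\<epsilon>..})" if \<epsilon>: "0 < \<epsilon>" for \<epsilon>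
  proof (rule ccontr)
    assume "infinite (P \<inter> {\<epsilon>..})"
    then obtain S where S: "S \<subseteq> P \<inter> {\<epsilon>..}" "finite S" "card S = Suc (nat \<lceil>A / \<epsilon>\<rceil>)"
      using infinite_arbitrarily_large by metis
    have "card S = (\<Sum>\<sigma>\<in>S. 1)" by simp
    also have "\<dots> \<le> (\<Sum>\<sigma>\<in>S. \<mu> \<sigma>)" using S(1) by (intro sum_mono) (auto simp: P_def Suc_le_eq)
    finally have "real (card S) \<le> real (\<Sum>\<sigma>\<in>S. \<mu> \<sigma>)" by (rule of_nat_mono)
    hence "real (card S) * \<epsilon> \<le> real (\<Sum>\<sigma>\<in>S. \<mu> \<sigma>) * \<epsilon>" using \<epsilon> by (intro mult_right_mono) auto
    also have "\<dots> \<le> A" using S by (intro bound \<epsilon>) auto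
    finally have "real (card S) \<le> A / \<epsilon>" using \<epsilon> by (simp add: field_simps)
    thus False unfolding S(3) by linarith
  qed
  define N where "N = (\<lambda>\<epsilon>. \<Sum>\<sigma>\<in>P \<inter> {\<epsilon>..}. \<mu> \<sigma>)"
  define N' where "N' = (\<lambda>\<epsilon>. \<Sum>\<sigma>\<in>P \<inter> {\<epsilon><..}. \<mu> \<sigma>)"
  have fin': "finite (P \<inter> {\<epsilon><..})" if "0 < \<epsilon>" for \<epsilon>
    by (rule finite_subset[OF _ fin[OF that]]) auto
  have N_mono: "N \<tau> \<le> N \<sigma>" if "0 < \<sigma>" "\<sigma> \<le> \<tau>" for \<sigma> \<tau>
    unfolding N_def by (rule sum_mono2[OF fin[OF that(1)]]) (use that in auto)
  have N_split: "N \<sigma> = N' \<sigma> + \<mu> \<sigma>" if \<sigma>: "0 < \<sigma>" for \<sigma>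
  proof (cases "\<mu> \<sigma> = 0")
    case True
    hence "P \<inter> {\<sigma>..} = P \<inter> {\<sigma><..}" by (auto simp: P_def le_less)
    thus ?thesis using True by (simp add: N_def N'_def)
  next
    case False
    hence "P \<inter> {\<sigma>..} = insert \<sigma> (P \<inter> {\<sigma><..})" using \<sigma> by (auto simp: P_def)
    thus ?thesis using fin'[OF \<sigma>] by (simp add: N_def N'_def)
  qed
  define G where "G = (\<lambda>n. {\<sigma> \<in> P. n < N \<sigma>})"
  have max_G: "\<exists>m\<in>G n. \<forall>\<tau>\<in>G n. \<tau> \<le> m" if ne: "G n \<noteq> {}" for n
  proof -
    obtain \<sigma> where \<sigma>: "\<sigma> \<in> G n" using ne by blast
    have "0 < \<sigma>" using \<sigma> by (simp add: G_def P_def)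
    have finG: "finite (G n \<inter> {\<sigma>..})"
      by (rule finite_subset[OF _ fin[OF \<open>0 < \<sigma>\<close>]]) (auto simp: G_def)
    let ?m = "Max (G n \<inter> {\<sigma>..})"
    have m: "?m \<in> G n \<inter> {\<sigma>..}" using \<sigma> by (intro Max_in finG) auto
    have "\<tau> \<le> ?m" if "\<tau> \<in> G n" for \<tau>
    proof (cases "\<sigma> \<le> \<tau>")
      case True
      thus ?thesis using that by (intro Max_ge finG) auto
    next
      case False
      thus ?thesis using m by auto
    qed
    thus ?thesis using m by (intro bexI[of _ ?m]) auto
  qed
  define s where "s = (\<lambda>n. if G n = {} then 0 else SOME m. m \<in> G n \<and> (\<forall>\<tau>\<in>G n. \<tau> \<le> m))"
  have s: "s n \<in> G n" "\<tau> \<le> s n" if "\<tau> \<in> G n" for n \<tau>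
  proof -
    have ne: "G n \<noteq> {}" using that by auto
    have "\<exists>m. m \<in> G n \<and> (\<forall>\<tau>\<in>G n. \<tau> \<le> m)" using max_G[OF ne] by (simp add: Bex_def)
    from someI_ex[OF this] show "s n \<in> G n" "\<tau> \<le> s n" using ne that by (simp_all add: s_def)
  qed
  have s_pos: "s n \<in> G n" if "0 < s n" for n
  proof -
    have "G n \<noteq> {}" using that by (auto simp: s_def)
    then obtain \<tau> where "\<tau> \<in> G n" by blast
    thus ?thesis by (rule s(1))
  qed
  have s_nonneg: "0 \<le> s n" for n
  proof (cases "G n = {}")
    case True
    thus ?thesis by (simp add: s_def)
  next
    case False
    then obtain \<tau> where "\<tau> \<in> G n" by blast
    hence "s n \<in> G n" by (rule s(1))
    thus ?thesis by (simp add: G_def P_def)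
  qed
  have least: "\<exists>\<tau>\<in>Q. \<forall>\<sigma>\<in>Q. \<tau> \<le> \<sigma>" if "finite Q" "Q \<noteq> {}" for Q :: "real set"
    using that by (intro bexI[of _ "Min Q"]) auto
  have ge_iff: "\<sigma> \<le> s n \<longleftrightarrow> n < N \<sigma>" if \<sigma>: "0 < \<sigma>" for \<sigma> n
  proof
    assume n: "n < N \<sigma>"
    hence "P \<inter> {\<sigma>..} \<noteq> {}" by (auto simp: N_def)
    then obtain \<tau> where \<tau>: "\<tau> \<in> P \<inter> {\<sigma>..}" "\<And>\<rho>. \<rho> \<in> P \<inter> {\<sigma>..} \<Longrightarrow> \<tau> \<le> \<rho>" using least[OF fin[OF \<sigma>]] by blast
    hence "P \<inter> {\<tau>..} = P \<inter> {\<sigma>..}" by auto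
    hence "\<tau> \<in> G n" using n \<tau>(1) by (simp add: G_def N_def)
    thus "\<sigma> \<le> s n" using s(2) \<tau>(1) by fastforce
  next
    assume le: "\<sigma> \<le> s n"
    hence "n < N (s n)" using s_pos[of n] \<sigma> by (simp add: G_def)
    also have "\<dots> \<le> N \<sigma>" by (rule N_mono[OF \<sigma> le])
    finally show "n < N \<sigma>" .
  qed
  have gr_iff: "\<sigma> < s n \<longleftrightarrow> n < N' \<sigma>" if \<sigma>: "0 < \<sigma>" for \<sigma> n
  proof
    assume n: "n < N' \<sigma>"
    hence "P \<inter> {\<sigma><..} \<noteq> {}" by (auto simp: N'_def)
    then obtain \<tau> where \<tau>: "\<tau> \<in> P \<inter> {\<sigma><..}" "\<And>\<rho>. \<rho> \<in> P \<inter> {\<sigma><..} \<Longrightarrow> \<tau> \<le> \<rho>" using least[OF fin'[OF \<sigma>]] by blast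
    hence "P \<inter> {\<tau>..} = P \<inter> {\<sigma><..}" by auto
    hence "\<tau> \<in> G n" using n \<tau>(1) by (simp add: G_def N_def N'_def)
    thus "\<sigma> < s n" using s(2) \<tau>(1) by fastforce
  next
    assume less: "\<sigma> < s n"
    hence "n < N (s n)" using s_pos[of n] \<sigma> by (simp add: G_def)
    also have "\<dots> \<le> N' \<sigma>"
      unfolding N_def N'_def by (rule sum_mono2[OF fin'[OF \<sigma>]]) (use less in auto)
    finally show "n < N' \<sigma>" .
  qed
  have level: "{n. s n = \<sigma>} = {N' \<sigma>..<N \<sigma>}" if \<sigma>: "0 < \<sigma>" for \<sigma>
  proof -
    have "s n = \<sigma> \<longleftrightarrow> \<sigma> \<le> s n \<and> \<not> \<sigma> < s n" for n by auto
    hence eq: "s n = \<sigma> \<longleftrightarrow> n < N \<sigma> \<and> \<not> n < N' \<sigma>" for n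
      by (simp only: ge_iff[OF \<sigma>] gr_iff[OF \<sigma>])
    show ?thesis unfolding eq by auto
  qed
  have "decseq s"
  proof (rule decseq_SucI)
    fix n
    show "s (Suc n) \<le> s n"
    proof (cases "0 < s (Suc n)")
      case True
      hence "Suc n < N (s (Suc n))" using ge_iff[of "s (Suc n)" "Suc n"] by simp
      hence "n < N (s (Suc n))" by simp
      thus ?thesis using ge_iff[OF True] by simp
    next
      case False
      thus ?thesis using s_nonneg[of n] by linarith
    qed
  qed
  moreover have "finite {n. s n = \<sigma>} \<and> card {n. s n = \<sigma>} = \<mu> \<sigma>" if "0 < \<sigma>" for \<sigma>
    unfolding level[OF that] by (simp add: N_split[OF that])
  moreover have "s n * real (Suc n) \<le> A" for n
  proof (cases "0 < s n")
    case True
    hence "Suc n \<le> N (s n)" using ge_iff[of "s n" n] by simp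
    hence "s n * real (Suc n) \<le> s n * real (N (s n))" using True by (intro mult_left_mono) auto
    also have "\<dots> = real (\<Sum>\<sigma>\<in>P \<inter> {s n..}. \<mu> \<sigma>) * s n" by (simp only: N_def mult.commute)
    also have "\<dots> \<le> A" by (rule bound[OF True fin[OF True]]) auto
    finally show ?thesis .
  next
    case False
    hence "s n = 0" using s_nonneg[of n] by linarith
    thus ?thesis using A0 by simp
  qed
  ultimately show ?thesis using s_nonneg by blast
qed

lemma bounded_linear_scaleC_left: "bounded_linear (\<lambda>c. scaleC c f)"
proof (rule bounded_linear_intro)
  show "scaleC (c + c') f = scaleC c f + scaleC c' f" for c c' by (rule hardy.scale_left_distrib)
  show "scaleC (r *\<^sub>R c) f = r *\<^sub>R scaleC c f" for r c
    by (simp add: scaleR_hardy_def scaleR_conv_of_real)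
  show "norm (scaleC c f) \<le> norm c * norm f" for c by simp
qed

lemma summable_const_over_Suc_sq: "summable (\<lambda>n. (C / real (Suc n))\<^sup>2)"
proof -
  have "summable (\<lambda>n. inverse (real (Suc n) ^ 2))"
    using inverse_power_summable[of 2, where ?'a = real] by (subst summable_Suc_iff) simp
  hence "summable (\<lambda>n. C\<^sup>2 * inverse (real (Suc n) ^ 2))" by (rule summable_mult)
  thus ?thesis by (simp only: divide_inverse power_mult_distrib power_inverse)
qed

text \<open>
  A Hilbert cube for the grading. It is the image of a compact set of coefficient families in the
  product topology; the truncations to finitely many degrees are continuous there, and they converge
  uniformly because the squares of \<open>C / (n + 1)\<close> are summable.
\<close>

lemma compact_component_box:
  assumes C: "0 \<le> C"
  shows "compact {f :: 'd::finite hardy. \<forall>n. norm (component n f) * real (Suc n) \<le> C}"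
proof -
  define r where "r = (\<lambda>n. (C / real (Suc n))\<^sup>2)"
  have r: "summable r" "\<And>n. 0 \<le> r n" unfolding r_def by (rule summable_const_over_Suc_sq) simp
  define Y where "Y = {a :: ('d \<Rightarrow>\<^sub>0 nat) \<Rightarrow> complex. \<forall>n. (\<Sum>\<gamma> | mdeg \<gamma> = n. (cmod (a \<gamma>))\<^sup>2) \<le> r n}"
  have ss: "square_summable a" if a: "a \<in> Y" for a
  proof (rule square_summable_by_degree)
    fix N
    have "(\<Sum>n<N. \<Sum>\<gamma> | mdeg \<gamma> = n. (cmod (a \<gamma>))\<^sup>2) \<le> (\<Sum>n<N. r n)"
      using a by (intro sum_mono) (auto simp: Y_def)
    also have "\<dots> \<le> suminf r" by (rule sum_le_suminf) (use r in auto)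
    finally show "(\<Sum>n<N. \<Sum>\<gamma> | mdeg \<gamma> = n. (cmod (a \<gamma>))\<^sup>2) \<le> suminf r" .
  qed
  have "compact Y"
  proof -
    have "closed Y"
      unfolding Y_def
      by (intro closed_Collect_all closed_Collect_le continuous_intros continuous_on_product_coordinates)
    moreover have "compact (PiE UNIV (\<lambda>_ :: 'd \<Rightarrow>\<^sub>0 nat. cball (0 :: complex) C))"
      unfolding compactin_euclidean_iff[symmetric] euclidean_product_topology[symmetric] compactin_PiE
      by simp
    moreover have "Y \<subseteq> PiE UNIV (\<lambda>_. cball 0 C)"
    proof
      fix a assume a: "a \<in> Y"
      have "cmod (a \<gamma>) \<le> C" for \<gamma>
      proof -
        have "(cmod (a \<gamma>))\<^sup>2 \<le> (\<Sum>\<delta> | mdeg \<delta> = mdeg \<gamma>. (cmod (a \<delta>))\<^sup>2)"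
          by (rule member_le_sum) (auto simp: finite_mdeg_eq)
        also have "\<dots> \<le> r (mdeg \<gamma>)" using a by (auto simp: Y_def)
        also have "\<dots> \<le> C\<^sup>2"
          unfolding r_def using C by (intro power_mono) (auto simp: divide_le_eq mult_le_cancel_left1)
        finally show ?thesis using C by (rule power2_le_imp_le)
      qed
      thus "a \<in> PiE UNIV (\<lambda>_. cball 0 C)" by auto
    qed
    ultimately show ?thesis by (metis compact_Int_closed inf.absorb_iff2)
  qed
  define F where "F = (\<lambda>N a. \<Sum>\<gamma> | mdeg \<gamma> < N. scaleC (a \<gamma>) (hardy_of_poly (Poly_Mapping.single \<gamma> 1) :: 'd hardy))"
  have fin: "finite {\<gamma> :: 'd \<Rightarrow>\<^sub>0 nat. mdeg \<gamma> < N}" for N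
    by (rule finite_subset[OF _ finite_mdeg_le[of N]]) auto
  have F_coeff: "hardy_coeff (F N a) \<delta> = (if mdeg \<delta> < N then a \<delta> else 0)" for N a \<delta>
  proof -
    have "hardy_coeff (F N a) \<delta> = (\<Sum>\<gamma> | mdeg \<gamma> < N. if \<gamma> = \<delta> then a \<delta> else 0)"
      unfolding F_def hardy_coeff_sum by (rule sum.cong) (auto simp: lookup_single when_def)
    thus ?thesis using fin by simp
  qed
  have cont_F: "continuous_on Y (F N)" for N
    unfolding F_def
    by (intro continuous_on_sum bounded_linear.continuous_on[OF bounded_linear_scaleC_left]
        continuous_on_product_coordinates[THEN continuous_on_subset]) auto
  have dist_F: "(norm (F N a - hardy_of_coeff a))\<^sup>2 \<le> suminf (\<lambda>n. r (n + N))" if a: "a \<in> Y" for N a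
  proof -
    let ?g = "F N a - hardy_of_coeff a"
    have cf: "hardy_coeff ?g \<gamma> = (if mdeg \<gamma> < N then 0 else - a \<gamma>)" for \<gamma>
      using hardy_coeff_of_coeff[OF ss[OF a]] by (simp add: F_coeff)
    have comp: "(norm (component n ?g))\<^sup>2 = (if n < N then 0 else \<Sum>\<gamma> | mdeg \<gamma> = n. (cmod (a \<gamma>))\<^sup>2)" for n
      unfolding norm_component_sq cf by (cases "n < N") (auto intro!: sum.cong sum.neutral)
    have sums: "summable (\<lambda>n. (norm (component n ?g))\<^sup>2)" "(norm ?g)\<^sup>2 = suminf (\<lambda>n. (norm (component n ?g))\<^sup>2)"
      using norm_sq_sums[of ?g] by (simp_all add: sums_iff)
    have "(norm ?g)\<^sup>2 = suminf (\<lambda>n. (norm (component (n + N) ?g))\<^sup>2) + (\<Sum>n<N. (norm (component n ?g))\<^sup>2)"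
      unfolding sums(2) by (rule suminf_split_initial_segment[OF sums(1)])
    also have "(\<Sum>n<N. (norm (component n ?g))\<^sup>2) = 0" unfolding comp by simp
    also have "suminf (\<lambda>n. (norm (component (n + N) ?g))\<^sup>2) \<le> suminf (\<lambda>n. r (n + N))"
    proof (rule suminf_le)
      show "(norm (component (n + N) ?g))\<^sup>2 \<le> r (n + N)" for n
        unfolding comp using a r(2) by (auto simp: Y_def)
      show "summable (\<lambda>n. (norm (component (n + N) ?g))\<^sup>2)" using sums(1) by (rule summable_ignore_initial_segment)
      show "summable (\<lambda>n. r (n + N))" using r(1) by (rule summable_ignore_initial_segment)
    qed
    finally show ?thesis by simp
  qed
  have "uniform_limit Y F hardy_of_coeff sequentially"
    unfolding uniform_limit_sequentially_iff
  proof (intro allI impI)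
    fix e :: real assume e: "0 < e"
    obtain N0 where N0: "\<And>N. N0 \<le> N \<Longrightarrow> norm (suminf (\<lambda>n. r (n + N))) < e\<^sup>2"
      using suminf_exist_split[OF _ r(1), of "e\<^sup>2"] e by auto
    have "dist (F N a) (hardy_of_coeff a) < e" if "N0 \<le> N" "a \<in> Y" for N a
    proof -
      have "(norm (F N a - hardy_of_coeff a))\<^sup>2 < e\<^sup>2"
        using dist_F[OF that(2), of N] N0[OF that(1)] by simp
      thus ?thesis using e by (simp add: dist_norm power_less_imp_less_base)
    qed
    thus "\<exists>N. \<forall>n\<ge>N. \<forall>x\<in>Y. dist (F n x) (hardy_of_coeff x) < e" by blast
  qed
  hence "continuous_on Y hardy_of_coeff"
    by (rule uniform_limit_theorem[OF always_eventually[OF allI[OF cont_F]]]) simp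
  hence "compact (hardy_of_coeff ` Y)" using \<open>compact Y\<close> by (rule compact_continuous_image)
  also have "hardy_of_coeff ` Y = {f. \<forall>n. norm (component n f) * real (Suc n) \<le> C}"
  proof -
    have iff: "x\<^sup>2 \<le> r n \<longleftrightarrow> x * real (Suc n) \<le> C" if x: "0 \<le> x" for x n
    proof -
      have "x\<^sup>2 \<le> r n \<longleftrightarrow> x \<le> C / real (Suc n)"
        unfolding r_def using x C by (intro power_mono_iff divide_nonneg_nonneg) auto
      thus ?thesis by (simp add: pos_le_divide_eq del: of_nat_Suc)
    qed
    have "hardy_of_coeff a \<in> {f. \<forall>n. norm (component n f) * real (Suc n) \<le> C}" if a: "a \<in> Y" for a
    proof -
      have "(norm (component n (hardy_of_coeff a)))\<^sup>2 \<le> r n" for n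
        using a unfolding norm_component_sq hardy_coeff_of_coeff[OF ss[OF a]] by (simp add: Y_def)
      thus ?thesis using iff[OF norm_ge_zero] by blast
    qed
    moreover have "f \<in> hardy_of_coeff ` Y" if f: "\<forall>n. norm (component n f) * real (Suc n) \<le> C" for f
    proof
      have "(norm (component n f))\<^sup>2 \<le> r n" for n using f iff[OF norm_ge_zero] by blast
      thus "hardy_coeff f \<in> Y" by (simp only: Y_def norm_component_sq mem_Collect_eq) blast
      show "f = hardy_of_coeff (hardy_coeff f)"
        by (rule hardy_eqI) (simp add: hardy_coeff_of_coeff square_summable_hardy_coeff)
    qed
    ultimately show ?thesis by blast
  qed
  finally show ?thesis .
qed

section \<open>Essential normality\<close>

text \<open>
  The union of bases of pairwise orthogonal subspaces is linearly independent.
\<close>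

lemma orthogonal_families_dim_bound:
  fixes E :: "'i \<Rightarrow> 'd::finite hardy set"
  assumes S: "finite S" and X: "finite X"
    and sub: "\<And>\<sigma>. \<sigma> \<in> S \<Longrightarrow> hardy.subspace (E \<sigma>)"
    and span: "\<And>\<sigma>. \<sigma> \<in> S \<Longrightarrow> E \<sigma> \<subseteq> hardy.span X"
    and orth: "\<And>\<sigma> \<tau> f g. \<sigma> \<in> S \<Longrightarrow> \<tau> \<in> S \<Longrightarrow> \<sigma> \<noteq> \<tau> \<Longrightarrow> f \<in> E \<sigma> \<Longrightarrow> g \<in> E \<tau> \<Longrightarrow> cinner f g = 0"
  shows "(\<Sum>\<sigma>\<in>S. hardy.dim (E \<sigma>)) \<le> card X"
proof -
  have "\<forall>\<sigma>. \<exists>B. \<sigma> \<in> S \<longrightarrow> finite B \<and> B \<subseteq> E \<sigma> \<and> hardy.independent B \<and> card B = hardy.dim (E \<sigma>)"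
    using finite_dim_basis[OF X span] by metis
  then obtain B where "\<forall>\<sigma>. \<sigma> \<in> S \<longrightarrow> finite (B \<sigma>) \<and> B \<sigma> \<subseteq> E \<sigma> \<and> hardy.independent (B \<sigma>) \<and> card (B \<sigma>) = hardy.dim (E \<sigma>)"
    by metis
  hence B: "finite (B \<sigma>)" "B \<sigma> \<subseteq> E \<sigma>" "hardy.independent (B \<sigma>)" "card (B \<sigma>) = hardy.dim (E \<sigma>)" if "\<sigma> \<in> S" for \<sigma>
    using that by auto
  define U where "U = (\<Union>\<sigma>\<in>S. B \<sigma>)"
  have finU: "finite U" unfolding U_def using S B(1) by blast
  have self_orth: "f = 0" if "cinner f f = 0" for f :: "'d hardy"
  proof -
    have "Re (cinner f f) = 0" by (simp only: that zero_complex.simps)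
    thus ?thesis by (simp only: cinner_self_eq_0)
  qed
  have disj: "B \<sigma> \<inter> B \<tau> = {}" if "\<sigma> \<in> S" "\<tau> \<in> S" "\<sigma> \<noteq> \<tau>" for \<sigma> \<tau>
  proof (rule ccontr)
    assume "B \<sigma> \<inter> B \<tau> \<noteq> {}"
    then obtain f where f: "f \<in> B \<sigma>" "f \<in> B \<tau>" by blast
    hence "cinner f f = 0" using B(2) that by (intro orth[of \<sigma> \<tau>]) auto
    hence "f = 0" by (rule self_orth)
    thus False using f(1) B(3)[OF that(1)] hardy.dependent_zero by blast
  qed
  have "hardy.independent U"
  proof
    assume "hardy.dependent U"
    then obtain u where u: "\<exists>v\<in>U. u v \<noteq> 0" "(\<Sum>v\<in>U. scaleC (u v) v) = 0"
      using hardy.dependent_finite[OF finU] by blast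
    define x where "x = (\<lambda>\<sigma>. \<Sum>v\<in>B \<sigma>. scaleC (u v) v)"
    have x_in: "x \<sigma> \<in> E \<sigma>" if "\<sigma> \<in> S" for \<sigma>
      unfolding x_def using B(2)[OF that] sub[OF that]
      by (intro hardy.subspace_sum hardy.subspace_scale) auto
    have "(\<Sum>v\<in>U. scaleC (u v) v) = (\<Sum>\<sigma>\<in>S. x \<sigma>)"
      unfolding U_def x_def using S B(1) disj by (intro sum.UNION_disjoint) auto
    hence sum0: "(\<Sum>\<sigma>\<in>S. x \<sigma>) = 0" using u(2) by simp
    have "x \<tau> = 0" if \<tau>: "\<tau> \<in> S" for \<tau>
    proof (rule self_orth)
      have "cinner (x \<tau>) (\<Sum>\<sigma>\<in>S. x \<sigma>) = (\<Sum>\<sigma>\<in>S. cinner (x \<tau>) (x \<sigma>))"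
        by (rule linear_sum[OF bounded_linear.linear[OF bounded_linear_cinner]])
      also have "\<dots> = cinner (x \<tau>) (x \<tau>) + (\<Sum>\<sigma>\<in>S - {\<tau>}. cinner (x \<tau>) (x \<sigma>))"
        by (rule sum.remove[OF S \<tau>])
      also have "(\<Sum>\<sigma>\<in>S - {\<tau>}. cinner (x \<tau>) (x \<sigma>)) = 0"
      proof (intro sum.neutral ballI)
        fix \<sigma> assume "\<sigma> \<in> S - {\<tau>}"
        thus "cinner (x \<tau>) (x \<sigma>) = 0" using \<tau> by (intro orth[of \<tau> \<sigma>] x_in) auto
      qed
      finally show "cinner (x \<tau>) (x \<tau>) = 0" by (simp add: sum0)
    qed
    hence "u v = 0" if "\<tau> \<in> S" "v \<in> B \<tau>" for \<tau> v
      using hardy.dependent_finite[OF B(1)[OF that(1)]] B(3)[OF that(1)] that(2)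
      unfolding x_def using that(1) by blast
    thus False using u(1) unfolding U_def by blast
  qed
  moreover have "U \<subseteq> hardy.span X" unfolding U_def using B(2) span by blast
  ultimately have "card U \<le> card X" using hardy.independent_span_bound[OF X] by blast
  moreover have "card U = (\<Sum>\<sigma>\<in>S. card (B \<sigma>))"
    unfolding U_def using S B(1) disj by (intro card_UN_disjoint) auto
  ultimately show ?thesis using B(4) by simp
qed

context graded_coinvariant
begin

text \<open>
  An operator \<open>T\<close> with adjoint \<open>T'\<close> that respects the grading and has norm at most \<open>C / (n + 1)\<close> in
  degree \<open>n\<close>. It maps the unit ball into a compact box. An eigenvector of \<open>T' T\<close> for \<open>\<sigma>\<^sup>2\<close> has no
  component of degree \<open>n\<close> if \<open>C < \<sigma> (n + 1)\<close>, so the eigenspaces for \<open>\<sigma> \<ge> \<epsilon>\<close>, which are pairwise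
  orthogonal, lie in a sum of at most \<open>C / \<epsilon>\<close> parts of dimension at most \<open>D\<close>.
\<close>

lemma weak_schatten_1I:
  assumes T_in: "\<And>f. f \<in> M \<Longrightarrow> T f \<in> M"
    and T_add: "\<And>f g. f \<in> M \<Longrightarrow> g \<in> M \<Longrightarrow> T (f + g) = T f + T g"
    and T_scale: "\<And>f c. f \<in> M \<Longrightarrow> T (scaleC c f) = scaleC c (T f)"
    and T'_in: "\<And>f. f \<in> M \<Longrightarrow> T' f \<in> M"
    and T'_add: "\<And>f g. f \<in> M \<Longrightarrow> g \<in> M \<Longrightarrow> T' (f + g) = T' f + T' g"
    and T'_scale: "\<And>f c. f \<in> M \<Longrightarrow> T' (scaleC c f) = scaleC c (T' f)"
    and adj: "\<And>f h. f \<in> M \<Longrightarrow> h \<in> M \<Longrightarrow> cinner (T f) h = cinner f (T' h)"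
    and T_comp: "\<And>f n. f \<in> M \<Longrightarrow> component n (T f) = T (component n f)"
    and T'_comp: "\<And>f n. f \<in> M \<Longrightarrow> component n (T' f) = T' (component n f)"
    and C: "0 \<le> C" and bound: "\<And>f n. f \<in> part n \<Longrightarrow> norm (T f) * real (Suc n) \<le> C * norm f"
  shows "T \<in> weak_schatten 1 M"
proof -
  have compact: "compact (closure (T ` (M \<inter> cball 0 1)))"
  proof -
    let ?K = "{f :: 'd hardy. \<forall>n. norm (component n f) * real (Suc n) \<le> C}"
    have K: "compact ?K" by (rule compact_component_box[OF C])
    have "T f \<in> ?K" if "f \<in> M \<inter> cball 0 1" for f
    proof -
      have f: "f \<in> M" "norm f \<le> 1" using that by auto
      have "norm (component n (T f)) * real (Suc n) \<le> C" for n
      proof -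
        have "norm (component n (T f)) * real (Suc n) \<le> C * norm (component n f)"
          unfolding T_comp[OF f(1)] by (rule bound[OF component_in_part[OF f(1)]])
        also have "\<dots> \<le> C * 1"
          using norm_component_le[of n f] f(2) C by (intro mult_left_mono) auto
        finally show ?thesis by simp
      qed
      thus ?thesis by blast
    qed
    hence "T ` (M \<inter> cball 0 1) \<subseteq> ?K" by blast
    hence "closure (T ` (M \<inter> cball 0 1)) \<subseteq> ?K" by (rule closure_minimal[OF _ compact_imp_closed[OF K]])
    hence "closure (T ` (M \<inter> cball 0 1)) = ?K \<inter> closure (T ` (M \<inter> cball 0 1))" by blast
    also have "compact \<dots>" by (rule compact_Int_closed[OF K closed_closure])
    finally show ?thesis .
  qed
  have compact_op: "compact_operator_on M T"
    unfolding compact_operator_on_def using T_in T_add T_scale compact by blast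
  have adjoint: "adjoint_on M T f = T' f" if f: "f \<in> M" for f
    by (rule adjoint_onI[OF f T'_in[OF f]]) (simp add: adj f)
  define E where "E = (\<lambda>\<sigma>. {f \<in> M. T' (T f) = scaleC (complex_of_real (\<sigma>\<^sup>2)) f})"
  have E_eq: "{f \<in> M. adjoint_on M T (T f) = scaleC (complex_of_real (\<sigma>\<^sup>2)) f} = E \<sigma>" for \<sigma>
    using adjoint T_in by (auto simp: E_def)
  have E_sub: "hardy.subspace (E \<sigma>)" for \<sigma>
  proof (rule hardy.subspaceI)
    have T0: "T 0 = 0" using T_scale[of 0 0] hardy.subspace_0[OF subspace] by simp
    have T'0: "T' 0 = 0" using T'_scale[of 0 0] hardy.subspace_0[OF subspace] by simp
    show "0 \<in> E \<sigma>" using hardy.subspace_0[OF subspace] by (simp add: E_def T0 T'0)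
    show "f + g \<in> E \<sigma>" if "f \<in> E \<sigma>" "g \<in> E \<sigma>" for f g
      using that hardy.subspace_add[OF subspace]
      by (simp add: E_def T_add T'_add T_in hardy.scale_right_distrib)
    show "scaleC c f \<in> E \<sigma>" if "f \<in> E \<sigma>" for c f
      using that hardy.subspace_scale[OF subspace]
      by (simp add: E_def T_scale T'_scale T_in mult.commute)
  qed
  have E_orth: "cinner f g = 0" if "0 < \<sigma>" "0 < \<tau>" "\<sigma> \<noteq> \<tau>" "f \<in> E \<sigma>" "g \<in> E \<tau>" for \<sigma> \<tau> f g
  proof -
    have f: "f \<in> M" "T' (T f) = scaleC (complex_of_real (\<sigma>\<^sup>2)) f"
      and g: "g \<in> M" "T' (T g) = scaleC (complex_of_real (\<tau>\<^sup>2)) g" using that by (auto simp: E_def)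
    have "cinner (T f) (T g) = complex_of_real (\<tau>\<^sup>2) * cinner f g"
      using adj[OF f(1) T_in[OF g(1)]] by (simp add: g(2) cinner_scaleC_right)
    moreover have "cinner (T f) (T g) = complex_of_real (\<sigma>\<^sup>2) * cinner f g"
    proof -
      have "cinner (T f) (T g) = cnj (cinner (T g) (T f))" by (rule cinner_commute)
      also have "\<dots> = cnj (cinner g (T' (T f)))" using adj[OF g(1) T_in[OF f(1)]] by simp
      also have "\<dots> = cinner (T' (T f)) g" by (rule cinner_commute[symmetric])
      finally show ?thesis by (simp add: f(2) cinner_scaleC_left)
    qed
    ultimately have "(complex_of_real (\<sigma>\<^sup>2) - complex_of_real (\<tau>\<^sup>2)) * cinner f g = 0"
      by (simp add: left_diff_distrib)
    moreover have "complex_of_real (\<sigma>\<^sup>2) \<noteq> complex_of_real (\<tau>\<^sup>2)"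
      using that unfolding of_real_eq_iff by (simp add: power2_eq_iff_nonneg)
    ultimately show ?thesis by simp
  qed
  have E_comp: "component n f = 0" if \<sigma>: "0 < \<sigma>" and f: "f \<in> E \<sigma>" and n: "C < \<sigma> * real (Suc n)" for \<sigma> f n
  proof (rule ccontr)
    let ?g = "component n f"
    assume "?g \<noteq> 0"
    have fM: "f \<in> M" and eig: "T' (T f) = scaleC (complex_of_real (\<sigma>\<^sup>2)) f" using f by (auto simp: E_def)
    have g: "?g \<in> M" "?g \<in> part n" using fM component_in component_in_part by auto
    have "T' (T ?g) = component n (T' (T f))"
      by (simp only: T_comp[OF fM, symmetric] T'_comp[OF T_in[OF fM]])
    hence "T' (T ?g) = scaleC (complex_of_real (\<sigma>\<^sup>2)) ?g" by (simp only: eig component_scaleC)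
    hence "cinner (T ?g) (T ?g) = complex_of_real (\<sigma>\<^sup>2) * cinner ?g ?g"
      using adj[OF g(1) T_in[OF g(1)]] by (simp add: cinner_scaleC_right)
    hence "complex_of_real ((norm (T ?g))\<^sup>2) = complex_of_real ((\<sigma> * norm ?g)\<^sup>2)"
      unfolding cinner_self_norm by (simp add: power_mult_distrib)
    hence "(norm (T ?g))\<^sup>2 = (\<sigma> * norm ?g)\<^sup>2" by (simp only: of_real_eq_iff)
    hence "norm (T ?g) = \<sigma> * norm ?g" using \<sigma> by (simp add: power2_eq_iff_nonneg)
    hence "(\<sigma> * real (Suc n)) * norm ?g \<le> C * norm ?g" using bound[OF g(2)] by (simp only: mult_ac)
    moreover have "0 < norm ?g" using \<open>?g \<noteq> 0\<close> by simp
    ultimately have "\<sigma> * real (Suc n) \<le> C" by (rule mult_right_le_imp_le)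
    thus False using n by simp
  qed
  obtain D where D: "\<And>n. hardy.dim (part n) \<le> D" using part_dim_bounded by metis
  have "\<forall>n. \<exists>B. finite B \<and> part n \<subseteq> hardy.span B \<and> card B \<le> D"
  proof
    fix n
    obtain B0 where B0: "finite B0" "part n \<subseteq> hardy.span B0" using part_finite_dim by blast
    obtain B where "finite B" "part n \<subseteq> hardy.span B" "card B = hardy.dim (part n)"
      using finite_dim_basis[OF B0] by metis
    thus "\<exists>B. finite B \<and> part n \<subseteq> hardy.span B \<and> card B \<le> D" using D[of n] by auto
  qed
  then obtain B where B: "\<And>n. finite (B n) \<and> part n \<subseteq> hardy.span (B n) \<and> card (B n) \<le> D" by metis
  have count: "real (\<Sum>\<sigma>\<in>S. hardy.dim (E \<sigma>)) * \<epsilon> \<le> real D * C"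
    if \<epsilon>: "0 < \<epsilon>" and S: "finite S" "S \<subseteq> {\<epsilon>..}" for \<epsilon> S
  proof -
    \<comment> \<open>Eigenvectors for \<open>\<sigma> \<ge> \<epsilon>\<close> have no components of degree \<open>N\<close> or more.\<close>
    define N where "N = nat \<lfloor>C / \<epsilon>\<rfloor>"
    have N_le: "real N \<le> C / \<epsilon>" unfolding N_def using C \<epsilon> by simp
    have N_gt: "C < \<epsilon> * real (Suc n)" if "N \<le> n" for n
    proof -
      have "C / \<epsilon> < real (Suc n)" using that unfolding N_def by linarith
      thus ?thesis using \<epsilon> by (simp add: field_simps)
    qed
    define X where "X = (\<Union>n<N. B n)"
    have X: "finite X" unfolding X_def using B by blast
    have "card X \<le> (\<Sum>n<N. card (B n))" unfolding X_def by (rule card_UN_le) simp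
    also have "\<dots> \<le> (\<Sum>n<N. D)" using B by (intro sum_mono) blast
    finally have card_X: "card X \<le> N * D" by simp
    have "E \<sigma> \<subseteq> hardy.span X" if \<sigma>: "\<sigma> \<in> S" for \<sigma>
    proof
      fix f assume f: "f \<in> E \<sigma>"
      have \<epsilon>\<sigma>: "\<epsilon> \<le> \<sigma>" using \<sigma> S(2) by auto
      have fM: "f \<in> M" using f by (simp add: E_def)
      have zero: "component n f = 0" if "N \<le> n" for n
      proof (rule E_comp[OF _ f])
        show "0 < \<sigma>" using \<epsilon> \<epsilon>\<sigma> by simp
        have "\<epsilon> * real (Suc n) \<le> \<sigma> * real (Suc n)" using \<epsilon>\<sigma> by (intro mult_right_mono) auto
        thus "C < \<sigma> * real (Suc n)" using N_gt[OF that] by linarith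
      qed
      have "f = (\<Sum>n<N. component n f)"
      proof (rule hardy_eqI)
        fix \<gamma>
        have "hardy_coeff (component (mdeg \<gamma>) f) \<gamma> = 0" if "N \<le> mdeg \<gamma>" using zero[OF that] by simp
        thus "hardy_coeff f \<gamma> = hardy_coeff (\<Sum>n<N. component n f) \<gamma>"
          by (cases "mdeg \<gamma> < N") (auto simp: hardy_coeff_sum)
      qed
      also have "\<dots> \<in> hardy.span X"
      proof (rule hardy.span_sum)
        fix n assume n: "n \<in> {..<N}"
        have "component n f \<in> hardy.span (B n)" using B component_in_part[OF fM] by blast
        moreover have "hardy.span (B n) \<subseteq> hardy.span X" using n by (intro hardy.span_mono) (auto simp: X_def)
        ultimately show "component n f \<in> hardy.span X" by blast
      qed
      finally show "f \<in> hardy.span X" .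
    qed
    moreover have "cinner f g = 0" if "\<sigma> \<in> S" "\<tau> \<in> S" "\<sigma> \<noteq> \<tau>" "f \<in> E \<sigma>" "g \<in> E \<tau>" for \<sigma> \<tau> f g
    proof (rule E_orth[of \<sigma> \<tau>])
      show "0 < \<sigma>" "0 < \<tau>" using that(1,2) S(2) \<epsilon> by force+
    qed (use that in auto)
    ultimately have "(\<Sum>\<sigma>\<in>S. hardy.dim (E \<sigma>)) \<le> card X"
      by (intro orthogonal_families_dim_bound[OF S(1) X E_sub])
    hence "(\<Sum>\<sigma>\<in>S. hardy.dim (E \<sigma>)) \<le> N * D" using card_X by simp
    hence "real (\<Sum>\<sigma>\<in>S. hardy.dim (E \<sigma>)) \<le> real (N * D)" by (rule of_nat_mono)
    hence "real (\<Sum>\<sigma>\<in>S. hardy.dim (E \<sigma>)) * \<epsilon> \<le> real N * real D * \<epsilon>"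
      using \<epsilon> unfolding of_nat_mult by (intro mult_right_mono) auto
    also have "\<dots> = real D * (real N * \<epsilon>)" by (simp only: mult_ac)
    also have "\<dots> \<le> real D * C"
      using N_le \<epsilon> by (intro mult_left_mono) (auto simp: field_simps)
    finally show ?thesis .
  qed
  obtain s where s: "decseq s" "\<forall>n. 0 \<le> s n"
    "\<forall>\<sigma>>0. finite {n. s n = \<sigma>} \<and> card {n. s n = \<sigma>} = hardy.dim (E \<sigma>)"
    "\<forall>n. s n * real (Suc n) \<le> real D * C"
    using exists_decreasing_enumeration[of "\<lambda>\<sigma>. hardy.dim (E \<sigma>)" "real D * C", OF count] by blast
  have "singular_values M T s"
    unfolding singular_values_def E_eq using s(1-3) by blast
  moreover have "s \<in> O(\<lambda>n. real (Suc n) powr (- 1 / 1))"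
  proof (rule bigoI[of _ "real D * C"], rule always_eventually, rule allI)
    fix n
    have "s n \<le> real D * C / real (Suc n)"
      using s(4) by (simp add: pos_le_divide_eq del: of_nat_Suc)
    thus "norm (s n) \<le> real D * C * norm (real (Suc n) powr (- 1 / 1))"
      using s(2) by (simp add: powr_minus divide_inverse del: of_nat_Suc)
  qed
  ultimately show ?thesis unfolding weak_schatten_def using compact_op by blast
qed

theorem essentially_normal_1: "essentially_normal 1 M"
  unfolding essentially_normal_def
proof (intro allI)
  fix i j
  let ?T = "commutator (adjoint_on M (compression M i)) (compression M j)"
  obtain C where "0 \<le> C \<and> (\<forall>i j n. \<forall>f\<in>part n. norm (cross_commutator i j f) * real (Suc n) \<le> C * norm f)"
    using cross_commutator_bound ..
  hence C: "0 \<le> C" "\<And>n f. f \<in> part n \<Longrightarrow> norm (cross_commutator i j f) * real (Suc n) \<le> C * norm f" by auto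
  note eq = commutator_eq_cross_commutator
  show "?T \<in> weak_schatten 1 M"
  proof (rule weak_schatten_1I[of ?T "cross_commutator j i" C])
    fix f g c n
    assume f: "f \<in> M"
    show "?T f \<in> M" "cross_commutator j i f \<in> M" by (simp_all add: eq f cross_commutator_in)
    show "?T (scaleC c f) = scaleC c (?T f)"
      using hardy.subspace_scale[OF subspace f] by (simp add: eq f cross_commutator_scaleC)
    show "cross_commutator j i (scaleC c f) = scaleC c (cross_commutator j i f)"
      by (rule cross_commutator_scaleC)
    show "component n (?T f) = ?T (component n f)"
      by (simp add: eq f component_in component_cross_commutator)
    show "component n (cross_commutator j i f) = cross_commutator j i (component n f)"
      by (rule component_cross_commutator[OF f])
    assume g: "g \<in> M"
    show "?T (f + g) = ?T f + ?T g"
      using hardy.subspace_add[OF subspace f g] by (simp add: eq f g cross_commutator_add)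
    show "cross_commutator j i (f + g) = cross_commutator j i f + cross_commutator j i g"
      by (rule cross_commutator_add)
    show "cinner (?T f) g = cinner f (cross_commutator j i g)"
      by (simp add: eq f cross_commutator_adjoint[OF f g])
  next
    fix f n assume f: "f \<in> part n"
    hence "f \<in> M" by (simp add: part_def)
    thus "norm (?T f) * real (Suc n) \<le> C * norm f" using C(2)[OF f] by (simp only: eq)
  qed (rule C(1))
qed

end

theorem theorem1p2:
  fixes I :: "'d::finite mpoly set"
  assumes "CARD('d) \<ge> 3"
    and "homogeneous_ideal I"
    and "zero_set I \<inter> frontier polydisc \<subseteq> torus"
  shows "essentially_normal 1 (quotient_module I)"
proof -
  interpret graded_coinvariant "quotient_module I"
    using assms by (intro graded_coinvariant_quotient_module) auto
  show ?thesis by (rule essentially_normal_1)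
qed

end
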